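(* Let $(a_m)_{m\geqslant 1}$ be a fixed sequence of complex numbers and $C\in\mathbb{C}$. Then the limit \[ \lim_{n\to\infty}\frac{1}{n}\sum_{k\leqslant n}a_k\left[\frac{n}{k}\right]=C \] exists if and only if the following two conditions hold: (1) $\sum_{k\leqslant n}a_k\left[\frac{n}{k}\right]\log k=o(n\log n)$ as $n\to\infty$; (2) $\lim_{\sigma\searrow 1}\sum_{m=1}^\infty \frac{a_m}{m^\sigma}=C$. Moreover, if condition (1) holds, then the series $\sum_{m=1}^\infty a_m m^{-\sigma}$ converges for every real $\sigma>1$.
   Context: $[x]$ denotes the integer part of a real number $x$. *)

theory Defs
  imports "HOL-Analysis.Analysis" "HOL-Library.Landau_Symbols"
begin

end

theory Submission
  imports Defs "HOL-Number_Theory.Prime_Powers" "HOL-Real_Asymp.Real_Asymp"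
begin

text \<open>
  Let \<open>S(n) = (\<Sum>k\<le>n. a k [n/k])\<close> and \<open>R(n) = S(n) / n\<close>. Condition (1) alone implies that \<open>R\<close> varies slowly
  in the strong sense that \<open>R(n') - R(n)\<close> tends to \<open>0\<close> uniformly for \<open>n \<le> n' \<le> n\<^sup>2\<close>. To see this, one
  replaces \<open>S(n)\<close> by \<open>\<Sum>k. a k (1 - ln k / l)\<^sub>+ ^ m [n/k]\<close> with \<open>l\<close> between \<open>ln n / 8\<close> and \<open>ln n / 4\<close>; in
  the latter sum only \<open>k \<le> n powr (1/4)\<close> occur, so \<open>[n/k]\<close> may be replaced by \<open>n/k\<close>, and after division
  by \<open>n\<close> the result depends on \<open>l\<close> only. The error of the first replacement is an average of sums
  \<open>\<Sum>k. a k ln k \<phi>(u ln k) [n/k]\<close> with a smooth cutoff \<open>\<phi>\<close>. Moebius inversion and partial summation express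
  them through the sums in (1) with a kernel built from \<open>\<Sum>d dvd j. \<mu>(d) \<phi>(u ln (e d))\<close>, which is an
  iterated finite difference of \<open>\<phi>\<close> over the primes dividing \<open>j\<close>. It is small unless \<open>j\<close> has few small
  prime factors, and a mean value estimate for multiplicative functions bounds its total variation.

  Since \<open>\<Sum>m. a m / m powr \<sigma>\<close> is a weighted mean of \<open>R\<close>, slow variation gives that its value at
  \<open>\<sigma> = 1 + 1 / ln n\<close> differs from \<open>R(n)\<close> by \<open>o(1)\<close>.
\<close>

section \<open>Divisor sums and Chebyshev bounds\<close>

text \<open>Condition (1) allows \<open>o(n * ln n)\<close>, and removing the factor
  \<open>ln k\<close> by interpolation gains only \<open>1 / l\<close> with \<open>l\<close> of size
  \<open>ln n\<close>. Hence the passage through Moebius inversion must not lose a logarithm: the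
  kernel \<open>V e\<close> that replaces the cutoff has to satisfy
  \<open>\<Sum>e\<le>n. e * \<bar>V e - V (Suc e)\<bar> = O(n)\<close>. The trivial bound
  \<open>2 ^ r\<close> for a Moebius sum over a number with \<open>r\<close> prime factors has a
  mean value of order \<open>ln n\<close> and is too weak for that. This obstacle dictates a cutoff
  with many derivatives; the truncated powers of \<open>1 - v\<close> are used, with an exponent
  fixed only after the constants of the mean value estimate are known.

  A second obstacle is that replacing \<open>[n/k]\<close> by \<open>n/k\<close> needs some
  polynomial bound on \<open>a k\<close>, while (1) speaks about sums only. The bound is taken from
  convergence of the Dirichlet series at \<open>\<sigma> = 2\<close>, so convergence is deduced from
  (1) without any appeal to slow variation.\<close>

lemma sum_dvd_hyperbola:
  fixes F :: "nat \<Rightarrow> nat \<Rightarrow> 'a::comm_monoid_add"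
  shows "(\<Sum>m=1..n. \<Sum>d | d dvd m. F d (m div d)) = (\<Sum>d=1..n. \<Sum>i=1..n div d. F d i)"
proof -
  have "(\<Sum>m=1..n. \<Sum>d | d dvd m. F d (m div d))
      = (\<Sum>(m,d)\<in>Sigma {1..n} (\<lambda>m. {d. d dvd m}). F d (m div d))"
    by (subst sum.Sigma) auto
  also have "\<dots> = (\<Sum>(d,i)\<in>Sigma {1..n} (\<lambda>d. {1..n div d}). F d i)"
    by (rule sum.reindex_bij_witness[of _ "\<lambda>(d,i). (d*i,d)" "\<lambda>(m,d). (d, m div d)"])
       (auto simp: Suc_le_eq div_le_mono less_eq_div_iff_mult_less_eq mult.commute
             intro!: Nat.gr0I intro: order.trans[OF dvd_imp_le])
  also have "\<dots> = (\<Sum>d=1..n. \<Sum>i=1..n div d. F d i)"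
    by (subst sum.Sigma) auto
  finally show ?thesis .
qed

text \<open>The condition \<open>d = \<Prod>(prime_factors d)\<close> says that \<open>d\<close> is positive and squarefree.\<close>

definition moebius :: "nat \<Rightarrow> real" where
  "moebius d = (if d = \<Prod>(prime_factors d) then (-1) ^ card (prime_factors d) else 0)"

lemma abs_moebius_le_1: "\<bar>moebius d\<bar> \<le> 1"
  by (simp add: moebius_def power_abs)

lemma prime_factors_prod_primes:
  fixes I :: "nat set"
  assumes "finite I" "\<And>p. p \<in> I \<Longrightarrow> prime p"
  shows "prime_factors (\<Prod>I) = I"
proof -
  have "prime_factorization (\<Prod>I) = prime_factorization (prod_mset (mset_set I))"
    by (simp add: prod_unfold_prod_mset)
  also have "\<dots> = mset_set I"
    by (rule prime_factorization_prod_mset_primes) (use assms in auto)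
  finally show ?thesis using assms by simp
qed

lemma prod_prime_factors_dvd:
  fixes n :: nat
  assumes "I \<subseteq> prime_factors n" "n > 0"
  shows "\<Prod>I dvd n"
proof -
  have fin: "finite I" using assms(1) finite_subset by blast
  have "mset_set I \<subseteq># prime_factorization n"
    using assms(1) fin by (metis finite_set_mset mset_set_set_mset_msubset msubset_mset_set_iff subset_mset.order_trans)
  hence "prod_mset (mset_set I) dvd prod_mset (prime_factorization n)"
    by (rule prod_mset_subset_imp_dvd)
  thus ?thesis using assms(2) by (simp add: prod_unfold_prod_mset prod_mset_prime_factorization_nat)
qed

text \<open>Only squarefree divisors contribute, and these are the products of sets of primes
  dividing \<open>n\<close>. The subset form becomes a finite difference once \<open>X\<close>
  depends on the logarithm of its argument.\<close>

lemma sum_dvd_moebius: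
  fixes X :: "nat \<Rightarrow> real"
  assumes "n > 0"
  shows "(\<Sum>d | d dvd n. moebius d * X d) = (\<Sum>I\<in>Pow (prime_factors n). (-1) ^ card I * X (\<Prod>I))"
proof -
  have "(\<Sum>d | d dvd n. moebius d * X d)
      = (\<Sum>d | d dvd n \<and> d = \<Prod>(prime_factors d). moebius d * X d)"
    by (rule sum.mono_neutral_right) (use assms in \<open>auto simp: moebius_def\<close>)
  also have "\<dots> = (\<Sum>I\<in>Pow (prime_factors n). (-1) ^ card I * X (\<Prod>I))"
  proof (rule sum.reindex_bij_witness[of _ "\<lambda>I. \<Prod>I" prime_factors])
    fix d assume d: "d \<in> {d. d dvd n \<and> d = \<Prod>(prime_factors d)}"
    thus "\<Prod>(prime_factors d) = d" by simp
    show "prime_factors d \<in> Pow (prime_factors n)"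
      using d assms dvd_prime_factors by auto
    show "(-1) ^ card (prime_factors d) * X (\<Prod>(prime_factors d)) = moebius d * X d"
      using d by (simp add: moebius_def)
  next
    fix I assume I: "I \<in> Pow (prime_factors n)"
    have "finite I" using I finite_subset by blast
    thus *: "prime_factors (\<Prod>I) = I"
      using I by (intro prime_factors_prod_primes) auto
    show "\<Prod>I \<in> {d. d dvd n \<and> d = \<Prod>(prime_factors d)}"
      using prod_prime_factors_dvd[of I n] I assms * by simp
  qed
  finally show ?thesis .
qed

lemma sum_Pow_insert:
  fixes F :: "'b set \<Rightarrow> 'a::comm_monoid_add"
  assumes "finite A" "x \<notin> A"
  shows "sum F (Pow (insert x A)) = sum F (Pow A) + (\<Sum>I\<in>Pow A. F (insert x I))"
proof -
  have "inj_on (insert x) (Pow A)" using assms(2) by (auto simp: inj_on_def)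
  moreover have "Pow A \<inter> insert x ` Pow A = {}" using assms(2) by auto
  ultimately show ?thesis
    using assms(1) by (simp add: Pow_insert sum.union_disjoint sum.reindex)
qed

text \<open>Subsets without \<open>p\<close> and subsets with \<open>p\<close> cancel in
  pairs.\<close>

lemma sum_dvd_moebius_eq_0:
  assumes "n > 1"
  shows "(\<Sum>d | d dvd n. moebius d) = 0"
proof -
  obtain p where p: "p \<in> prime_factors n"
    using assms prime_factor_nat[of n] by (auto simp: in_prime_factors_iff)
  define A where "A = prime_factors n - {p}"
  have A: "finite A" "p \<notin> A" "prime_factors n = insert p A" using p by (auto simp: A_def)
  have "(\<Sum>d | d dvd n. moebius d) = (\<Sum>I\<in>Pow (insert p A). (-1) ^ card I)"
    using sum_dvd_moebius[of n "\<lambda>_. 1"] assms A(3) by simp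
  also have "\<dots> = (\<Sum>I\<in>Pow A. (-1) ^ card I) + (\<Sum>I\<in>Pow A. (-1) ^ card (insert p I))"
    using A by (subst sum_Pow_insert) auto
  also have "(\<Sum>I\<in>Pow A. (-1) ^ card (insert p I)) = (\<Sum>I\<in>Pow A. - ((-1) ^ card I :: real))"
    using A by (intro sum.cong refl) (auto simp: card_insert_if finite_subset)
  finally show ?thesis by (simp add: sum_negf)
qed

lemma moebius_1 [simp]: "moebius (Suc 0) = 1"
  by (simp add: moebius_def)

section \<open>Chebyshev and Mertens upper bounds for primes\<close>

lemma sum_mangoldt_floor:
  "(\<Sum>d=1..n. mangoldt d * real (n div d)) = ln (fact n)"
proof -
  have "(\<Sum>d=1..n. mangoldt d * real (n div d)) = (\<Sum>d=1..n. \<Sum>i=1..n div d. mangoldt d :: real)"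
    by (simp add: mult.commute)
  also have "\<dots> = (\<Sum>m=1..n. \<Sum>d | d dvd m. mangoldt d)"
    by (rule sum_dvd_hyperbola[symmetric])
  also have "\<dots> = (\<Sum>m=1..n. ln (real m))"
    by (intro sum.cong refl, subst mangoldt_sum) auto
  also have "\<dots> = ln (fact n)"
    by (subst fact_prod, subst of_nat_prod, subst ln_prod) auto
  finally show ?thesis .
qed

lemma ln_fact_le: "ln (fact n) \<le> real n * ln (real n)"
proof (cases "n = 0")
  case False
  have "ln (fact n) \<le> ln (real n ^ n)"
    by (subst ln_le_cancel_iff) (use False fact_le_power[of n, where ?'a=real] in auto)
  thus ?thesis using False by (simp add: ln_realpow)
qed auto

text \<open>Chebyshev's argument: the combination \<open>[2m/d] - 2[m/d]\<close> is nonnegative, is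
  at least 1 for \<open>m < d \<le> 2m\<close>, and summed against \<open>mangoldt\<close> gives the
  logarithm of the central binomial coefficient, which is at most \<open>2 ^ (2m)\<close>.\<close>

lemma psi_double_le: "(\<Sum>d=1..2*m. mangoldt d) \<le> (\<Sum>d=1..m. mangoldt d) + 2 * real m * ln 2"
proof -
  have nn: "0 \<le> real (2*m div d) - 2 * real (m div d)" for d
  proof -
    have "2 * (m div d) \<le> 2 * m div d"
    proof (cases "d = 0")
      case False
      have "m div d * d \<le> m" by simp
      hence "2 * (m div d) * d \<le> 2 * m" by linarith
      thus ?thesis using False by (simp add: less_eq_div_iff_mult_less_eq)
    qed auto
    hence "real (2 * (m div d)) \<le> real (2 * m div d)" by (rule of_nat_mono)
    thus ?thesis by simp
  qed
  have one: "1 \<le> real (2*m div d) - 2 * real (m div d)" if "d \<in> {m<..2*m}" for d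
  proof -
    have "m div d = 0" "2*m div d \<ge> 1" using that by (auto simp: less_eq_div_iff_mult_less_eq)
    thus ?thesis by simp
  qed
  have "(\<Sum>d\<in>{m<..2*m}. mangoldt d :: real) \<le> (\<Sum>d\<in>{m<..2*m}. mangoldt d * (real (2*m div d) - 2 * real (m div d)))"
  proof (rule sum_mono)
    fix d assume "d \<in> {m<..2*m}"
    from mult_left_mono[OF one[OF this] mangoldt_nonneg[of d]]
    show "mangoldt d \<le> mangoldt d * (real (2*m div d) - 2 * real (m div d))" by simp
  qed
  also have "\<dots> \<le> (\<Sum>d=1..2*m. mangoldt d * (real (2*m div d) - 2 * real (m div d)))"
    by (rule sum_mono2) (auto intro!: mult_nonneg_nonneg mangoldt_nonneg nn)
  also have "\<dots> = (\<Sum>d=1..2*m. mangoldt d * real (2*m div d)) - 2 * (\<Sum>d=1..2*m. mangoldt d * real (m div d))"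
    by (simp add: sum_subtractf sum_distrib_left algebra_simps)
  also have "(\<Sum>d=1..2*m. mangoldt d * real (m div d)) = (\<Sum>d=1..m. mangoldt d * real (m div d))"
    by (rule sum.mono_neutral_right) auto
  also have "(\<Sum>d=1..2*m. mangoldt d * real (2*m div d)) - 2 * \<dots> = ln (fact (2*m)) - 2 * ln (fact m)"
    by (simp only: sum_mangoldt_floor)
  also have "\<dots> = ln (real ((2*m) choose m))"
  proof -
    have "real ((2*m) choose m) = fact (2*m) / (fact m * fact m)"
      by (subst binomial_fact) (auto simp: mult_2)
    thus ?thesis by (simp add: ln_div ln_mult)
  qed
  also have "\<dots> \<le> ln (real (2 ^ (2*m)))"
  proof (subst ln_le_cancel_iff)
    have "(2*m) choose m \<le> 2 ^ (2*m)"
      using sum_mono2[of "{..2*m}" "{m}" "\<lambda>k. (2*m) choose k"] choose_row_sum[of "2*m"] by simp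
    thus "real ((2*m) choose m) \<le> real (2 ^ (2*m))" by linarith
  qed auto
  also have "\<dots> = 2 * real m * ln 2" by (simp add: ln_realpow)
  finally have "(\<Sum>d\<in>{m<..2*m}. mangoldt d) \<le> 2 * real m * ln 2" .
  moreover have "(\<Sum>d=1..2*m. mangoldt d :: real) = (\<Sum>d=1..m. mangoldt d) + (\<Sum>d\<in>{m<..2*m}. mangoldt d)"
    by (subst sum.union_disjoint[symmetric]) (auto intro: sum.cong)
  ultimately show ?thesis by simp
qed

lemma psi_le: "(\<Sum>d=1..n. mangoldt d) \<le> 4 * real n"
proof (induction n rule: less_induct)
  case (less n)
  \<comment> \<open>With \<open>ln 2 \<le> 7/10\<close> the induction step yields
    \<open>2.7 * (n + 1)\<close>, which is below \<open>4 * n\<close> only from \<open>n = 3\<close>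
    on.\<close>
  have l2: "ln 2 \<le> (7/10::real)" using ln2_le_25_over_36 by simp
  consider "n = 0" | "n = 1" | "n = 2" | "n \<ge> 3" by linarith
  thus ?case
  proof cases
    case 3
    have "{1..2::nat} = {1,2}" by auto
    thus ?thesis using 3 l2 by simp
  next
    case 4
    define m where "m = (n+1) div 2"
    have m: "m < n" "n \<le> 2*m" "2*m \<le> n+1" using 4 by (auto simp: m_def)
    have "(\<Sum>d=1..n. mangoldt d :: real) \<le> (\<Sum>d=1..2*m. mangoldt d)"
      by (rule sum_mono2) (use m in \<open>auto intro: mangoldt_nonneg\<close>)
    also have "\<dots> \<le> (\<Sum>d=1..m. mangoldt d) + 2 * real m * ln 2" by (rule psi_double_le)
    also have "\<dots> \<le> 4 * real m + 2 * real m * (7/10)"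
      using less.IH[OF m(1)] l2 by (intro add_mono mult_left_mono) auto
    also have "\<dots> = (27/10) * real (2*m)" by simp
    also have "\<dots> \<le> (27/10) * real (n+1)" using m by (intro mult_left_mono) linarith+
    also have "\<dots> \<le> 4 * real n" using 4 by simp
    finally show ?thesis .
  qed auto
qed

text \<open>Upper half of Mertens' first theorem. The factor 2 pays for
  \<open>n / p \<le> 2 * [n/p]\<close>, valid because \<open>p \<le> n\<close>.\<close>

lemma sum_primes_ln_over_le:
  "(\<Sum>p | prime p \<and> p \<le> n. ln (real p) / real p) \<le> 2 * ln (real n)"
proof (cases "n = 0")
  case True thus ?thesis by (simp add: not_prime_0 cong: conj_cong)
next
  case False
  have half: "real n / (2 * real p) \<le> real (n div p)" if "prime p" "p \<le> n" for p
  proof -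
    have p: "p > 0" using that prime_gt_0_nat by blast
    have "n div p \<ge> 1" using that p by (simp add: less_eq_div_iff_mult_less_eq)
    moreover have "n < p * (n div p + 1)" using p by (metis add.commute dividend_less_times_div mult_Suc_right plus_1_eq_Suc)
    ultimately have "n \<le> p * (2 * (n div p))"
      by (smt (verit) add_mono_thms_linordered_semiring(1) le_trans less_or_eq_imp_le mult_2 mult_le_mono2)
    hence "real n \<le> real p * (2 * real (n div p))" by (metis of_nat_le_iff of_nat_mult of_nat_numeral)
    thus ?thesis using p by (simp add: field_simps)
  qed
  have "real n / 2 * (\<Sum>p | prime p \<and> p \<le> n. ln (real p) / real p) = (\<Sum>p | prime p \<and> p \<le> n. ln (real p) * (real n / (2 * real p)))"
    by (simp add: sum_distrib_left field_simps)
  also have "\<dots> \<le> (\<Sum>p | prime p \<and> p \<le> n. mangoldt p * real (n div p))"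
  proof (rule sum_mono)
    fix p assume p: "p \<in> {p. prime p \<and> p \<le> n}"
    hence "ln (real p) \<ge> 0" using prime_gt_0_nat[of p] by (intro ln_ge_zero) auto
    thus "ln (real p) * (real n / (2 * real p)) \<le> mangoldt p * real (n div p)"
      using mult_left_mono[OF half, of p "ln (real p)"] p by simp
  qed
  also have "\<dots> \<le> (\<Sum>p=1..n. mangoldt p * real (n div p))"
    by (rule sum_mono2) (auto intro!: mult_nonneg_nonneg mangoldt_nonneg simp: prime_gt_0_nat Suc_le_eq)
  also have "\<dots> \<le> real n * ln (real n)" using sum_mangoldt_floor ln_fact_le by metis
  finally show ?thesis using False by (simp add: field_simps)
qed

section \<open>Finite differences of Riesz weights\<close>

text \<open>The weight of Riesz means. Truncated powers are closed under differentiation up to a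
  factor, so the mean value theorem can be iterated inside the family, and for \<open>m > 0\<close>
  they vanish from \<open>v = 1\<close> on.\<close>

definition riesz :: "nat \<Rightarrow> real \<Rightarrow> real" where
  "riesz m v = max 0 (1 - v) ^ m"

lemma riesz_nonneg: "0 \<le> riesz m v"
  by (simp add: riesz_def)

lemma riesz_le_1: "v \<ge> 0 \<Longrightarrow> riesz m v \<le> 1"
  by (simp add: riesz_def power_le_one)

lemma riesz_eq_0: "v \<ge> 1 \<Longrightarrow> m > 0 \<Longrightarrow> riesz m v = 0"
  by (simp add: riesz_def)

lemma riesz_0 [simp]: "riesz m 0 = 1"
  by (simp add: riesz_def)

lemma has_real_derivative_riesz:
  assumes "m \<ge> 1"
  shows "(riesz (Suc m) has_real_derivative - real (Suc m) * riesz m v) (at v)"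
proof -
  consider "v < 1" | "v = 1" | "v > 1" by linarith
  thus ?thesis
  proof cases
    case 1
    have "((\<lambda>v. (1 - v) ^ Suc m) has_real_derivative - real (Suc m) * riesz m v) (at v)"
    proof -
      have "((\<lambda>v. 1 - v) has_real_derivative -1) (at v)"
        by (auto intro!: derivative_eq_intros)
      from DERIV_power_Suc[OF this, of m] show ?thesis using 1 by (simp add: riesz_def algebra_simps)
    qed
    thus ?thesis
      by (rule DERIV_cong_ev[THEN iffD1, rotated 3])
         (use 1 in \<open>auto simp: riesz_def intro!: eventually_mono[OF eventually_at_in_open'[of "{..<1}"]]
            eventually_mono[OF eventually_nhds_in_open[of "{..<1}"]]\<close>)
  next
    case 3
    have "((\<lambda>v. 0) has_real_derivative - real (Suc m) * riesz m v) (at v)"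
      using 3 assms by (simp add: riesz_def power_0_left)
    thus ?thesis
      by (rule DERIV_cong_ev[THEN iffD1, rotated 3])
         (use 3 in \<open>auto simp: riesz_def intro!: 
            eventually_mono[OF eventually_nhds_in_open[of "{1<..}"]]\<close>)
  next
    \<comment> \<open>At the breakpoint the difference quotient is at most
      \<open>\<bar>y - 1\<bar> ^ m\<close>, which tends to 0 because
      \<open>m \<ge> 1\<close>.\<close>
    case 2
    have "((\<lambda>y. (riesz (Suc m) y - riesz (Suc m) 1) / (y - 1)) \<longlongrightarrow> 0) (at 1)"
    proof (rule Lim_null_comparison)
      show "\<forall>\<^sub>F y in at 1. norm ((riesz (Suc m) y - riesz (Suc m) 1) / (y - 1)) \<le> \<bar>y - 1\<bar> ^ m"
      proof (intro always_eventually allI)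
        fix y :: real
        have "\<bar>riesz (Suc m) y\<bar> \<le> \<bar>y - 1\<bar> ^ Suc m"
          unfolding riesz_def power_abs by (intro power_mono) auto
        hence "\<bar>riesz (Suc m) y\<bar> / \<bar>y - 1\<bar> \<le> \<bar>y - 1\<bar> ^ m"
          by (cases "y = 1") (auto simp: field_simps)
        thus "norm ((riesz (Suc m) y - riesz (Suc m) 1) / (y - 1)) \<le> \<bar>y - 1\<bar> ^ m"
          by (simp add: riesz_eq_0)
      qed
      show "((\<lambda>y::real. \<bar>y - 1\<bar> ^ m) \<longlongrightarrow> 0) (at 1)"
        by (rule tendsto_eq_intros refl | use assms in simp)+
    qed
    thus ?thesis using 2 assms by (simp add: has_field_derivative_iff riesz_def power_0_left)
  qed
qed

section \<open>Iterated finite differences\<close>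

text \<open>This is the product over \<open>p \<in> P\<close> of the operators
  \<open>1 - T (h p)\<close> applied to \<open>f\<close>, where \<open>T s\<close> translates by
  \<open>s\<close>. The expanded form over subsets is the one that \<open>sum_dvd_moebius\<close>
  delivers.\<close>

definition idiff :: "('a \<Rightarrow> real) \<Rightarrow> 'a set \<Rightarrow> (real \<Rightarrow> real) \<Rightarrow> real \<Rightarrow> real" where
  "idiff h P f v = (\<Sum>I\<in>Pow P. (-1) ^ card I * f (v + (\<Sum>p\<in>I. h p)))"

lemma idiff_empty [simp]: "idiff h {} f = f"
  by (auto simp: idiff_def)

lemma idiff_insert:
  assumes "finite P" "p \<notin> P"
  shows "idiff h (insert p P) f v = idiff h P f v - idiff h P f (v + h p)"
proof -
  have "(\<Sum>I\<in>Pow P. (-1) ^ card (insert p I) * f (v + (\<Sum>q\<in>insert p I. h q)))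
      = (\<Sum>I\<in>Pow P. - ((-1) ^ card I * f (v + h p + (\<Sum>q\<in>I. h q))))"
  proof (rule sum.cong[OF refl])
    fix I assume "I \<in> Pow P"
    hence "finite I" "p \<notin> I" using assms finite_subset by auto
    thus "(-1) ^ card (insert p I) * f (v + (\<Sum>q\<in>insert p I. h q)) = - ((-1) ^ card I * f (v + h p + (\<Sum>q\<in>I. h q)))"
      by (simp add: add.assoc)
  qed
  thus ?thesis using assms unfolding idiff_def by (simp add: sum_Pow_insert sum_negf)
qed

lemma idiff_cmult: "idiff h P (\<lambda>v. c * f v) v = c * idiff h P f v"
  by (simp add: idiff_def sum_distrib_left mult_ac)

lemma has_real_derivative_idiff:
  assumes "\<And>v. (f has_real_derivative f' v) (at v)"
  shows "(idiff h P f has_real_derivative idiff h P f' v) (at v)"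
  unfolding idiff_def
  by ((rule derivative_eq_intros DERIV_chain2[OF assms] refl | simp)+) (simp add: mult.commute)

lemma has_real_derivative_idiff_riesz:
  assumes "m \<ge> 1"
  shows "(idiff h P (riesz (Suc m)) has_real_derivative - real (Suc m) * idiff h P (riesz m) v) (at v)"
  using has_real_derivative_idiff[OF has_real_derivative_riesz[OF assms], of h P v]
  by (simp only: idiff_cmult)

text \<open>The mean value theorem trades one difference for one derivative, at the price of the
  step and of a factor at most \<open>m\<close>. The exponent drops each time, and
  \<open>card P < m\<close> keeps it positive until \<open>P\<close> is exhausted.\<close>

lemma abs_idiff_riesz_le:
  assumes "finite P" "\<And>p. p \<in> P \<Longrightarrow> h p \<ge> 0" "card P < m" "v \<ge> 0"
  shows "\<bar>idiff h P (riesz m) v\<bar> \<le> real m ^ card P * (\<Prod>p\<in>P. h p)"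
  using assms
proof (induction P arbitrary: m v rule: finite_induct)
  case empty
  thus ?case using riesz_le_1 riesz_nonneg by simp
next
  case (insert p P)
  obtain k where k: "m = Suc k" "card P < k" using insert.prems insert.hyps by (cases m) auto
  have hp: "h p \<ge> 0" using insert.prems by simp
  have PP: "0 \<le> (\<Prod>q\<in>P. h q)" using insert.prems by (intro prod_nonneg) auto
  show ?case
  proof (cases "h p = 0")
    case True
    thus ?thesis using insert.hyps by (simp add: idiff_insert)
  next
    case False
    hence "v < v + h p" using hp by simp
    from MVT2[OF this, of "idiff h P (riesz m)" "\<lambda>v. - real (Suc k) * idiff h P (riesz k) v"]
    obtain z where z: "v < z" "idiff h P (riesz m) (v + h p) - idiff h P (riesz m) v
        = (v + h p - v) * (- real (Suc k) * idiff h P (riesz k) z)"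
      using has_real_derivative_idiff_riesz[of k h P] k by auto
    have "\<bar>idiff h (insert p P) (riesz m) v\<bar> = h p * (real (Suc k) * \<bar>idiff h P (riesz k) z\<bar>)"
    proof -
      have "\<bar>idiff h (insert p P) (riesz m) v\<bar> = \<bar>idiff h P (riesz m) (v + h p) - idiff h P (riesz m) v\<bar>"
        using insert.hyps by (simp add: idiff_insert abs_minus_commute)
      also have "\<dots> = \<bar>h p * (real (Suc k) * idiff h P (riesz k) z)\<bar>"
        unfolding z(2) by (simp add: abs_mult del: of_nat_Suc)
      finally show ?thesis using hp by (simp add: abs_mult del: of_nat_Suc)
    qed
    also have "\<bar>idiff h P (riesz k) z\<bar> \<le> real k ^ card P * (\<Prod>q\<in>P. h q)"
      using insert.prems k z by (intro insert.IH) auto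
    also have "\<dots> \<le> real m ^ card P * (\<Prod>q\<in>P. h q)"
      using PP k by (intro mult_right_mono power_mono) auto
    finally have "\<bar>idiff h (insert p P) (riesz m) v\<bar> \<le> h p * (real (Suc k) * (real m ^ card P * (\<Prod>q\<in>P. h q)))"
      using hp by (simp add: mult_left_mono del: of_nat_Suc)
    thus ?thesis using insert.hyps k by (simp add: mult_ac)
  qed
qed

text \<open>Differences that are not traded for derivatives cost a factor 2 each, because
  \<open>K\<close> is uniform in \<open>v\<close>.\<close>

lemma abs_idiff_Un_le:
  assumes "finite P" "finite Q" "P \<inter> Q = {}" "\<And>q. q \<in> Q \<Longrightarrow> h q \<ge> 0"
    and "\<And>v. v \<ge> 0 \<Longrightarrow> \<bar>idiff h P f v\<bar> \<le> K" "v \<ge> 0"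
  shows "\<bar>idiff h (P \<union> Q) f v\<bar> \<le> 2 ^ card Q * K"
  using assms(2,3,4,6)
proof (induction Q arbitrary: v rule: finite_induct)
  case empty
  thus ?case using assms(5) by simp
next
  case (insert q Q)
  have "idiff h (P \<union> insert q Q) f v = idiff h (P \<union> Q) f v - idiff h (P \<union> Q) f (v + h q)"
    using insert assms(1) by (subst idiff_insert[symmetric]) auto
  moreover have "\<bar>idiff h (P \<union> Q) f v\<bar> \<le> 2 ^ card Q * K"
    "\<bar>idiff h (P \<union> Q) f (v + h q)\<bar> \<le> 2 ^ card Q * K"
    using insert.prems by (auto intro!: insert.IH)
  ultimately show ?case using insert.hyps by simp
qed

text \<open>Doubling a scale until at most \<open>J\<close> steps remain short turns the finite difference bound, which
  may use at most \<open>J\<close> derivatives, into a sum of multiplicative majorants with weights \<open>2 powr (- J t)\<close>.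
  The mean values of the majorants grow only like a fixed power of \<open>2 ^ t\<close>, so a large \<open>J\<close> wins.\<close>

lemma select_small_steps:
  fixes x :: "'a \<Rightarrow> real"
  assumes "finite P" "\<And>p. p \<in> P \<Longrightarrow> x p > 0" "\<And>p. p \<in> P \<Longrightarrow> 2 \<le> 2 ^ N * x p"
  shows "\<exists>t\<le>N. \<exists>I\<subseteq>P. card I \<le> J \<and>
    2 ^ card (P - I) * (\<Prod>p\<in>I. x p) \<le> 2 ^ J * (1 / 2 ^ J) ^ t * (\<Prod>p\<in>P. min 2 (2 ^ t * x p))"
proof -
  define A where "A t = {p\<in>P. 2 ^ t * x p < 2}" for t :: nat
  define t where "t = (LEAST t. card (A t) \<le> J)"
  have AN: "card (A N) \<le> J"
  proof -
    have "A N = {}" using assms(3) by (force simp: A_def not_less)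
    thus ?thesis by simp
  qed
  have t: "card (A t) \<le> J" "t \<le> N" unfolding t_def using AN by (auto intro: LeastI Least_le)
  \<comment> \<open>For \<open>t > 0\<close> minimality provides more than \<open>J\<close> short
    steps at scale \<open>t - 1\<close>, so \<open>A t\<close> extends to exactly \<open>J\<close>
    of them, and one doubling leaves them at most 4. For \<open>t = 0\<close> no gain is claimed,
    and \<open>A 0\<close> itself serves.\<close>
  have "\<exists>I. A t \<subseteq> I \<and> I \<subseteq> P \<and> card I \<le> J \<and> (t > 0 \<longrightarrow> card I = J) \<and> (\<forall>p\<in>I. 2 ^ t * x p \<le> 4)"
  proof (cases t)
    case 0
    thus ?thesis using t by (intro exI[of _ "A 0"]) (auto simp: A_def)
  next
    case (Suc s)
    have "\<not> card (A s) \<le> J" using not_less_Least[of s "\<lambda>t. card (A t) \<le> J"] Suc t_def by simp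
    moreover have "A t \<subseteq> A s" using Suc assms(2)
      by (auto simp: A_def)
    moreover have "finite (A s)" using assms(1) by (simp add: A_def)
    ultimately obtain I where "A t \<subseteq> I" "I \<subseteq> A s" "card I = J"
      using exists_subset_between[of "A t" J "A s"] t by auto
    moreover have "\<forall>p\<in>A s. 2 ^ t * x p \<le> 4"
    proof
      fix p assume "p \<in> A s"
      hence "2 ^ s * x p < 2" by (simp add: A_def)
      thus "2 ^ t * x p \<le> 4" using Suc by (simp add: mult_ac)
    qed
    ultimately show ?thesis using Suc by (intro exI[of _ I]) (auto simp: A_def)
  qed
  then obtain I where I: "A t \<subseteq> I" "I \<subseteq> P" "card I \<le> J" "t > 0 \<Longrightarrow> card I = J"
    "\<And>p. p \<in> I \<Longrightarrow> 2 ^ t * x p \<le> 4" by blast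
  have fI: "finite I" using I assms finite_subset by blast
  \<comment> \<open>On \<open>I\<close> the quantity \<open>2 ^ t * x p\<close> is at most 4, hence
    at most twice its truncation at 2; off \<open>I\<close> the truncation already equals 2.\<close>
  have "(\<Prod>p\<in>P. if p \<in> I then 2 ^ t * x p else 2) \<le> (\<Prod>p\<in>P. min 2 (2 ^ t * x p) * (if p \<in> I then 2 else 1))"
  proof (rule prod_mono)
    fix p assume p: "p \<in> P"
    have x: "x p > 0" using assms p by simp
    show "0 \<le> (if p \<in> I then 2 ^ t * x p else 2) \<and>
      (if p \<in> I then 2 ^ t * x p else 2) \<le> min 2 (2 ^ t * x p) * (if p \<in> I then 2 else 1)"
      using I(1) I(5)[of p] x p by (auto simp: A_def min_def not_less subset_iff)
  qed
  also have "\<dots> = (\<Prod>p\<in>P. min 2 (2 ^ t * x p)) * 2 ^ card I"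
    using I(2) assms(1) by (simp add: prod.distrib prod.If_cases Int_absorb1)
  also have "(\<Prod>p\<in>P. if p \<in> I then 2 ^ t * x p else 2) = (2 ^ t) ^ card I * (\<Prod>p\<in>I. x p) * 2 ^ card (P - I)"
    using I(2) assms(1) by (simp add: prod.distrib prod.If_cases Int_absorb1 Diff_eq)
  finally have *: "(2 ^ t) ^ card I * (2 ^ card (P - I) * (\<Prod>p\<in>I. x p)) \<le> (\<Prod>p\<in>P. min 2 (2 ^ t * x p)) * 2 ^ card I"
    by (simp add: mult_ac)
  have nonneg: "0 \<le> (\<Prod>p\<in>P. min 2 (2 ^ t * x p))"
    using assms(2) by (intro prod_nonneg) (auto simp: less_imp_le)
  have pw: "(2 ^ t) ^ card I = (2 ^ J :: real) ^ t"
    using I(4) by (cases "t = 0") (auto simp: power_mult[symmetric] mult.commute)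
  have "2 ^ card (P - I) * (\<Prod>p\<in>I. x p) \<le> (\<Prod>p\<in>P. min 2 (2 ^ t * x p)) * 2 ^ card I / (2 ^ J) ^ t"
    using * unfolding pw by (simp add: field_simps)
  also have "\<dots> \<le> (\<Prod>p\<in>P. min 2 (2 ^ t * x p)) * 2 ^ J / (2 ^ J) ^ t"
    using nonneg I(3) by (intro divide_right_mono mult_left_mono power_increasing) auto
  also have "\<dots> = 2 ^ J * (1 / 2 ^ J) ^ t * (\<Prod>p\<in>P. min 2 (2 ^ t * x p))"
    by (simp add: power_divide)
  finally show ?thesis using t(2) I(2,3) by blast
qed

section \<open>Multiplicative majorants for differences over prime factors\<close>

definition kap :: "(nat \<Rightarrow> real) \<Rightarrow> nat \<Rightarrow> real" where
  "kap c j = (\<Prod>p\<in>prime_factors j. c p)"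

lemma kap_nonneg: "(\<And>p. prime p \<Longrightarrow> c p \<ge> 0) \<Longrightarrow> kap c j \<ge> 0"
  unfolding kap_def by (intro prod_nonneg) auto

lemma kap_1 [simp]: "kap c (Suc 0) = 1"
  by (simp add: kap_def)

text \<open>\<open>select_small_steps\<close> picks a scale \<open>t\<close> that depends on
  \<open>j\<close>; adding up all scales removes this dependence and leaves a fixed combination of
  multiplicative functions. The steps in the majorant use \<open>w\<close>, so that one majorant
  serves all \<open>u \<le> w\<close>.\<close>

lemma abs_idiff_prime_factors_le:
  assumes "0 \<le> u" "u \<le> w" "w > 0" "J < m" "2 \<le> 2 ^ N * (w * ln 2)" "v \<ge> 0"
  shows "\<bar>idiff (\<lambda>p. u * ln (real p)) (prime_factors j) (riesz m) v\<bar>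
    \<le> (2 * real m) ^ J * (\<Sum>t\<le>N. (1 / 2 ^ J) ^ t * kap (\<lambda>p. min 2 (2 ^ t * (w * ln (real p)))) j)"
proof -
  let ?P = "prime_factors j" and ?h = "\<lambda>p. u * ln (real p)"
  have ln: "ln (real p) \<ge> ln 2" if "p \<in> ?P" for p
    using that prime_ge_2_nat[of p] by (intro ln_mono) auto
  have ln0: "ln (real p) > 0" if "p \<in> ?P" for p
    using ln[OF that] by (rule less_le_trans[rotated]) simp
  have big: "2 \<le> 2 ^ N * (w * ln (real p))" if "p \<in> ?P" for p
    using ln[OF that] assms(3) by (intro order.trans[OF assms(5)] mult_left_mono) auto
  obtain t I where tI: "t \<le> N" "I \<subseteq> ?P" "card I \<le> J"
    "2 ^ card (?P - I) * (\<Prod>p\<in>I. w * ln (real p)) \<le> 2 ^ J * (1 / 2 ^ J) ^ t * (\<Prod>p\<in>?P. min 2 (2 ^ t * (w * ln (real p))))"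
    using select_small_steps[of ?P "\<lambda>p. w * ln (real p)" N J] assms(3) ln0 big by auto
  have fI: "finite I" using tI finite_subset by blast
  have mJ: "real m ^ card I \<le> real m ^ J" using assms(4) tI(3) by (intro power_increasing) auto
  have "\<bar>idiff ?h (I \<union> (?P - I)) (riesz m) v\<bar> \<le> 2 ^ card (?P - I) * (real m ^ card I * (\<Prod>p\<in>I. ?h p))"
  proof (rule abs_idiff_Un_le)
    fix v :: real assume "v \<ge> 0"
    thus "\<bar>idiff ?h I (riesz m) v\<bar> \<le> real m ^ card I * (\<Prod>p\<in>I. ?h p)"
      using assms(1,4) tI(2,3) ln0 fI by (intro abs_idiff_riesz_le) (auto simp: subset_iff less_imp_le)
  qed (use assms fI ln0 in \<open>auto simp: less_imp_le\<close>)
  also have "\<dots> \<le> 2 ^ card (?P - I) * (real m ^ J * (\<Prod>p\<in>I. w * ln (real p)))"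
    using assms tI(2) ln0 mJ
    by (intro mult_left_mono mult_mono prod_mono prod_nonneg) (auto simp: less_imp_le subset_iff intro!: mult_right_mono)
  also have "\<dots> = real m ^ J * (2 ^ card (?P - I) * (\<Prod>p\<in>I. w * ln (real p)))" by simp
  also have "\<dots> \<le> real m ^ J * (2 ^ J * (1 / 2 ^ J) ^ t * (\<Prod>p\<in>?P. min 2 (2 ^ t * (w * ln (real p)))))"
    by (intro mult_left_mono tI) auto
  also have "\<dots> = (2 * real m) ^ J * ((1 / 2 ^ J) ^ t * kap (\<lambda>p. min 2 (2 ^ t * (w * ln (real p)))) j)"
    by (simp add: kap_def power_mult_distrib)
  also have "\<dots> \<le> (2 * real m) ^ J * (\<Sum>t\<le>N. (1 / 2 ^ J) ^ t * kap (\<lambda>p. min 2 (2 ^ t * (w * ln (real p)))) j)"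
    using tI(1) assms(3) prime_gt_0_nat
    by (intro mult_left_mono member_le_sum[of t "{..N}"] mult_nonneg_nonneg kap_nonneg) (auto simp: Suc_le_eq)
  finally show ?thesis using tI(2) by (simp add: Un_absorb1)
qed

section \<open>Mean values of multiplicative majorants\<close>

lemma ln_power2_le: "z \<ge> 1 \<Longrightarrow> (ln z)\<^sup>2 \<le> 16 * sqrt z" for z :: real
proof -
  assume z: "z \<ge> 1"
  have "ln z = 4 * ln (sqrt (sqrt z))" using z by (simp add: ln_sqrt)
  also have "\<dots> \<le> 4 * sqrt (sqrt z)"
    using z ln_le_minus_one[of "sqrt (sqrt z)"] by simp
  finally have "(ln z)\<^sup>2 \<le> (4 * sqrt (sqrt z))\<^sup>2" using z by (intro power_mono) auto
  thus ?thesis using z by (simp add: power_mult_distrib)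
qed

text \<open>The weight is \<open>ln q\<close> rather than \<open>mangoldt q\<close>, so proper
  powers need a separate count: with bases up to \<open>sqrt z\<close> and exponents up to
  \<open>log 2 z\<close> they contribute at most \<open>sqrt z * log 2 z * ln z\<close>, which
  \<open>ln_power2_le\<close> makes \<open>O(z)\<close>. Primes give the constant 4, proper powers
  32.\<close>

lemma sum_primepow_ln_le: "(\<Sum>q | primepow q \<and> q \<le> z. ln (real q)) \<le> 36 * real z"
proof (cases "z = 0")
  case False
  hence z: "real z \<ge> 1" by simp
  define N where "N = {q. primepow q \<and> \<not> prime q \<and> q \<le> z}"
  have "(\<Sum>q | prime q \<and> q \<le> z. ln (real q)) = (\<Sum>q | prime q \<and> q \<le> z. mangoldt q)"
    by (intro sum.cong) auto
  also have "\<dots> \<le> (\<Sum>q=1..z. mangoldt q)"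
    by (rule sum_mono2) (auto intro: mangoldt_nonneg simp: Suc_le_eq prime_gt_0_nat)
  also have "\<dots> \<le> 4 * real z" by (rule psi_le)
  finally have primes: "(\<Sum>q | prime q \<and> q \<le> z. ln (real q)) \<le> 4 * real z" .
  define X Y where "X = {1..nat \<lfloor>sqrt (real z)\<rfloor>}" and "Y = {1..nat \<lfloor>log 2 (real z)\<rfloor>}"
  have "N \<subseteq> (\<lambda>(p,a). p ^ a) ` (X \<times> Y)"
  proof
    fix q assume q: "q \<in> N"
    then obtain p a where pa: "prime p" "a > 0" "q = p ^ a"
      unfolding N_def primepow_def by blast
    have a: "a \<ge> 2" using pa q by (cases "a = 1") (auto simp: N_def)
    have p2: "p \<ge> 2" using pa prime_ge_2_nat by blast
    have "p ^ 2 \<le> p ^ a" using p2 a by (intro power_increasing) auto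
    hence "p ^ 2 \<le> z" using q pa by (auto simp: N_def)
    hence "real p ^ 2 \<le> real z" by (metis of_nat_le_iff of_nat_power)
    hence "real p \<le> sqrt (real z)" by (simp add: real_le_rsqrt)
    hence pX: "p \<in> X" using p2 by (auto simp: X_def le_nat_iff le_floor_iff)
    have "2 ^ a \<le> p ^ a" using p2 by (intro power_mono) auto
    also have "p ^ a \<le> z" using q pa by (auto simp: N_def)
    finally have "2 ^ a \<le> z" .
    hence "2 ^ a \<le> real z" by (metis of_nat_le_iff of_nat_numeral of_nat_power)
    hence "real a \<le> log 2 (real z)" using z by (simp add: le_log_iff powr_realpow)
    hence "a \<in> Y" using a by (auto simp: Y_def le_nat_iff le_floor_iff)
    thus "q \<in> (\<lambda>(p,a). p ^ a) ` (X \<times> Y)" using pX pa by force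
  qed
  hence "card N \<le> card (X \<times> Y)" by (rule surj_card_le[rotated]) (auto simp: X_def Y_def)
  also have "\<dots> = card X * card Y" by (rule card_cartesian_product)
  finally have "real (card N) \<le> real (card X) * real (card Y)" by (metis of_nat_le_iff of_nat_mult)
  also have "\<dots> \<le> sqrt (real z) * log 2 (real z)"
    using z by (intro mult_mono) (auto simp: X_def Y_def)
  finally have cN: "real (card N) \<le> sqrt (real z) * log 2 (real z)" .
  have "(\<Sum>q\<in>N. ln (real q)) \<le> (\<Sum>q\<in>N. ln (real z))"
    by (intro sum_mono ln_mono) (auto simp: N_def primepow_gt_0_nat)
  also have "\<dots> = real (card N) * ln (real z)" by simp
  also have "\<dots> \<le> sqrt (real z) * log 2 (real z) * ln (real z)"
    using z by (intro mult_right_mono cN) auto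
  also have "\<dots> = sqrt (real z) * (ln (real z))\<^sup>2 / ln 2" by (simp add: log_def power2_eq_square)
  also have "\<dots> \<le> sqrt (real z) * (16 * sqrt (real z)) / ln 2"
    using ln_power2_le[OF z] by (intro divide_right_mono mult_left_mono) auto
  also have "\<dots> = 16 * real z / ln 2" by simp
  also have "\<dots> \<le> 32 * real z"
    using z ln2_ge_two_thirds by (simp add: field_simps)
  finally have nonprimes: "(\<Sum>q\<in>N. ln (real q)) \<le> 32 * real z" .
  have "(\<Sum>q | primepow q \<and> q \<le> z. ln (real q)) = (\<Sum>q\<in>{q. prime q \<and> q \<le> z} \<union> N. ln (real q))"
    by (intro sum.cong) (auto simp: N_def)
  also have "\<dots> = (\<Sum>q | prime q \<and> q \<le> z. ln (real q)) + (\<Sum>q\<in>N. ln (real q))"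
    by (rule sum.union_disjoint) (auto simp: N_def)
  finally show ?thesis using primes nonprimes by simp
qed (auto simp: primepow_gt_0_nat)

lemma kap_mult_prime_power:
  assumes "prime p" "\<not> p dvd i" "i > 0" "a > 0"
  shows "kap c (p ^ a * i) = c p * kap c i"
proof -
  have "prime_factors (p ^ a * i) = insert p (prime_factors i)"
    using assms by (subst prime_factors_product) (auto simp: prime_factorization_prime_power)
  moreover have "p \<notin> prime_factors i" using assms(2) by auto
  ultimately show ?thesis by (simp add: kap_def)
qed

lemma sum_geometric_half: "0 \<le> x \<Longrightarrow> x \<le> 1/2 \<Longrightarrow> (\<Sum>a=1..n. x ^ a) \<le> 2 * x" for x :: real
proof (induction n)
  case (Suc n)
  have "(\<Sum>a=1..Suc n. x ^ a) = x * (1 + (\<Sum>a=1..n. x ^ a))"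
  proof -
    have "(\<Sum>a=1..Suc n. x ^ a) = (\<Sum>a=0..n. x ^ Suc a)"
      by (rule sum.reindex_bij_witness[of _ Suc "\<lambda>a. a - 1"]) (auto simp: Suc_le_eq)
    also have "\<dots> = x * (\<Sum>a=0..n. x ^ a)" by (simp add: sum_distrib_left)
    also have "(\<Sum>a=0..n. x ^ a) = 1 + (\<Sum>a=1..n. x ^ a)"
      by (simp add: sum.atLeast_Suc_atMost)
    finally show ?thesis .
  qed
  also have "\<dots> \<le> x * (1 + 2 * x)" using Suc by (intro mult_left_mono) auto
  also have "\<dots> \<le> x * 2" using Suc.prems by (intro mult_left_mono) auto
  finally show ?case by simp
qed auto

lemma decompose_prime_power:
  fixes j p :: nat
  assumes "prime p" "j > 0"
  obtains i where "j = p ^ multiplicity p j * i" "\<not> p dvd i" "i > 0" "i \<le> j"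
proof -
  define i where "i = j div p ^ multiplicity p j"
  have "j = p ^ multiplicity p j * i" unfolding i_def by (simp add: multiplicity_dvd)
  moreover have "\<not> p dvd i" unfolding i_def using assms
    by (intro multiplicity_decompose) (auto simp: prime_gt_Suc_0_nat)
  moreover have "i > 0" using assms calculation(1) by (metis gr0I mult_is_0)
  moreover have "i \<le> j" unfolding i_def by simp
  ultimately show ?thesis using that by blast
qed

text \<open>A partial Euler product. Splitting off the exact power of \<open>p\<close> from
  \<open>j\<close> gives one factor per prime, and the geometric series bounds the reciprocals of
  the positive powers of \<open>p\<close> by \<open>2 / p\<close>.\<close>

lemma sum_kap_over_le_prod:
  assumes "finite P" "\<And>p. p \<in> P \<Longrightarrow> prime p" "\<And>p. prime p \<Longrightarrow> c p \<ge> 0"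
  shows "(\<Sum>j | 1 \<le> j \<and> j \<le> n \<and> prime_factors j \<subseteq> P. kap c j / real j) \<le> (\<Prod>p\<in>P. 1 + 2 * c p / real p)"
  using assms(1,2)
proof (induction P rule: finite_induct)
  case empty
  have "{j. 1 \<le> j \<and> j \<le> n \<and> prime_factors j \<subseteq> {}} \<subseteq> {1}"
    by (auto simp: prime_factorization_empty_iff)
  hence "(\<Sum>j | 1 \<le> j \<and> j \<le> n \<and> prime_factors j \<subseteq> {}. kap c j / real j) \<le> (\<Sum>j\<in>{1}. kap c j / real j)"
    by (intro sum_mono2) auto
  thus ?case by simp
next
  case (insert p P)
  have p: "prime p" using insert.prems by auto
  have p2: "real p \<ge> 2" using prime_ge_2_nat[OF p] by simp
  define A where "A P = {j. 1 \<le> j \<and> j \<le> n \<and> prime_factors j \<subseteq> P}" for P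
  define F where "F = (\<lambda>(a,i). (if a = 0 then 1 else c p * (1 / real p) ^ a) * (kap c i / real i))"
  have finA: "finite (A Q)" for Q by (rule finite_subset[of _ "{..n}"]) (auto simp: A_def)
  have kn: "kap c i \<ge> 0" for i by (rule kap_nonneg) (use assms in auto)
  have "(\<Sum>j\<in>A (insert p P). kap c j / real j) \<le> (\<Sum>x\<in>{0..n} \<times> A P. F x)"
  proof (rule sum_le_included[where i = "\<lambda>(a,i). p ^ a * i"])
    show "\<forall>y\<in>{0..n} \<times> A P. 0 \<le> F y"
      using assms(3)[OF p] kn by (auto simp: F_def)
    show "\<forall>j\<in>A (insert p P). \<exists>y\<in>{0..n} \<times> A P. (case y of (a, i) \<Rightarrow> p ^ a * i) = j \<and> kap c j / real j \<le> F y"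
    proof
      fix j assume j: "j \<in> A (insert p P)"
      hence j0: "j > 0" by (auto simp: A_def)
      define a where "a = multiplicity p j"
      obtain i where i: "j = p ^ a * i" "\<not> p dvd i" "i > 0" "i \<le> j"
        using decompose_prime_power[OF p j0] a_def by blast
      \<comment> \<open>Exponents need only run up to \<open>n\<close>, since
        \<open>a < 2 ^ a \<le> p ^ a \<le> j\<close>.\<close>
      have "a < 2 ^ a" by simp
      also have "2 ^ a \<le> p ^ a" using prime_ge_2_nat[OF p] by (intro power_mono) auto
      also have "\<dots> \<le> j" using i by simp
      finally have "a \<le> n" using j by (auto simp: A_def)
      moreover have "prime_factors i \<subseteq> P"
      proof
        fix q assume q: "q \<in> prime_factors i"
        hence "q \<in> prime_factors j" using i(1) j0 dvd_prime_factors[of j i] by auto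
        moreover have "q \<noteq> p" using q i(2) by auto
        ultimately show "q \<in> P" using j by (auto simp: A_def)
      qed
      ultimately have mem: "(a,i) \<in> {0..n} \<times> A P" using i(3,4) j by (auto simp: A_def)
      have "kap c j / real j \<le> F (a,i)"
      proof (cases "a = 0")
        case True thus ?thesis using i by (simp add: F_def)
      next
        case False
        thus ?thesis using kap_mult_prime_power[OF p i(2,3), of a c] i(1) by (simp add: F_def power_divide)
      qed
      thus "\<exists>y\<in>{0..n} \<times> A P. (case y of (a, i) \<Rightarrow> p ^ a * i) = j \<and> kap c j / real j \<le> F y"
        using mem i(1) by (intro bexI[of _ "(a,i)"]) auto
    qed
  qed (use finA in auto)
  also have "\<dots> = (\<Sum>a=0..n. if a = 0 then 1 else c p * (1 / real p) ^ a) * (\<Sum>i\<in>A P. kap c i / real i)"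
    by (simp add: F_def sum_product sum.cartesian_product)
  also have "(\<Sum>a=0..n. if a = 0 then 1 else c p * (1 / real p) ^ a) = 1 + c p * (\<Sum>a=1..n. (1 / real p) ^ a)"
    by (simp add: sum.atLeast_Suc_atMost sum_distrib_left)
  also have "\<dots> * (\<Sum>i\<in>A P. kap c i / real i) \<le> (1 + 2 * c p / real p) * (\<Prod>p\<in>P. 1 + 2 * c p / real p)"
  proof (rule mult_mono)
    have "c p * (\<Sum>a=1..n. (1 / real p) ^ a) \<le> c p * (2 * (1 / real p))"
      using p2 assms(3)[OF p] by (intro mult_left_mono sum_geometric_half) (auto simp: field_simps)
    thus "1 + c p * (\<Sum>a=1..n. (1 / real p) ^ a) \<le> 1 + 2 * c p / real p" by (simp add: mult.commute)
    show "(\<Sum>i\<in>A P. kap c i / real i) \<le> (\<Prod>p\<in>P. 1 + 2 * c p / real p)"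
      using insert.IH insert.prems by (simp add: A_def)
    show "0 \<le> (\<Sum>i\<in>A P. kap c i / real i)" using kn by (intro sum_nonneg) auto
  qed (use assms(3)[OF p] in auto)
  finally show ?case using insert.hyps by (simp add: A_def)
qed

lemma sum_kap_over_le_exp:
  assumes "\<And>p. prime p \<Longrightarrow> c p \<ge> 0"
  shows "(\<Sum>j=1..n. kap c j / real j) \<le> exp (2 * (\<Sum>p | prime p \<and> p \<le> n. c p / real p))"
proof -
  let ?P = "{p. prime p \<and> p \<le> n}"
  have "(\<Sum>j=1..n. kap c j / real j) = (\<Sum>j | 1 \<le> j \<and> j \<le> n \<and> prime_factors j \<subseteq> ?P. kap c j / real j)"
    by (intro sum.cong) (auto simp: in_prime_factors_iff intro: order.trans[OF dvd_imp_le])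
  also have "\<dots> \<le> (\<Prod>p\<in>?P. 1 + 2 * c p / real p)"
    by (rule sum_kap_over_le_prod) (use assms in auto)
  also have "\<dots> \<le> (\<Prod>p\<in>?P. exp (2 * c p / real p))"
    using assms by (intro prod_mono) (auto intro: exp_ge_add_one_self add_nonneg_nonneg)
  also have "\<dots> = exp (2 * (\<Sum>p\<in>?P. c p / real p))"
    by (simp add: exp_sum sum_distrib_left)
  finally show ?thesis .
qed

lemma ln_eq_sum_prime_factors:
  assumes "j > 0"
  shows "ln (real j) = (\<Sum>p\<in>prime_factors j. ln (real (p ^ multiplicity p j)))"
proof -
  have "ln (real j) = ln (real (\<Prod>p\<in>prime_factors j. p ^ multiplicity p j))"
    using prime_factorization_nat[OF assms] by simp
  also have "\<dots> = (\<Sum>p\<in>prime_factors j. ln (real (p ^ multiplicity p j)))"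
    by (subst of_nat_prod, subst ln_prod) (auto simp: prime_gt_0_nat in_prime_factors_iff)
  finally show ?thesis .
qed

text \<open>\<open>ln j\<close> is the sum of \<open>ln (p ^ a)\<close> over the exact prime powers
  in \<open>j\<close>. Writing \<open>j = p ^ a * i\<close> separates \<open>kap c j\<close> into
  \<open>c p * kap c i\<close>; then \<open>c p \<le> D * ln y\<close>, and the prime powers
  \<open>q \<le> y / i\<close> are summed by \<open>sum_primepow_ln_le\<close>. The bound on
  \<open>c\<close> by the logarithm is what yields the small factor \<open>D\<close>.\<close>

lemma sum_kap_ln_le:
  assumes c0: "\<And>p. prime p \<Longrightarrow> c p \<ge> 0" and cD: "\<And>p. prime p \<Longrightarrow> c p \<le> D * ln (real p)" and D: "D \<ge> 0"
  shows "(\<Sum>j=1..y. kap c j * ln (real j)) \<le> 36 * D * ln (real y) * real y * (\<Sum>j=1..y. kap c j / real j)"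
proof -
  have kn: "kap c i \<ge> 0" for i by (rule kap_nonneg) (use c0 in auto)
  define Q where "Q i = {q. primepow q \<and> q \<le> y div i}" for i
  have finQ: "finite (Q i)" for i by (rule finite_subset[of _ "{..y div i}"]) (auto simp: Q_def)
  define F where "F = (\<lambda>(i,q). kap c i * (D * ln (real y) * ln (real q)))"
  have "(\<Sum>j=1..y. kap c j * ln (real j)) = (\<Sum>j=1..y. \<Sum>p\<in>prime_factors j. kap c j * ln (real (p ^ multiplicity p j)))"
    by (intro sum.cong refl, subst ln_eq_sum_prime_factors) (simp_all add: sum_distrib_left)
  also have "\<dots> = (\<Sum>(j,p)\<in>Sigma {1..y} prime_factors. kap c j * ln (real (p ^ multiplicity p j)))"
    by (subst sum.Sigma) auto
  \<comment> \<open>The pair \<open>(j, p)\<close> is recovered from \<open>(i, q)\<close>, because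
    the prime power \<open>q\<close> determines \<open>p\<close>.\<close>
  also have "\<dots> \<le> sum F (Sigma {1..y} Q)"
  proof (rule sum_le_included[where i = "\<lambda>(i,q). (q * i, aprimedivisor q)"])
    show "finite (Sigma {1..y} prime_factors)" by auto
    show "finite (Sigma {1..y} Q)" using finQ by auto
    show "\<forall>z\<in>Sigma {1..y} Q. 0 \<le> F z"
      using kn D by (auto simp: F_def Q_def Suc_le_eq primepow_gt_0_nat intro!: mult_nonneg_nonneg ln_ge_zero)
    show "\<forall>x\<in>Sigma {1..y} prime_factors. \<exists>z\<in>Sigma {1..y} Q. (case z of (i, q) \<Rightarrow> (q * i, aprimedivisor q)) = x \<and>
        (case x of (j, p) \<Rightarrow> kap c j * ln (real (p ^ multiplicity p j))) \<le> F z"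
    proof
      fix x assume "x \<in> Sigma {1..y} prime_factors"
      then obtain j p where x: "x = (j,p)" "1 \<le> j" "j \<le> y" "p \<in> prime_factors j" by auto
      have p: "prime p" and j0: "j > 0" using x by auto
      define a where "a = multiplicity p j"
      have a: "a > 0" using x(4) by (simp add: a_def prime_factors_multiplicity)
      obtain i where i: "j = p ^ a * i" "\<not> p dvd i" "i > 0" "i \<le> j"
        using decompose_prime_power[OF p j0] a_def by blast
      have pa: "p ^ a > 0" using p by (simp add: prime_gt_0_nat)
      have mem: "(i, p ^ a) \<in> Sigma {1..y} Q"
        using i(1,3) x(2,3) order.trans[OF i(4) x(3)] p a by (auto simp: Q_def less_eq_div_iff_mult_less_eq)
      have eq: "(p ^ a * i, aprimedivisor (p ^ a)) = x"
        using x i(1) aprimedivisor_prime_power[OF p a] by simp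
      have kj: "kap c j = c p * kap c i"
        by (subst i(1)) (rule kap_mult_prime_power[OF p i(2,3) a])
      have "p \<le> j" using x(4) j0 by (auto intro: dvd_imp_le)
      hence "ln (real p) \<le> ln (real y)" using x p by (intro ln_mono) (auto simp: prime_gt_0_nat)
      hence "c p \<le> D * ln (real y)" using cD[OF p] D by (meson mult_left_mono order_trans)
      hence "kap c i * (c p * ln (real (p ^ a))) \<le> kap c i * (D * ln (real y) * ln (real (p ^ a)))"
        using kn pa by (intro mult_left_mono mult_right_mono ln_ge_zero) (auto simp: Suc_le_eq simp del: of_nat_power)
      hence "kap c j * ln (real (p ^ multiplicity p j)) \<le> F (i, p ^ a)"
        unfolding F_def prod.case a_def[symmetric] kj by (simp only: mult_ac)
      thus "\<exists>z\<in>Sigma {1..y} Q. (case z of (i, q) \<Rightarrow> (q * i, aprimedivisor q)) = x \<and>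
        (case x of (j, p) \<Rightarrow> kap c j * ln (real (p ^ multiplicity p j))) \<le> F z"
        using mem eq x(1) by (intro bexI[of _ "(i, p ^ a)"]) auto
    qed
  qed
  also have "\<dots> = (\<Sum>i=1..y. \<Sum>q\<in>Q i. kap c i * (D * ln (real y) * ln (real q)))"
    unfolding F_def by (subst sum.Sigma) (use finQ in auto)
  also have "\<dots> = (\<Sum>i=1..y. kap c i * (D * ln (real y)) * (\<Sum>q\<in>Q i. ln (real q)))"
    by (simp add: sum_distrib_left mult_ac)
  also have "\<dots> \<le> (\<Sum>i=1..y. kap c i * (D * ln (real y)) * (36 * (real y / real i)))"
  proof (intro sum_mono mult_left_mono)
    fix i assume "i \<in> {1..y}"
    have "(\<Sum>q\<in>Q i. ln (real q)) \<le> 36 * real (y div i)" unfolding Q_def by (rule sum_primepow_ln_le)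
    also have "\<dots> \<le> 36 * (real y / real i)" using of_nat_div_le_of_nat[of y i, where ?'a=real] by simp
    finally show "(\<Sum>q\<in>Q i. ln (real q)) \<le> 36 * (real y / real i)" .
  qed (use kn D in \<open>auto intro!: mult_nonneg_nonneg ln_ge_zero\<close>)
  also have "\<dots> = 36 * D * ln (real y) * real y * (\<Sum>j=1..y. kap c j / real j)"
    by (simp add: sum_distrib_left mult_ac)
  finally show ?thesis .
qed

text \<open>Multiplying by \<open>ln y = ln j + ln (y / j)\<close> reduces the sum to
  \<open>sum_kap_ln_le\<close> and to the sum of \<open>kap c j * (y / j)\<close>. The index 1 is
  left out because \<open>kap c 1 = 1\<close> carries no factor \<open>D\<close>; without it the
  second sum is \<open>y * (Z - 1)\<close>, and \<open>exp x - 1 \<le> x * exp x\<close> recovers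
  \<open>D * ln y\<close>. The constants 36 and 4 add up to 40.\<close>

lemma sum_kap_le:
  assumes c0: "\<And>p. prime p \<Longrightarrow> c p \<ge> 0" and cD: "\<And>p. prime p \<Longrightarrow> c p \<le> D * ln (real p)" and D: "D \<ge> 0"
    and s: "(\<Sum>p | prime p \<and> p \<le> y. c p / real p) \<le> s"
  shows "(\<Sum>j=2..y. kap c j) \<le> 40 * D * real y * exp (2 * s)"
proof (cases "y \<ge> 2")
  case True
  define Z where "Z = (\<Sum>j=1..y. kap c j / real j)"
  \<comment> \<open>The exact prime sum is kept apart from its bound \<open>s\<close>: its linear
    occurrence is estimated by \<open>2 * D * ln y\<close>, and only its occurrence in the exponent
    by \<open>s\<close>.\<close>
  define s' where "s' = (\<Sum>p | prime p \<and> p \<le> y. c p / real p)"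
  have lny: "ln (real y) > 0" using True by simp
  have kn: "kap c i \<ge> 0" for i by (rule kap_nonneg) (use c0 in auto)
  have s'0: "s' \<ge> 0" unfolding s'_def using c0 by (intro sum_nonneg) auto
  have "s' \<le> (\<Sum>p | prime p \<and> p \<le> y. D * (ln (real p) / real p))"
    unfolding s'_def using cD by (intro sum_mono) (auto simp: divide_right_mono)
  also have "\<dots> \<le> D * (2 * ln (real y))"
    unfolding sum_distrib_left[symmetric] using sum_primes_ln_over_le[of y] D by (rule mult_left_mono)
  finally have s'D: "s' \<le> 2 * D * ln (real y)" by simp
  have Z: "Z \<le> exp (2 * s')" unfolding Z_def s'_def by (rule sum_kap_over_le_exp) (use c0 in auto)
  have e1: "exp (2 * s') - 1 \<le> 2 * s' * exp (2 * s')"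
  proof -
    have "1 - 2 * s' \<le> exp (- (2 * s'))" using exp_ge_add_one_self[of "- (2 * s')"] by simp
    hence "(1 - 2 * s') * exp (2 * s') \<le> exp (- (2 * s')) * exp (2 * s')" by (intro mult_right_mono) auto
    thus ?thesis by (simp add: exp_minus field_simps)
  qed
  have split1: "(\<Sum>j=1..y. f j) = f 1 + (\<Sum>j=2..y. f j)" for f :: "nat \<Rightarrow> real"
    using True by (simp add: sum.atLeast_Suc_atMost numeral_2_eq_2)
  have "ln (real y) * (\<Sum>j=2..y. kap c j) = (\<Sum>j=2..y. kap c j * ln (real j)) + (\<Sum>j=2..y. kap c j * ln (real y / real j))"
    unfolding sum.distrib[symmetric] sum_distrib_left
    by (intro sum.cong refl) (use True in \<open>auto simp: ln_div algebra_simps\<close>)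
  also have "(\<Sum>j=2..y. kap c j * ln (real j)) = (\<Sum>j=1..y. kap c j * ln (real j))"
    using split1[of "\<lambda>j. kap c j * ln (real j)"] by simp
  also have "\<dots> \<le> 36 * D * ln (real y) * real y * Z"
    unfolding Z_def by (rule sum_kap_ln_le) (use assms in auto)
  also have "\<dots> \<le> 36 * D * ln (real y) * real y * exp (2 * s')"
    using D lny by (intro mult_left_mono Z) auto
  also have "(\<Sum>j=2..y. kap c j * ln (real y / real j)) \<le> (\<Sum>j=2..y. kap c j * (real y / real j))"
  proof (intro sum_mono mult_left_mono kn)
    fix j assume j: "j \<in> {2..y}"
    have "ln (real y / real j) \<le> real y / real j - 1" using j by (intro ln_le_minus_one) auto
    thus "ln (real y / real j) \<le> real y / real j" by simp
  qed
  also have "\<dots> = real y * (Z - 1)"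
    unfolding Z_def split1 by (simp add: sum_distrib_left mult_ac)
  also have "\<dots> \<le> real y * (2 * (2 * D * ln (real y)) * exp (2 * s'))"
  proof (intro mult_left_mono)
    have "Z - 1 \<le> 2 * s' * exp (2 * s')" using Z e1 by linarith
    also have "\<dots> \<le> 2 * (2 * D * ln (real y)) * exp (2 * s')" using s'D by (intro mult_right_mono mult_left_mono) auto
    finally show "Z - 1 \<le> 2 * (2 * D * ln (real y)) * exp (2 * s')" .
  qed auto
  finally have "ln (real y) * (\<Sum>j=2..y. kap c j) \<le> ln (real y) * (40 * D * real y * exp (2 * s'))"
    by (simp add: algebra_simps)
  hence "(\<Sum>j=2..y. kap c j) \<le> 40 * D * real y * exp (2 * s')" using lny by simp
  also have "\<dots> \<le> 40 * D * real y * exp (2 * s)" using D s by (intro mult_left_mono) (auto simp: s'_def)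
  finally show ?thesis .
qed (use D in auto)

text \<open>Induction on the scale: doubling raises only the terms with \<open>x p < 2\<close>, that
  is \<open>ln p < 2 / (2 ^ t * w)\<close>, and by \<open>sum_primes_ln_over_le\<close> these add at
  most 4 altogether, whatever the scale.\<close>

lemma sum_min_ln_over_le:
  assumes w: "w > 0"
  shows "(\<Sum>p | prime p \<and> p \<le> y. min 2 (2 ^ t * (w * ln (real p))) / real p) \<le> 2 * w * ln (real y) + 4 * real t"
proof (induction t)
  case 0
  have "(\<Sum>p | prime p \<and> p \<le> y. min 2 (2 ^ 0 * (w * ln (real p))) / real p) \<le> (\<Sum>p | prime p \<and> p \<le> y. w * (ln (real p) / real p))"
    by (intro sum_mono) (auto simp: divide_right_mono)
  also have "\<dots> \<le> w * (2 * ln (real y))"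
    unfolding sum_distrib_left[symmetric] using sum_primes_ln_over_le[of y] w by (intro mult_left_mono) auto
  finally show ?case by simp
next
  case (Suc t)
  define x where "x p = 2 ^ t * (w * ln (real p))" for p :: nat
  define z where "z = nat \<lfloor>exp (2 / (2 ^ t * w))\<rfloor>"
  have "(\<Sum>p | prime p \<and> p \<le> y. min 2 (2 ^ Suc t * (w * ln (real p))) / real p)
      \<le> (\<Sum>p | prime p \<and> p \<le> y. min 2 (x p) / real p + (if x p < 2 then x p / real p else 0))"
  proof (rule sum_mono)
    fix p assume "p \<in> {p. prime p \<and> p \<le> y}"
    have "min 2 (2 * x p) \<le> min 2 (x p) + (if x p < 2 then x p else 0)" by auto
    hence "min 2 (2 * x p) / real p \<le> (min 2 (x p) + (if x p < 2 then x p else 0)) / real p"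
      by (rule divide_right_mono) auto
    moreover have "2 ^ Suc t * (w * ln (real p)) = 2 * x p" by (simp add: x_def)
    ultimately show "min 2 (2 ^ Suc t * (w * ln (real p))) / real p \<le> min 2 (x p) / real p + (if x p < 2 then x p / real p else 0)"
      by (simp only: add_divide_distrib) (auto split: if_splits)
  qed
  also have "\<dots> = (\<Sum>p | prime p \<and> p \<le> y. min 2 (x p) / real p) + (\<Sum>p | prime p \<and> p \<le> y \<and> x p < 2. x p / real p)"
    by (simp add: sum.distrib sum.inter_filter[symmetric] conj_assoc)
  also have "(\<Sum>p | prime p \<and> p \<le> y \<and> x p < 2. x p / real p) \<le> (\<Sum>p | prime p \<and> p \<le> z. x p / real p)"
  proof (rule sum_mono2)
    show "{p. prime p \<and> p \<le> y \<and> x p < 2} \<subseteq> {p. prime p \<and> p \<le> z}"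
    proof safe
      fix p assume p: "prime p" "x p < 2"
      hence p0: "real p > 0" by (simp add: prime_gt_0_nat)
      have "ln (real p) \<le> 2 / (2 ^ t * w)" using p(2) w by (simp add: x_def field_simps)
      hence "real p \<le> exp (2 / (2 ^ t * w))" using p0 by (simp add: ln_le_cancel_iff[symmetric] del: ln_le_cancel_iff)
      thus "p \<le> z" by (simp add: z_def le_nat_iff le_floor_iff)
    qed
    fix p assume "p \<in> {p. prime p \<and> p \<le> z} - {p. prime p \<and> p \<le> y \<and> x p < 2}"
    hence "real p \<ge> 1" using prime_gt_0_nat[of p] by auto
    thus "0 \<le> x p / real p" using w by (simp add: x_def)
  qed auto
  also have "\<dots> = 2 ^ t * w * (\<Sum>p | prime p \<and> p \<le> z. ln (real p) / real p)"
    by (simp add: x_def sum_distrib_left mult_ac)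
  also have "\<dots> \<le> 2 ^ t * w * (2 * ln (real z))"
    using w by (intro mult_left_mono sum_primes_ln_over_le) auto
  also have "\<dots> \<le> 2 ^ t * w * (2 * (2 / (2 ^ t * w)))"
  proof (intro mult_left_mono)
    have "exp (2 / (2 ^ t * w)) \<ge> 1" using w by simp
    hence z1: "real z \<ge> 1" and z2: "real z \<le> exp (2 / (2 ^ t * w))" by (auto simp: z_def le_floor_iff Suc_le_eq)
    have "ln (real z) \<le> ln (exp (2 / (2 ^ t * w)))" using z1 z2 by (intro ln_mono) auto
    thus "ln (real z) \<le> 2 / (2 ^ t * w)" by simp
  qed (use w in auto)
  also have "\<dots> = 4" using w by simp
  finally show ?case using Suc.IH by (simp add: x_def)
qed

text \<open>The order of choices matters: \<open>m\<close> and \<open>C\<close> are fixed before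
  \<open>n\<close> and \<open>w\<close>, while \<open>\<kappa>\<close> may depend on both. The
  summand 1 in \<open>1 + w * y\<close> accounts for \<open>j = 1\<close>, where there is nothing to
  difference; all other \<open>j\<close> bring the factor \<open>w\<close>.\<close>

lemma riesz_kernel_bound:
  assumes W: "W \<ge> 0"
  shows "\<exists>m C. m \<ge> 1 \<and> C \<ge> 0 \<and> (\<forall>n w. n \<ge> 1 \<longrightarrow> w > 0 \<longrightarrow> w * ln (real n) \<le> W \<longrightarrow>
    (\<exists>\<kappa>. (\<forall>j. \<kappa> j \<ge> 0) \<and> (\<forall>y\<le>n. (\<Sum>j=1..y. \<kappa> j) \<le> C * (1 + w * real y)) \<and>
      (\<forall>u v j. 0 \<le> u \<longrightarrow> u \<le> w \<longrightarrow> v \<ge> 0 \<longrightarrow>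
        \<bar>idiff (\<lambda>p. u * ln (real p)) (prime_factors j) (riesz m) v\<bar> \<le> \<kappa> j \<and>
        \<bar>idiff (\<lambda>p. u * ln (real p)) (prime_factors j) (riesz (Suc m)) v\<bar> \<le> \<kappa> j)))"
proof -
  \<comment> \<open>Scale \<open>t\<close> contributes \<open>2 ^ t\<close> from
    \<open>D = 2 ^ t * w\<close> and \<open>exp (8 * t)\<close> from \<open>exp (2 * s)\<close>,
    where \<open>s\<close> grows by 4 per doubling. \<open>J\<close> is chosen so that the weight
    \<open>(1 / 2 ^ J) ^ t\<close> turns this into a geometric series of ratio at most 1/2.\<close>
  obtain J where "4 * exp 8 < (2::real) ^ J" using real_arch_pow[of 2 "4 * exp 8"] by auto
  hence J: "2 * exp 8 / 2 ^ J \<le> (1/2::real)" by (simp add: field_simps)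
  have J1: "1 / 2 ^ J \<le> (1/2::real)"
  proof -
    have "1 / 2 ^ J \<le> 2 * exp 8 / (2 ^ J :: real)" by (intro divide_right_mono) (auto intro: order.trans[of 1 2])
    thus ?thesis using J by linarith
  qed
  have geo: "(\<Sum>t\<le>N. x ^ t) \<le> 2" if "0 \<le> x" "x \<le> 1/2" for x :: real and N
    using sum_geometric_half[OF that, of N] that by (simp add: atMost_atLeast0 sum.atLeast_Suc_atMost)
  define m where "m = Suc J"
  define M where "M = (2 * real (Suc m)) ^ J"
  have M: "M \<ge> 0" "(2 * real m) ^ J \<le> M" unfolding M_def by (simp, intro power_mono) auto
  define C where "C = M * (80 * exp (4 * W) + 2)"
  have C0: "C \<ge> 0" using M by (simp add: C_def add_nonneg_nonneg)
  have "\<exists>\<kappa>. (\<forall>j. \<kappa> j \<ge> 0) \<and> (\<forall>y\<le>n. (\<Sum>j=1..y. \<kappa> j) \<le> C * (1 + w * real y)) \<and>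
      (\<forall>u v j. 0 \<le> u \<longrightarrow> u \<le> w \<longrightarrow> v \<ge> 0 \<longrightarrow>
        \<bar>idiff (\<lambda>p. u * ln (real p)) (prime_factors j) (riesz m) v\<bar> \<le> \<kappa> j \<and>
        \<bar>idiff (\<lambda>p. u * ln (real p)) (prime_factors j) (riesz (Suc m)) v\<bar> \<le> \<kappa> j)"
    if n: "n \<ge> 1" and w: "w > 0" and wn: "w * ln (real n) \<le> W" for n :: nat and w :: real
  proof -
    \<comment> \<open>\<open>N\<close> depends on \<open>w\<close>, which does no harm: the
      geometric series is bounded independently of \<open>N\<close>.\<close>
    obtain N where "2 / (w * ln 2) < 2 ^ N" using real_arch_pow[of 2 "2 / (w * ln 2)"] by auto
    hence N: "2 \<le> 2 ^ N * (w * ln 2)" using w by (simp add: field_simps)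
    define c where "c t = (\<lambda>p::nat. min 2 (2 ^ t * (w * ln (real p))))" for t :: nat
    define S where "S j = (\<Sum>t\<le>N. (1 / 2 ^ J) ^ t * kap (c t) j)" for j
    have c0: "c t p \<ge> 0" if "prime p" for t p
      using that w by (auto simp: c_def Suc_le_eq prime_gt_0_nat)
    have S0: "S j \<ge> 0" for j
      unfolding S_def by (intro sum_nonneg mult_nonneg_nonneg kap_nonneg c0) auto
    have bound: "(\<Sum>j=1..y. S j) \<le> (80 * exp (4 * W) + 2) * (1 + w * real y)" if y: "1 \<le> y" "y \<le> n" for y
    proof -
      have "(\<Sum>j=2..y. S j) = (\<Sum>t\<le>N. (1 / 2 ^ J) ^ t * (\<Sum>j=2..y. kap (c t) j))"
        unfolding S_def by (subst sum.swap) (simp add: sum_distrib_left)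
      also have "\<dots> \<le> (\<Sum>t\<le>N. (1 / 2 ^ J) ^ t * (40 * (2 ^ t * w) * real y * exp (2 * (2 * W + 4 * real t))))"
      proof (intro sum_mono mult_left_mono sum_kap_le c0)
        fix t
        have "ln (real y) \<le> ln (real n)" using y by (intro ln_mono) auto
        hence "w * ln (real y) \<le> W" using wn w by (meson mult_left_mono less_imp_le order_trans)
        thus "(\<Sum>p | prime p \<and> p \<le> y. c t p / real p) \<le> 2 * W + 4 * real t"
          using sum_min_ln_over_le[OF w, of t y] by (simp add: c_def)
      qed (use w in \<open>auto simp: c_def mult.assoc\<close>)
      also have "\<dots> = 40 * exp (4 * W) * w * real y * (\<Sum>t\<le>N. (2 * exp 8 / 2 ^ J) ^ t)"
        unfolding sum_distrib_left
      proof (intro sum.cong refl)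
        fix t
        have "exp (2 * (2 * W + 4 * real t)) = exp (4 * W) * exp 8 ^ t"
          by (simp add: exp_add[symmetric] exp_of_nat_mult[symmetric] algebra_simps)
        thus "(1 / 2 ^ J) ^ t * (40 * (2 ^ t * w) * real y * exp (2 * (2 * W + 4 * real t)))
          = 40 * exp (4 * W) * w * real y * (2 * exp 8 / 2 ^ J) ^ t"
          by (simp add: power_divide power_mult_distrib)
      qed
      also have "\<dots> \<le> 40 * exp (4 * W) * w * real y * 2"
        using w J by (intro mult_left_mono geo) auto
      finally have a: "(\<Sum>j=2..y. S j) \<le> 80 * exp (4 * W) * (w * real y)" by simp
      have b: "S 1 \<le> 2" using geo[of "1 / 2 ^ J" N] J1 by (simp add: S_def)
      have "(\<Sum>j=1..y. S j) = S 1 + (\<Sum>j=2..y. S j)"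
        using y by (simp add: sum.atLeast_Suc_atMost numeral_2_eq_2)
      also have "\<dots> \<le> 2 + 80 * exp (4 * W) * (w * real y)" using a b by linarith
      also have "\<dots> \<le> (80 * exp (4 * W) + 2) * (1 + w * real y)"
        using w by (simp add: algebra_simps)
      finally show ?thesis .
    qed
    show ?thesis
    proof (intro exI[of _ "\<lambda>j. M * S j"] conjI allI impI)
      fix y assume y: "y \<le> n"
      show "(\<Sum>j=1..y. M * S j) \<le> C * (1 + w * real y)"
      proof (cases "y = 0")
        case False
        thus ?thesis using bound[of y] y M(1) by (simp add: C_def sum_distrib_left[symmetric] mult_left_mono mult.assoc)
      qed (use C0 in auto)
    next
      fix u v :: real and j assume uv: "0 \<le> u" "u \<le> w" "v \<ge> 0"
      have "\<bar>idiff (\<lambda>p. u * ln (real p)) (prime_factors j) (riesz m) v\<bar> \<le> (2 * real m) ^ J * S j"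
        unfolding S_def c_def by (rule abs_idiff_prime_factors_le) (use uv w N in \<open>auto simp: m_def\<close>)
      also have "\<dots> \<le> M * S j" by (intro mult_right_mono M S0)
      finally show "\<bar>idiff (\<lambda>p. u * ln (real p)) (prime_factors j) (riesz m) v\<bar> \<le> M * S j" .
      show "\<bar>idiff (\<lambda>p. u * ln (real p)) (prime_factors j) (riesz (Suc m)) v\<bar> \<le> M * S j"
        unfolding S_def c_def M_def by (rule abs_idiff_prime_factors_le) (use uv w N in \<open>auto simp: m_def\<close>)
    qed (use M S0 in auto)
  qed
  thus ?thesis using C0 by (intro exI[of _ m] exI[of _ C]) (auto simp: m_def)
qed

section \<open>Weighted Ingham sums\<close>

lemma sum_dvd_dvd_swap:
  fixes G :: "nat \<Rightarrow> nat \<Rightarrow> 'a::comm_monoid_add"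
  assumes "N > 0"
  shows "(\<Sum>e | e dvd N. \<Sum>k | k dvd e. G e k) = (\<Sum>k | k dvd N. \<Sum>i | i dvd N div k. G (k * i) k)"
proof -
  have fin: "finite {d. d dvd M}" if "M dvd N" for M using assms that by (intro finite_divisors_nat) auto
  have "(\<Sum>e | e dvd N. \<Sum>k | k dvd e. G e k) = (\<Sum>(e,k)\<in>Sigma {e. e dvd N} (\<lambda>e. {k. k dvd e}). G e k)"
    by (subst sum.Sigma) (use fin in auto)
  also have "\<dots> = (\<Sum>(k,i)\<in>Sigma {k. k dvd N} (\<lambda>k. {i. i dvd N div k}). G (k * i) k)"
    by (rule sum.reindex_bij_witness[of _ "\<lambda>(k,i). (k * i, k)" "\<lambda>(e,k). (k, e div k)"])
       (use assms in \<open>auto elim!: dvdE\<close>)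
  also have "\<dots> = (\<Sum>k | k dvd N. \<Sum>i | i dvd N div k. G (k * i) k)"
    by (subst sum.Sigma) (use fin in \<open>auto simp: div_dvd_iff_mult\<close>)
  finally show ?thesis .
qed

lemma sum_dvd_cofactor_swap:
  fixes H :: "nat \<Rightarrow> nat \<Rightarrow> 'a::comm_monoid_add"
  assumes "M > 0"
  shows "(\<Sum>i | i dvd M. \<Sum>d | d dvd M div i. H i d) = (\<Sum>q | q dvd M. \<Sum>d | d dvd q. H (q div d) d)"
proof -
  have fin: "finite {d. d dvd K}" if "K dvd M" for K using assms that by (intro finite_divisors_nat) auto
  have "(\<Sum>i | i dvd M. \<Sum>d | d dvd M div i. H i d) = (\<Sum>(i,d)\<in>Sigma {i. i dvd M} (\<lambda>i. {d. d dvd M div i}). H i d)"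
    by (subst sum.Sigma) (use fin in \<open>auto simp: div_dvd_iff_mult\<close>)
  also have "\<dots> = (\<Sum>(q,d)\<in>Sigma {q. q dvd M} (\<lambda>q. {d. d dvd q}). H (q div d) d)"
    by (rule sum.reindex_bij_witness[of _ "\<lambda>(q,d). (q div d, d)" "\<lambda>(i,d). (i * d, d)"])
       (use assms in \<open>auto elim!: dvdE\<close>)
  also have "\<dots> = (\<Sum>q | q dvd M. \<Sum>d | d dvd q. H (q div d) d)"
    by (subst sum.Sigma) (use fin in auto)
  finally show ?thesis .
qed

text \<open>With \<open>e = k * i\<close> and \<open>q = i * d\<close> the argument of
  \<open>X\<close> becomes \<open>k * q\<close>, so the Moebius sum over \<open>d dvd q\<close>
  leaves only \<open>q = 1\<close>. The weight \<open>X\<close> is arbitrary, so a cutoff can be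
  inserted.\<close>

lemma moebius_inversion_weighted:
  fixes b :: "nat \<Rightarrow> complex" and X :: "nat \<Rightarrow> complex"
  assumes "N > 0"
  shows "(\<Sum>e | e dvd N. (\<Sum>k | k dvd e. b k) * (\<Sum>d | d dvd N div e. of_real (moebius d) * X (e * d)))
       = (\<Sum>k | k dvd N. b k * X k)"
proof -
  have "(\<Sum>e | e dvd N. (\<Sum>k | k dvd e. b k) * (\<Sum>d | d dvd N div e. of_real (moebius d) * X (e * d)))
      = (\<Sum>e | e dvd N. \<Sum>k | k dvd e. b k * (\<Sum>d | d dvd N div e. of_real (moebius d) * X (e * d)))"
    by (simp add: sum_distrib_right)
  also have "\<dots> = (\<Sum>k | k dvd N. \<Sum>i | i dvd N div k. b k * (\<Sum>d | d dvd N div (k * i). of_real (moebius d) * X (k * i * d)))"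
    by (rule sum_dvd_dvd_swap[OF assms])
  also have "\<dots> = (\<Sum>k | k dvd N. b k * X k)"
  proof (rule sum.cong[OF refl])
    fix k assume "k \<in> {k. k dvd N}"
    hence k: "k dvd N" "k > 0" "N div k > 0" using assms by (auto elim!: dvdE)
    have "(\<Sum>i | i dvd N div k. b k * (\<Sum>d | d dvd N div (k * i). of_real (moebius d) * X (k * i * d)))
        = b k * (\<Sum>i | i dvd N div k. \<Sum>d | d dvd N div k div i. of_real (moebius d) * X (k * i * d))"
      by (simp add: sum_distrib_left div_mult2_eq)
    also have "(\<Sum>i | i dvd N div k. \<Sum>d | d dvd N div k div i. of_real (moebius d) * X (k * i * d))
        = (\<Sum>q | q dvd N div k. \<Sum>d | d dvd q. of_real (moebius d) * X (k * (q div d) * d))"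
      by (rule sum_dvd_cofactor_swap[OF k(3)])
    also have "\<dots> = (\<Sum>q | q dvd N div k. if q = 1 then X k else 0)"
    proof (rule sum.cong[OF refl])
      fix q assume "q \<in> {q. q dvd N div k}"
      hence q: "q > 0" using k by (auto intro: Nat.gr0I)
      have "(\<Sum>d | d dvd q. of_real (moebius d) * X (k * (q div d) * d)) = (\<Sum>d | d dvd q. of_real (moebius d) * X (k * q))"
        by (intro sum.cong) (auto simp: mult.assoc)
      also have "\<dots> = of_real (\<Sum>d | d dvd q. moebius d) * X (k * q)"
        by (simp add: sum_distrib_right)
      also have "\<dots> = (if q = 1 then X k else 0)"
        using sum_dvd_moebius_eq_0[of q] q by (cases "q = 1") auto
      finally show "(\<Sum>d | d dvd q. of_real (moebius d) * X (k * (q div d) * d)) = (if q = 1 then X k else 0)" .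
    qed
    also have "\<dots> = X k" using k(3) by (subst sum.delta) (auto intro: finite_divisors_nat)
    finally show "(\<Sum>i | i dvd N div k. b k * (\<Sum>d | d dvd N div (k * i). of_real (moebius d) * X (k * i * d))) = b k * X k" .
  qed
  finally show ?thesis .
qed

section \<open>Ingham sums under a change of weights\<close>

definition ingham_sum :: "(nat \<Rightarrow> complex) \<Rightarrow> nat \<Rightarrow> complex" where
  "ingham_sum c n = (\<Sum>k=1..n. c k * of_nat (n div k))"

lemma ingham_sum_conv_divisor_sum: "ingham_sum c n = (\<Sum>m=1..n. \<Sum>d | d dvd m. c d)"
  unfolding ingham_sum_def by (subst sum_dvd_hyperbola) (simp add: mult.commute)

lemma sum_by_parts_nat:
  fixes g V :: "nat \<Rightarrow> 'a::comm_ring"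
  shows "(\<Sum>e=1..n. g e * V e) = (\<Sum>i=1..n. g i) * V (Suc n) + (\<Sum>e=1..n. (\<Sum>i=1..e. g i) * (V e - V (Suc e)))"
  by (induction n) (auto simp: algebra_simps)

text \<open>The weighted inversion moves \<open>X\<close> into a kernel and leaves the plain divisor
  sums of \<open>b\<close>, on which partial summation can act.\<close>

lemma ingham_sum_weighted:
  fixes X :: "nat \<Rightarrow> real"
  defines "V \<equiv> \<lambda>n e. \<Sum>j=1..n div e. \<Sum>d | d dvd j. moebius d * X (e * d)"
  shows "ingham_sum (\<lambda>k. b k * of_real (X k)) n
       = (\<Sum>e=1..n. ingham_sum b e * of_real (V n e - V n (Suc e)))"
proof -
  have "ingham_sum (\<lambda>k. b k * of_real (X k)) n = (\<Sum>m=1..n. \<Sum>k | k dvd m. b k * of_real (X k))"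
    by (rule ingham_sum_conv_divisor_sum)
  also have "\<dots> = (\<Sum>m=1..n. \<Sum>e | e dvd m. (\<Sum>k | k dvd e. b k) * (\<Sum>d | d dvd m div e. of_real (moebius d) * of_real (X (e * d))))"
    by (rule sum.cong[OF refl], rule moebius_inversion_weighted[symmetric]) auto
  also have "\<dots> = (\<Sum>e=1..n. \<Sum>j=1..n div e. (\<Sum>k | k dvd e. b k) * (\<Sum>d | d dvd j. of_real (moebius d) * of_real (X (e * d))))"
    by (rule sum_dvd_hyperbola)
  also have "\<dots> = (\<Sum>e=1..n. (\<Sum>k | k dvd e. b k) * of_real (V n e))"
    by (simp add: V_def sum_distrib_left)
  \<comment> \<open>\<open>V n (Suc n)\<close> is an empty sum, so there is no boundary
    term.\<close>
  also have "\<dots> = (\<Sum>e=1..n. ingham_sum b e * of_real (V n e - V n (Suc e)))"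
    by (subst sum_by_parts_nat) (simp add: ingham_sum_conv_divisor_sum V_def)
  finally show ?thesis .
qed

text \<open>The logarithm turns a product of distinct primes into a sum of steps
  \<open>u * ln p\<close>.\<close>

lemma sum_dvd_moebius_riesz:
  assumes "e > 0" "j > 0"
  shows "(\<Sum>d | d dvd j. moebius d * riesz m (u * ln (real (e * d))))
       = idiff (\<lambda>p. u * ln (real p)) (prime_factors j) (riesz m) (u * ln (real e))"
proof -
  have "(\<Sum>d | d dvd j. moebius d * riesz m (u * ln (real (e * d))))
      = (\<Sum>I\<in>Pow (prime_factors j). (-1) ^ card I * riesz m (u * ln (real (e * \<Prod>I))))"
    by (rule sum_dvd_moebius) (use assms in auto)
  also have "\<dots> = idiff (\<lambda>p. u * ln (real p)) (prime_factors j) (riesz m) (u * ln (real e))"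
    unfolding idiff_def
  proof (intro sum.cong refl arg_cong2[where f = "(*)"] arg_cong[where f = "riesz m"])
    fix I assume I: "I \<in> Pow (prime_factors j)"
    have fin: "finite I" using I finite_subset[OF _ finite_set_mset] by blast
    have pos: "\<And>p. p \<in> I \<Longrightarrow> p > 0"
      using I by (auto simp: in_prime_factors_iff prime_gt_0_nat subset_iff)
    have "0 \<notin> I" using pos by blast
    hence "ln (real (e * \<Prod>I)) = ln (real e) + (\<Sum>p\<in>I. ln (real p))"
      using assms pos fin by (simp add: ln_mult prod_pos ln_prod)
    thus "u * ln (real (e * \<Prod>I)) = u * ln (real e) + (\<Sum>p\<in>I. u * ln (real p))"
      by (simp add: algebra_simps sum_distrib_left)
  qed
  finally show ?thesis .
qed

lemma sum_inverse_le: "n \<ge> 1 \<Longrightarrow> (\<Sum>e=1..n. 1 / real e) \<le> 1 + ln (real n)"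
proof (induction n rule: nat_induct_at_least)
  case (Suc n)
  have "1 / real (Suc n) \<le> ln (real (Suc n)) - ln (real n)"
  proof -
    have "ln (real n / real (Suc n)) \<le> real n / real (Suc n) - 1"
      using Suc.hyps by (intro ln_le_minus_one) auto
    thus ?thesis using Suc.hyps by (simp add: ln_div field_simps)
  qed
  thus ?case using Suc.IH by simp
qed simp

text \<open>The total variation of the kernel is governed by the mass of \<open>\<kappa>\<close> up
  to \<open>n div e\<close>, summed over \<open>e\<close>. This is at most
  \<open>C * (n + w * n * (1 + ln n))\<close>, and \<open>w * ln n \<le> W\<close> absorbs the
  logarithm of the harmonic sum.\<close>

lemma norm_ingham_sum_riesz_le:
  fixes b :: "nat \<Rightarrow> complex"
  assumes n: "n \<ge> 3" and w: "0 \<le> u" "u \<le> w" "w * ln (real n) \<le> W" and C: "C \<ge> 0" and m: "m \<ge> 1"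
    and k0: "\<And>j. \<kappa> j \<ge> 0" and K: "\<And>y. y \<le> n \<Longrightarrow> (\<Sum>j=1..y. \<kappa> j) \<le> C * (1 + w * real y)"
    and k1: "\<And>v j. v \<ge> 0 \<Longrightarrow> \<bar>idiff (\<lambda>p. u * ln (real p)) (prime_factors j) (riesz m) v\<bar> \<le> \<kappa> j"
    and k2: "\<And>v j. v \<ge> 0 \<Longrightarrow> \<bar>idiff (\<lambda>p. u * ln (real p)) (prime_factors j) (riesz (Suc m)) v\<bar> \<le> \<kappa> j"
    and T: "\<And>e. 1 \<le> e \<Longrightarrow> e \<le> n \<Longrightarrow> norm (ingham_sum b e) \<le> B * real e" and B: "B \<ge> 0"
  shows "norm (ingham_sum (\<lambda>k. b k * of_real (riesz (Suc m) (u * ln (real k)))) n)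
    \<le> B * (C * (1 + 2 * W) * (real (Suc m) * W + 1)) * real n"
proof -
  define Om where "Om e j = idiff (\<lambda>p. u * ln (real p)) (prime_factors j) (riesz (Suc m)) (u * ln (real e))" for e j
  define V where "V e = (\<Sum>j=1..n div e. Om e j)" for e
  define KK where "KK y = (\<Sum>j=1..y. \<kappa> j)" for y
  have KK0: "KK y \<ge> 0" for y unfolding KK_def using k0 by (intro sum_nonneg) auto
  have KKmono: "KK y \<le> KK z" if "y \<le> z" for y z
    unfolding KK_def using k0 that by (intro sum_mono2) auto
  \<comment> \<open>\<open>n \<ge> 3\<close> makes \<open>ln n \<ge> 1\<close>, hence
    \<open>u \<le> w \<le> W\<close>, which absorbs the isolated factors \<open>u\<close> and
    \<open>w\<close>.\<close>
  have lnn: "ln (real n) \<ge> 1"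
  proof -
    have "exp 1 \<le> real n" using exp_le n by linarith
    thus ?thesis using n by (subst ln_ge_iff) auto
  qed
  have wW: "w \<le> W"
  proof -
    have "w * 1 \<le> w * ln (real n)" using w lnn by (intro mult_left_mono) auto
    thus ?thesis using w by simp
  qed
  have W0: "W \<ge> 0" using w wW by linarith
  have dOm: "\<bar>Om e j - Om (Suc e) j\<bar> \<le> real (Suc m) * u / real e * \<kappa> j" if e: "e \<ge> 1" for e j
  proof (cases "u = 0")
    case True thus ?thesis by (simp add: Om_def)
  next
    case False
    hence u: "u > 0" using w by simp
    define v v' where "v = u * ln (real e)" and "v' = u * ln (real (Suc e))"
    have vv: "v < v'" "v \<ge> 0" using u e by (auto simp: v_def v'_def)
    have "v' - v = u * (ln (real (Suc e) / real e))" using e by (simp add: v_def v'_def ln_div algebra_simps)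
    also have "\<dots> \<le> u * (1 / real e)"
      using u e ln_le_minus_one[of "real (Suc e) / real e"] by (intro mult_left_mono) (auto simp: field_simps)
    finally have len: "v' - v \<le> u / real e" by simp
    from MVT2[OF vv(1), of "idiff (\<lambda>p. u * ln (real p)) (prime_factors j) (riesz (Suc m))"
        "\<lambda>v. - real (Suc m) * idiff (\<lambda>p. u * ln (real p)) (prime_factors j) (riesz m) v"]
    obtain z where z: "v < z" "Om (Suc e) j - Om e j = (v' - v) * (- real (Suc m) * idiff (\<lambda>p. u * ln (real p)) (prime_factors j) (riesz m) z)"
      using has_real_derivative_idiff_riesz[OF m] by (auto simp: Om_def v_def v'_def)
    have "\<bar>Om e j - Om (Suc e) j\<bar> = \<bar>Om (Suc e) j - Om e j\<bar>" by (rule abs_minus_commute)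
    also have "\<dots> = (v' - v) * (real (Suc m) * \<bar>idiff (\<lambda>p. u * ln (real p)) (prime_factors j) (riesz m) z\<bar>)"
      unfolding z(2) using vv by (simp add: abs_mult del: of_nat_Suc)
    also have "\<dots> \<le> u / real e * (real (Suc m) * \<kappa> j)"
      using len vv z u k0[of j] k1[of z j] by (intro mult_mono mult_left_mono) (auto intro!: mult_nonneg_nonneg)
    finally show ?thesis by (simp add: mult_ac)
  qed
  \<comment> \<open>Two sources of variation: the base point of the differences moves with
    \<open>e\<close>, and the range of \<open>j\<close> shrinks.\<close>
  have dV: "\<bar>V e - V (Suc e)\<bar> \<le> real (Suc m) * u / real e * KK (n div Suc e) + (KK (n div e) - KK (n div Suc e))"
    if e: "e \<ge> 1" for e
  proof -
    have le: "n div Suc e \<le> n div e" using e by (intro div_le_mono2) auto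
    have split: "(\<Sum>j=1..n div e. f j) = (\<Sum>j=1..n div Suc e. f j) + (\<Sum>j\<in>{n div Suc e<..n div e}. f j)" for f :: "nat \<Rightarrow> real"
      using le by (subst sum.union_disjoint[symmetric]) (auto intro!: sum.cong)
    have "V e - V (Suc e) = (\<Sum>j=1..n div Suc e. Om e j - Om (Suc e) j) + (\<Sum>j\<in>{n div Suc e<..n div e}. Om e j)"
      unfolding V_def split sum_subtractf by simp
    also have "\<bar>\<dots>\<bar> \<le> (\<Sum>j=1..n div Suc e. \<bar>Om e j - Om (Suc e) j\<bar>) + (\<Sum>j\<in>{n div Suc e<..n div e}. \<bar>Om e j\<bar>)"
      by (rule order.trans[OF abs_triangle_ineq add_mono]) (rule sum_abs)+
    also have "\<dots> \<le> (\<Sum>j=1..n div Suc e. real (Suc m) * u / real e * \<kappa> j) + (\<Sum>j\<in>{n div Suc e<..n div e}. \<kappa> j)"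
    proof (intro add_mono sum_mono dOm e)
      show "\<bar>Om e j\<bar> \<le> \<kappa> j" for j unfolding Om_def using w e by (intro k2) auto
    qed
    also have "(\<Sum>j\<in>{n div Suc e<..n div e}. \<kappa> j) = KK (n div e) - KK (n div Suc e)"
      unfolding KK_def split by simp
    finally show ?thesis by (simp add: KK_def sum_distrib_left)
  qed
  have sumK: "(\<Sum>e=1..n. KK (n div e)) \<le> C * (1 + 2 * W) * real n"
  proof -
    have "(\<Sum>e=1..n. KK (n div e)) \<le> (\<Sum>e=1..n. C * (1 + w * (real n / real e)))"
    proof (rule sum_mono)
      fix e
      have "KK (n div e) \<le> C * (1 + w * real (n div e))" unfolding KK_def by (rule K) simp
      also have "\<dots> \<le> C * (1 + w * (real n / real e))"
        using C w of_nat_div_le_of_nat[of n e, where ?'a = real] by (intro mult_left_mono add_left_mono) auto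
      finally show "KK (n div e) \<le> C * (1 + w * (real n / real e))" .
    qed
    also have "\<dots> = C * (real n + w * real n * (\<Sum>e=1..n. 1 / real e))"
      by (simp add: sum_distrib_left sum.distrib algebra_simps)
    also have "\<dots> \<le> C * (real n + w * real n * (1 + ln (real n)))"
      using C w n by (intro mult_left_mono add_left_mono sum_inverse_le) auto
    also have "\<dots> = C * real n * (1 + (w + w * ln (real n)))" by (simp add: algebra_simps)
    also have "\<dots> \<le> C * real n * (1 + 2 * W)"
      using C w wW by (intro mult_left_mono) auto
    finally show ?thesis by (simp add: mult_ac)
  qed
  \<comment> \<open>Partial summation against the constant sequence 1 undoes the differences of
    \<open>KK\<close>; the boundary value \<open>KK (n div Suc n)\<close> is 0.\<close>
  have "(\<Sum>e=1..n. 1 * KK (n div e)) = (\<Sum>i=1..n. 1) * KK (n div Suc n) + (\<Sum>e=1..n. (\<Sum>i=1..e. 1) * (KK (n div e) - KK (n div Suc e)))"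
    by (rule sum_by_parts_nat)
  hence parts: "(\<Sum>e=1..n. real e * (KK (n div e) - KK (n div Suc e))) = (\<Sum>e=1..n. KK (n div e))"
    by (simp add: KK_def)
  have shift: "(\<Sum>e=1..n. KK (n div Suc e)) \<le> (\<Sum>e=1..n. KK (n div e))"
    by (intro sum_mono KKmono div_le_mono2) auto
  have Veq: "(\<Sum>j=1..n div e. \<Sum>d | d dvd j. moebius d * riesz (Suc m) (u * ln (real (e * d)))) = V e" if "e > 0" for e
    unfolding V_def Om_def by (intro sum.cong refl sum_dvd_moebius_riesz) (use that in auto)
  have "ingham_sum (\<lambda>k. b k * of_real (riesz (Suc m) (u * ln (real k)))) n
      = (\<Sum>e=1..n. ingham_sum b e * of_real (V e - V (Suc e)))"
    unfolding ingham_sum_weighted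
  proof (rule sum.cong[OF refl])
    fix e assume "e \<in> {1..n}"
    hence "e > 0" by simp
    thus "ingham_sum b e * of_real ((\<Sum>j=1..n div e. \<Sum>d | d dvd j. moebius d * riesz (Suc m) (u * ln (real (e * d))))
        - (\<Sum>j=1..n div Suc e. \<Sum>d | d dvd j. moebius d * riesz (Suc m) (u * ln (real (Suc e * d)))))
      = ingham_sum b e * of_real (V e - V (Suc e))"
      by (simp only: Veq zero_less_Suc)
  qed
  also have "norm \<dots> \<le> (\<Sum>e=1..n. B * real e * \<bar>V e - V (Suc e)\<bar>)"
    by (rule sum_norm_le) (auto simp: norm_mult simp flip: of_real_diff intro!: mult_right_mono T)
  also have "\<dots> \<le> (\<Sum>e=1..n. B * real e * (real (Suc m) * u / real e * KK (n div Suc e) + (KK (n div e) - KK (n div Suc e))))"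
    using B by (intro sum_mono mult_left_mono dV) auto
  also have "\<dots> = B * (real (Suc m) * u * (\<Sum>e=1..n. KK (n div Suc e)) + (\<Sum>e=1..n. real e * (KK (n div e) - KK (n div Suc e))))"
    unfolding sum_distrib_left sum.distrib[symmetric] by (intro sum.cong refl) (simp add: field_simps)
  also have "\<dots> \<le> B * (real (Suc m) * W * (\<Sum>e=1..n. KK (n div e)) + (\<Sum>e=1..n. KK (n div e)))"
    unfolding parts using B w wW shift KK0
    by (intro mult_left_mono add_right_mono mult_mono) (auto intro!: sum_nonneg)
  also have "\<dots> = B * (real (Suc m) * W + 1) * (\<Sum>e=1..n. KK (n div e))" by (simp add: algebra_simps)
  also have "\<dots> \<le> B * (real (Suc m) * W + 1) * (C * (1 + 2 * W) * real n)"
    using B W0 by (intro mult_left_mono sumK) auto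
  finally show ?thesis by (simp add: mult_ac)
qed

section \<open>From condition (1) to slow variation of the means\<close>

text \<open>Partial summation involves all \<open>e \<le> n\<close> at once; the finitely many small
  \<open>e\<close> are paid for by \<open>M\<close>.\<close>

lemma smallo_sum_bound:
  fixes T :: "nat \<Rightarrow> complex"
  assumes "T \<in> o(\<lambda>n. of_real (real n * ln (real n)))" "\<epsilon> > 0"
  shows "\<exists>M\<ge>0. \<forall>e n. 1 \<le> e \<longrightarrow> e \<le> n \<longrightarrow> norm (T e) \<le> (\<epsilon> * ln (real n) + M) * real e"
proof -
  have "eventually (\<lambda>n. norm (T n) \<le> \<epsilon> * norm (of_real (real n * ln (real n)) :: complex)) at_top"
    by (rule landau_o.smallD[OF assms])
  then obtain N where N: "\<And>n. n \<ge> N \<Longrightarrow> norm (T n) \<le> \<epsilon> * norm (of_real (real n * ln (real n)) :: complex)"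
    by (auto simp: eventually_at_top_linorder)
  define M where "M = (\<Sum>e<N. norm (T e))"
  have M: "M \<ge> 0" by (simp add: M_def sum_nonneg)
  have "norm (T e) \<le> (\<epsilon> * ln (real n) + M) * real e" if e: "1 \<le> e" "e \<le> n" for e n
  proof (cases "e \<ge> N")
    case True
    have "norm (T e) \<le> \<epsilon> * (real e * ln (real e))" using N[OF True] e by (simp add: norm_mult)
    also have "\<dots> \<le> \<epsilon> * (real e * ln (real n))" using e assms(2) by (intro mult_left_mono) auto
    also have "\<dots> \<le> (\<epsilon> * ln (real n) + M) * real e" using M by (simp add: algebra_simps)
    finally show ?thesis .
  next
    case False
    have "norm (T e) \<le> M" unfolding M_def using False by (intro member_le_sum) auto
    also have "\<dots> \<le> M * real e" using M e by (simp add: mult_le_cancel_left1)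
    also have "\<dots> \<le> (\<epsilon> * ln (real n) + M) * real e"
      using assms(2) e by (intro mult_right_mono) auto
    finally show ?thesis .
  qed
  thus ?thesis using M by blast
qed

text \<open>The factor \<open>ln n\<close> allowed by the hypothesis is regained from
  \<open>1 / l \<le> 8 / ln n\<close>. The exponent \<open>m\<close> is fixed before
  \<open>\<delta>\<close>, and the estimate is uniform in \<open>l\<close>.\<close>

lemma ingham_sum_riesz_close:
  fixes a :: "nat \<Rightarrow> complex"
  assumes o: "ingham_sum (\<lambda>k. a k * of_real (ln (real k))) \<in> o(\<lambda>n. of_real (real n * ln (real n)))"
  shows "\<exists>m\<ge>1. \<forall>\<delta>>0. \<exists>n0. \<forall>n\<ge>n0. \<forall>l. ln (real n) / 8 \<le> l \<longrightarrow>
    norm (ingham_sum a n - ingham_sum (\<lambda>k. a k * of_real (riesz m (ln (real k) / l))) n) \<le> \<delta> * real n"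
proof -
  define b where "b = (\<lambda>k. a k * of_real (ln (real k)))"
  obtain m C where m: "m \<ge> 1" and C: "C \<ge> 0" and ker: "\<And>n w. n \<ge> 1 \<Longrightarrow> w > 0 \<Longrightarrow> w * ln (real n) \<le> 8 \<Longrightarrow>
    (\<exists>\<kappa>. (\<forall>j. \<kappa> j \<ge> 0) \<and> (\<forall>y\<le>n. (\<Sum>j=1..y. \<kappa> j) \<le> C * (1 + w * real y)) \<and>
      (\<forall>u v j. 0 \<le> u \<longrightarrow> u \<le> w \<longrightarrow> v \<ge> 0 \<longrightarrow>
        \<bar>idiff (\<lambda>p. u * ln (real p)) (prime_factors j) (riesz m) v\<bar> \<le> \<kappa> j \<and>
        \<bar>idiff (\<lambda>p. u * ln (real p)) (prime_factors j) (riesz (Suc m)) v\<bar> \<le> \<kappa> j))"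
    using riesz_kernel_bound[of 8] by auto
  define Q where "Q = C * (1 + 2 * 8) * (real (Suc m) * 8 + 1)"
  have Q: "Q \<ge> 0" using C by (simp add: Q_def)
  \<comment> \<open>Two orders above the kernel exponent: one is spent on differentiating in
    \<open>\<theta>\<close>, the other on differentiating the kernel along \<open>e\<close>.\<close>
  have main: "\<exists>n0. \<forall>n\<ge>n0. \<forall>l. ln (real n) / 8 \<le> l \<longrightarrow>
    norm (ingham_sum a n - ingham_sum (\<lambda>k. a k * of_real (riesz (m+2) (ln (real k) / l))) n) \<le> \<delta> * real n"
    if \<delta>: "\<delta> > 0" for \<delta>
  proof -
    \<comment> \<open>One half of \<open>\<delta>\<close> pays for the \<open>ln n\<close> term of
      \<open>B\<close>, the other half for \<open>M\<close>, which is small against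
      \<open>ln n\<close> once \<open>n \<ge> n1\<close>.\<close>
    define R where "R = real (m+2) * 8 * (Q + 1)"
    have R: "R > 0" using Q by (simp add: R_def)
    obtain M where M: "M \<ge> 0" "\<And>e n. 1 \<le> e \<Longrightarrow> e \<le> n \<Longrightarrow> norm (ingham_sum b e) \<le> (\<delta> / (2 * R) * ln (real n) + M) * real e"
      using smallo_sum_bound[OF o, of "\<delta> / (2 * R)"] \<delta> R b_def by auto
    have "filterlim (\<lambda>n. ln (real n)) at_top at_top" by real_asymp
    hence "eventually (\<lambda>n. ln (real n) \<ge> 2 * R * M / \<delta>) at_top" by (simp add: filterlim_at_top)
    then obtain n1 where n1: "\<And>n. n \<ge> n1 \<Longrightarrow> ln (real n) \<ge> 2 * R * M / \<delta>"
      by (auto simp: eventually_at_top_linorder)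
    have "norm (ingham_sum a n - ingham_sum (\<lambda>k. a k * of_real (riesz (m+2) (ln (real k) / l))) n) \<le> \<delta> * real n"
      if n: "n \<ge> max n1 3" and l: "ln (real n) / 8 \<le> l" for n l
    proof -
      define L where "L = ln (real n)"
      have L: "L > 0" using n by (simp add: L_def)
      have l0: "l > 0" using l L by (simp add: L_def)
      \<comment> \<open>An upper bound for all \<open>\<theta> / l\<close>, so that one majorant
        \<open>\<kappa>\<close> covers the whole interpolation.\<close>
      define w where "w = 8 / L"
      have w: "w > 0" "w * ln (real n) \<le> 8" using L by (auto simp: w_def L_def)
      have "n \<ge> 1" using n by simp
      from ker[OF this w] obtain \<kappa> where \<kappa>: "\<forall>j. \<kappa> j \<ge> 0" "\<forall>y\<le>n. (\<Sum>j=1..y. \<kappa> j) \<le> C * (1 + w * real y)"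
        "\<forall>u v j. 0 \<le> u \<longrightarrow> u \<le> w \<longrightarrow> v \<ge> 0 \<longrightarrow>
          \<bar>idiff (\<lambda>p. u * ln (real p)) (prime_factors j) (riesz m) v\<bar> \<le> \<kappa> j \<and>
          \<bar>idiff (\<lambda>p. u * ln (real p)) (prime_factors j) (riesz (Suc m)) v\<bar> \<le> \<kappa> j"
        by blast
      define B where "B = \<delta> / (2 * R) * L + M"
      have B: "B \<ge> 0" using \<delta> R L M by (simp add: B_def)
      txt \<open>\<open>E\<close> interpolates between the unweighted sum (\<open>\<theta> = 0\<close>) and the weighted one (\<open>\<theta> = 1\<close>).
        Differentiating in \<open>\<theta>\<close> produces the factor \<open>ln k\<close> that the hypothesis is about.\<close>
      define E where "E \<theta> = ingham_sum (\<lambda>k. a k * of_real (riesz (m+2) (\<theta> / l * ln (real k)))) n" for \<theta>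
      define E' where "E' \<theta> = - (real (m+2) / l) *\<^sub>R ingham_sum (\<lambda>k. b k * of_real (riesz (Suc m) (\<theta> / l * ln (real k)))) n" for \<theta>
      have der: "(E has_vector_derivative E' \<theta>) (at \<theta> within {0..1})" for \<theta>
      proof -
        have 1: "((\<lambda>\<theta>. riesz (m+2) (\<theta> / l * ln (real k))) has_real_derivative
             (- real (m+2) * riesz (Suc m) (\<theta> / l * ln (real k))) * (1 / l * ln (real k))) (at \<theta> within {0..1})" for k
        proof (rule DERIV_chain2[of "riesz (m+2)"])
          show "(riesz (m+2) has_real_derivative - real (m+2) * riesz (Suc m) (\<theta> / l * ln (real k))) (at (\<theta> / l * ln (real k)))"
            using has_real_derivative_riesz[of "Suc m"] by simp
          show "((\<lambda>\<theta>. \<theta> / l * ln (real k)) has_real_derivative 1 / l * ln (real k)) (at \<theta> within {0..1})"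
            using l0 by (auto intro!: derivative_eq_intros)
        qed
        have "((\<lambda>\<theta>. \<Sum>k=1..n. riesz (m+2) (\<theta> / l * ln (real k)) *\<^sub>R (a k * of_nat (n div k))) has_vector_derivative
             (\<Sum>k=1..n. ((- real (m+2) * riesz (Suc m) (\<theta> / l * ln (real k))) * (1 / l * ln (real k))) *\<^sub>R (a k * of_nat (n div k)))) (at \<theta> within {0..1})"
          using has_vector_derivative_scaleR[OF 1 has_vector_derivative_const]
          by (intro has_vector_derivative_sum) simp
        moreover have "(\<lambda>\<theta>. \<Sum>k=1..n. riesz (m+2) (\<theta> / l * ln (real k)) *\<^sub>R (a k * of_nat (n div k))) = E"
          by (auto simp: E_def ingham_sum_def scaleR_conv_of_real mult_ac)
        moreover have "(\<Sum>k=1..n. ((- real (m+2) * riesz (Suc m) (\<theta> / l * ln (real k))) * (1 / l * ln (real k))) *\<^sub>R (a k * of_nat (n div k))) = E' \<theta>"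
          unfolding E'_def ingham_sum_def scaleR_sum_right
        proof (rule sum.cong[OF refl])
          fix k
          have "((- M * \<rho>) * (1 / l * x)) *\<^sub>R (c * d) = - (M / l) *\<^sub>R (c * of_real x * of_real \<rho> * d)"
            for M \<rho> x :: real and c d :: complex
            by (simp add: scaleR_conv_of_real mult_ac)
          thus "((- real (m+2) * riesz (Suc m) (\<theta> / l * ln (real k))) * (1 / l * ln (real k))) *\<^sub>R (a k * of_nat (n div k))
             = - (real (m+2) / l) *\<^sub>R (b k * of_real (riesz (Suc m) (\<theta> / l * ln (real k))) * of_nat (n div k))"
            unfolding b_def by blast
        qed
        ultimately show ?thesis by simp
      qed
      have bound: "norm (E' \<theta>) \<le> \<delta> * real n" if \<theta>: "\<theta> \<in> {0..1}" for \<theta>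
      proof -
        have "\<theta> / l \<le> 1 / l" using \<theta> l0 by (simp add: divide_right_mono)
        also have "1 / l \<le> w" using l L l0 by (simp add: w_def L_def field_simps)
        finally have u: "0 \<le> \<theta> / l" "\<theta> / l \<le> w" using \<theta> l0 by auto
        have "norm (ingham_sum (\<lambda>k. b k * of_real (riesz (Suc m) (\<theta> / l * ln (real k)))) n) \<le> B * Q * real n"
          unfolding Q_def
          by (rule norm_ingham_sum_riesz_le[where \<kappa> = \<kappa> and w = w])
             (use n w u C m \<kappa> M(2) B in \<open>auto simp: B_def L_def\<close>)
        moreover have "real (m+2) / l \<le> real (m+2) * w" using \<open>1 / l \<le> w\<close> mult_left_mono[of "1 / l" w "real (m+2)"] by simp
        ultimately have "norm (E' \<theta>) \<le> real (m+2) * w * (B * Q * real n)"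
          unfolding E'_def using l0 w by (simp only: norm_scaleR) (intro mult_mono, auto)
        also have "\<dots> = real (m+2) * 8 * Q * real n * (B / L)" by (simp add: w_def)
        also have "\<dots> \<le> R * real n * (\<delta> / R)"
        proof (intro mult_mono)
          show "real (m + 2) * 8 * Q \<le> R" unfolding R_def by (intro mult_left_mono) auto
          have "M \<le> \<delta> / (2 * R) * L" using n1[of n] n \<delta> R by (simp add: L_def field_simps)
          hence "B \<le> \<delta> / (2 * R) * L + \<delta> / (2 * R) * L" unfolding B_def by (rule add_left_mono)
          also have "\<dots> = \<delta> / R * L" by simp
          finally have "B \<le> \<delta> / R * L" .
          thus "B / L \<le> \<delta> / R" using L by (simp add: field_simps)
        qed (use Q R B L \<delta> in auto)
        also have "\<dots> = \<delta> * real n" using R by simp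
        finally show ?thesis .
      qed
      have "norm (E 0 - E 1) \<le> \<delta> * real n * norm (0 - 1 :: real)"
      proof (rule differentiable_bound[of "{0..1}" E "\<lambda>\<theta> h. h *\<^sub>R E' \<theta>"])
        show "(E has_derivative (\<lambda>h. h *\<^sub>R E' \<theta>)) (at \<theta> within {0..1})" for \<theta>
          using der by (simp add: has_vector_derivative_def)
        show "onorm (\<lambda>h. h *\<^sub>R E' \<theta>) \<le> \<delta> * real n" if "\<theta> \<in> {0..1}" for \<theta>
          using bound[OF that] by (intro onorm_le) (simp add: mult.commute mult_left_mono)
      qed auto
      thus ?thesis by (simp add: E_def ingham_sum_def)
    qed
    thus ?thesis by blast
  qed
  show ?thesis using main by (intro exI[of _ "m+2"]) auto
qed

text \<open>Both means are compared with the same \<open>P l\<close>. The fourth root is dictated by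
  the bound on \<open>a\<close>: with \<open>y\<close> the end of the truncated sum,
  \<open>y\<close> coefficients of size at most \<open>A * y ^ 2\<close>, each with a rounding error
  of at most 1, give \<open>A * y ^ 3\<close>, and \<open>y ^ 4 \<le> n\<close> leaves a factor
  \<open>y\<close> to make this small.\<close>

lemma ingham_mean_slowly_varying:
  fixes a :: "nat \<Rightarrow> complex"
  assumes o: "ingham_sum (\<lambda>k. a k * of_real (ln (real k))) \<in> o(\<lambda>n. of_real (real n * ln (real n)))"
    and a: "\<And>k. k \<ge> 1 \<Longrightarrow> norm (a k) \<le> A * real k ^ 2"
    and \<epsilon>: "\<epsilon> > 0"
  shows "\<exists>n0. \<forall>n\<ge>n0. \<forall>n'. n \<le> n' \<longrightarrow> n' \<le> n ^ 2 \<longrightarrow>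
    norm (ingham_sum a n / of_nat n - ingham_sum a n' / of_nat n') \<le> \<epsilon>"
proof -
  have A: "A \<ge> 0" using order.trans[OF norm_ge_zero a[of 1]] by simp
  obtain m where m: "m \<ge> 1" and close: "\<And>\<delta>. \<delta> > 0 \<Longrightarrow> \<exists>n0. \<forall>n\<ge>n0. \<forall>l. ln (real n) / 8 \<le> l \<longrightarrow>
    norm (ingham_sum a n - ingham_sum (\<lambda>k. a k * of_real (riesz m (ln (real k) / l))) n) \<le> \<delta> * real n"
    using ingham_sum_riesz_close[OF o] by blast
  obtain n1 where n1: "\<And>n l. n \<ge> n1 \<Longrightarrow> ln (real n) / 8 \<le> l \<Longrightarrow>
    norm (ingham_sum a n - ingham_sum (\<lambda>k. a k * of_real (riesz m (ln (real k) / l))) n) \<le> \<epsilon> / 4 * real n"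
    using close[of "\<epsilon> / 4"] \<epsilon> by auto
  define y where "y l = nat \<lfloor>exp l\<rfloor>" for l :: real
  define P where "P l = (\<Sum>k=1..y l. a k * of_real (riesz m (ln (real k) / l)) / of_nat k)" for l
  \<comment> \<open>Forces \<open>y l \<ge> 4 * A / \<epsilon> + 1\<close>, hence
    \<open>A * y ^ 3 \<le> \<epsilon> / 4 * y ^ 4\<close>; the summand 1 on the right ensures
    \<open>y l \<ge> 1\<close>.\<close>
  have "filterlim (\<lambda>n. exp (ln (real n) / 8) - 1) at_top at_top" by real_asymp
  hence "eventually (\<lambda>n. exp (ln (real n) / 8) - 1 \<ge> 4 * A / \<epsilon> + 1) at_top" unfolding filterlim_at_top by blast
  then obtain n2 where n2: "\<And>n. n \<ge> n2 \<Longrightarrow> exp (ln (real n) / 8) - 1 \<ge> 4 * A / \<epsilon> + 1"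
    by (auto simp: eventually_at_top_linorder)
  have main: "norm (ingham_sum a n / of_nat n - P l) \<le> \<epsilon> / 2"
    if n: "n \<ge> max (max n1 n2) 2" and l: "ln (real n) / 8 \<le> l" "l \<le> ln (real n) / 4" for n l
  proof -
    have l0: "l > 0" using l(1) n by (smt (verit) divide_pos_pos ln_gt_zero max.bounded_iff of_nat_1 of_nat_less_iff one_less_numeral_iff order_less_le_trans semiring_norm(76))
    have yl: "real (y l) \<le> exp l" by (simp add: y_def)
    have y4: "y l ^ 4 \<le> n"
    proof -
      have "real (y l) ^ 4 \<le> exp l ^ 4" using yl by (intro power_mono) auto
      also have "\<dots> = exp (4 * l)" using exp_of_nat_mult[of 4 l] by simp
      also have "\<dots> \<le> exp (ln (real n))" using l by simp
      also have "\<dots> = real n" using n by simp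
      finally show ?thesis by (metis of_nat_le_iff of_nat_power)
    qed
    have ybig: "real (y l) \<ge> 4 * A / \<epsilon> + 1"
    proof -
      have "exp (ln (real n) / 8) \<le> exp l" using l by simp
      moreover have "exp l \<le> real (y l) + 1" unfolding y_def by linarith
      ultimately show ?thesis using n2[of n] n by linarith
    qed
    have y1: "y l \<ge> 1" using ybig A \<epsilon> by (smt (verit) divide_nonneg_pos of_nat_1 of_nat_le_iff)
    have yn: "y l \<le> n" using y4 y1 by (meson le_trans self_le_power zero_less_numeral)
    define c where "c k = a k * of_real (riesz m (ln (real k) / l))" for k
    have c: "norm (c k) \<le> A * real (y l) ^ 2" if k: "k \<in> {1..y l}" for k
    proof -
      have "norm (c k) \<le> norm (a k) * 1"
        unfolding c_def norm_mult using riesz_le_1[of "ln (real k) / l" m] riesz_nonneg[of m "ln (real k) / l"] l0 k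
        by (intro mult_left_mono) auto
      also have "\<dots> \<le> A * real k ^ 2" using a k by simp
      also have "\<dots> \<le> A * real (y l) ^ 2" using k A by (intro mult_left_mono power_mono) auto
      finally show ?thesis .
    qed
    have c0: "c k = 0" if k: "k > y l" for k
    proof -
      have "exp l \<le> real k" using k by (simp add: y_def) linarith
      hence "l \<le> ln (real k)" using y1 k by (subst ln_ge_iff) auto
      thus ?thesis using m l0 by (simp add: c_def riesz_eq_0)
    qed
    have "ingham_sum c n = (\<Sum>k=1..y l. c k * of_nat (n div k))"
      unfolding ingham_sum_def using yn c0 by (intro sum.mono_neutral_right) auto
    moreover have "of_nat n * P l = (\<Sum>k=1..y l. c k * of_real (real n / real k))"
      by (simp add: P_def c_def sum_distrib_left mult_ac)
    ultimately have "norm (ingham_sum c n - of_nat n * P l) = norm (\<Sum>k=1..y l. c k * of_real (real (n div k) - real n / real k))"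
      by (simp add: sum_subtractf algebra_simps)
    also have "\<dots> \<le> (\<Sum>k=1..y l. A * real (y l) ^ 2 * 1)"
    proof (rule sum_norm_le)
      fix k assume k: "k \<in> {1..y l}"
      have "real n / real k - 1 \<le> real (n div k)" proof -
        have "real (n mod k) / real k \<le> 1" using k by (simp add: less_imp_le)
        thus ?thesis using of_nat_of_nat_div_aux[of n k, where ?'a = real] by linarith
      qed
      moreover have "real (n div k) \<le> real n / real k" by (rule of_nat_div_le_of_nat)
      ultimately have "\<bar>real (n div k) - real n / real k\<bar> \<le> 1" by linarith
      thus "norm (c k * of_real (real (n div k) - real n / real k)) \<le> A * real (y l) ^ 2 * 1"
        unfolding norm_mult norm_of_real using c[OF k] A by (intro mult_mono) auto
    qed
    also have "\<dots> = A * real (y l) ^ 3" by (simp add: power2_eq_square power3_eq_cube)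
    also have "\<dots> \<le> \<epsilon> / 4 * real (y l) * real (y l) ^ 3"
      using ybig \<epsilon> A by (intro mult_right_mono) (auto simp: field_simps)
    also have "\<dots> = \<epsilon> / 4 * real (y l ^ 4)" by (simp add: power3_eq_cube power4_eq_xxxx)
    also have "\<dots> \<le> \<epsilon> / 4 * real n" using y4 \<epsilon> by (intro mult_left_mono of_nat_mono) auto
    finally have 1: "norm (ingham_sum c n - of_nat n * P l) \<le> \<epsilon> / 4 * real n" .
    have 2: "norm (ingham_sum a n - ingham_sum c n) \<le> \<epsilon> / 4 * real n"
      unfolding c_def by (rule n1) (use n l in auto)
    have "norm (ingham_sum a n - of_nat n * P l) \<le> \<epsilon> / 4 * real n + \<epsilon> / 4 * real n"
      by (rule norm_diff_triangle_le[OF 2 1])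
    also have "\<dots> = \<epsilon> / 2 * real n" by simp
    finally have "norm (ingham_sum a n - of_nat n * P l) / real n \<le> \<epsilon> / 2" using n by (simp add: field_simps)
    moreover have "ingham_sum a n / of_nat n - P l = (ingham_sum a n - of_nat n * P l) / of_nat n"
      using n by (simp add: field_simps)
    ultimately show ?thesis by (simp add: norm_divide)
  qed
  have "norm (ingham_sum a n / of_nat n - ingham_sum a n' / of_nat n') \<le> \<epsilon>"
    if n: "n \<ge> max (max n1 n2) 2" and n': "n \<le> n'" "n' \<le> n ^ 2" for n n'
  proof -
    \<comment> \<open>The upper end of the range admissible for \<open>n\<close>; as
      \<open>ln n \<le> ln n' \<le> 2 * ln n\<close>, it also lies in the range admissible for
      \<open>n'\<close>.\<close>
    define l where "l = ln (real n) / 4"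
    have "ln (real n') \<le> ln (real n ^ 2)" using n n' by (intro ln_mono) (auto simp flip: of_nat_power)
    hence ln': "ln (real n') \<le> 2 * ln (real n)" using n by (simp add: ln_realpow)
    have ln: "ln (real n) \<le> ln (real n')" using n n' by (intro ln_mono) auto
    have 1: "norm (ingham_sum a n / of_nat n - P l) \<le> \<epsilon> / 2"
      by (rule main) (use n in \<open>auto simp: l_def\<close>)
    have 2: "norm (P l - ingham_sum a n' / of_nat n') \<le> \<epsilon> / 2"
      by (subst norm_minus_commute, rule main) (use n n' ln ln' in \<open>auto simp: l_def\<close>)
    from norm_diff_triangle_le[OF 1 2] show ?thesis by simp
  qed
  thus ?thesis by blast
qed

section \<open>Convergence of Dirichlet series\<close>

lemma sums_Suc_iff_atLeast1:
  fixes f :: "nat \<Rightarrow> 'a::real_normed_vector"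
  shows "(\<lambda>m. f (Suc m)) sums s \<longleftrightarrow> (\<lambda>N. \<Sum>k=1..N. f k) \<longlonglongrightarrow> s"
  unfolding sums_def by (simp add: sum.atLeast1_atMost_eq)

text \<open>The analogue for Dirichlet convolution of Mertens' theorem on Cauchy products: the
  factor \<open>x\<close> may converge conditionally. The partial sum up to \<open>N\<close> is the
  sum of \<open>y d * P (N div d)\<close> with bounded \<open>P\<close>, so the Weierstrass test
  permits a termwise limit.\<close>

lemma tendsto_dirichlet_product:
  fixes x y :: "nat \<Rightarrow> complex"
  assumes x: "(\<lambda>N. \<Sum>k=1..N. x k) \<longlonglongrightarrow> X" and y: "summable (\<lambda>d. norm (y (Suc d)))"
  shows "(\<lambda>N. \<Sum>n=1..N. \<Sum>d | d dvd n. y d * x (n div d)) \<longlonglongrightarrow> (\<Sum>d. y (Suc d)) * X"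
proof -
  define P where "P N = (\<Sum>k=1..N. x k)" for N
  have "Bseq P" using x unfolding P_def by (intro convergent_imp_Bseq) (auto simp: convergent_def)
  then obtain B where B: "B > 0" "\<And>N. norm (P N) \<le> B" by (auto elim: BseqE)
  \<comment> \<open>Zero for \<open>Suc d > N\<close>, so the infinite sum over \<open>d\<close> is
    really the finite hyperbola sum.\<close>
  define f where "f d N = y (Suc d) * P (N div Suc d)" for d N
  have 1: "uniform_limit UNIV (\<lambda>M N. \<Sum>d<M. f d N) (\<lambda>N. \<Sum>d. f d N) sequentially"
  proof (rule Weierstrass_m_test)
    show "norm (f d N) \<le> norm (y (Suc d)) * B" for d N
      unfolding f_def norm_mult by (intro mult_left_mono B) auto
    show "summable (\<lambda>d. norm (y (Suc d)) * B)" by (intro summable_mult2 y)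
  qed
  have 2: "(f d \<longlongrightarrow> y (Suc d) * X) sequentially" for d
  proof -
    have "filterlim (\<lambda>N. N div Suc d) at_top sequentially"
      by (rule filterlim_at_top_div_const_nat) simp
    from filterlim_compose[OF x this] show ?thesis
      unfolding f_def P_def by (intro tendsto_mult tendsto_const)
  qed
  have 3: "(\<lambda>M. \<Sum>d<M. y (Suc d) * X) \<longlonglongrightarrow> (\<Sum>d. y (Suc d)) * X"
    using summable_LIMSEQ[OF summable_norm_cancel[OF y]]
    by (simp add: sum_distrib_right[symmetric] tendsto_mult)
  have "((\<lambda>N. \<Sum>d. f d N) \<longlongrightarrow> (\<Sum>d. y (Suc d)) * X) sequentially"
    by (rule swap_uniform_limit'[OF _ 3 1]) (auto intro!: always_eventually tendsto_sum 2)
  moreover have "(\<Sum>d. f d N) = (\<Sum>n=1..N. \<Sum>d | d dvd n. y d * x (n div d))" for N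
  proof -
    have "(\<Sum>n=1..N. \<Sum>d | d dvd n. y d * x (n div d)) = (\<Sum>d=1..N. \<Sum>i=1..N div d. y d * x i)"
      by (rule sum_dvd_hyperbola)
    also have "\<dots> = (\<Sum>d<N. f d N)"
      by (simp add: sum.atLeast1_atMost_eq f_def P_def sum_distrib_left)
    also have "\<dots> = (\<Sum>d. f d N)"
      by (rule suminf_finite[symmetric]) (auto simp: f_def P_def)
    finally show ?thesis ..
  qed
  ultimately show ?thesis by simp
qed

lemma abel_summation_tendsto:
  fixes g V :: "nat \<Rightarrow> complex"
  defines "G \<equiv> \<lambda>n. \<Sum>i=1..n. g i"
  assumes "(\<lambda>n. G n * V (Suc n)) \<longlonglongrightarrow> 0" "summable (\<lambda>e. norm (G (Suc e) * (V (Suc e) - V (Suc (Suc e)))))"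
  shows "(\<lambda>N. \<Sum>e=1..N. g e * V e) \<longlonglongrightarrow> (\<Sum>e. G (Suc e) * (V (Suc e) - V (Suc (Suc e))))"
proof -
  have "(\<lambda>N. \<Sum>e=1..N. G e * (V e - V (Suc e))) \<longlonglongrightarrow> (\<Sum>e. G (Suc e) * (V (Suc e) - V (Suc (Suc e))))"
    using summable_sums[OF summable_norm_cancel[OF assms(3)]]
      sums_Suc_iff_atLeast1[of "\<lambda>e. G e * (V e - V (Suc e))"] by simp
  from tendsto_add[OF assms(2) this] show ?thesis
    unfolding sum_by_parts_nat[of g V] by (simp add: G_def)
qed

lemma powr_minus_diff_bounds:
  assumes "e > 0" "\<sigma> > 0"
  shows "0 \<le> real e powr -\<sigma> - real (Suc e) powr -\<sigma>"
    and "real e powr -\<sigma> - real (Suc e) powr -\<sigma> \<le> \<sigma> * real e powr (-\<sigma> - 1)"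
    and "\<sigma> * real (Suc e) powr (-\<sigma> - 1) \<le> real e powr -\<sigma> - real (Suc e) powr -\<sigma>"
proof -
  show "0 \<le> real e powr -\<sigma> - real (Suc e) powr -\<sigma>"
    using powr_mono2'[of "-\<sigma>" "real e" "real (Suc e)"] assms by simp
  have "\<exists>z. real e < z \<and> z < real (Suc e) \<and> real (Suc e) powr -\<sigma> - real e powr -\<sigma> = (real (Suc e) - real e) * (-\<sigma> * z powr (-\<sigma> - 1))"
    by (rule MVT2) (use assms in \<open>auto intro!: derivative_eq_intros\<close>)
  then obtain z where z: "real e < z" "z < real (Suc e)" "real (Suc e) powr -\<sigma> - real e powr -\<sigma> = - \<sigma> * z powr (-\<sigma> - 1)"
    by auto
  have "real (Suc e) powr (-\<sigma> - 1) \<le> z powr (-\<sigma> - 1)" using z assms by (intro powr_mono2') auto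
  hence "\<sigma> * real (Suc e) powr (-\<sigma> - 1) \<le> \<sigma> * z powr (-\<sigma> - 1)" using assms by (intro mult_left_mono) auto
  thus "\<sigma> * real (Suc e) powr (-\<sigma> - 1) \<le> real e powr -\<sigma> - real (Suc e) powr -\<sigma>" using z by linarith
  have "z powr (-\<sigma> - 1) \<le> real e powr (-\<sigma> - 1)" using z assms by (intro powr_mono2') auto
  hence "\<sigma> * z powr (-\<sigma> - 1) \<le> \<sigma> * real e powr (-\<sigma> - 1)" using assms by (intro mult_left_mono) auto
  thus "real e powr -\<sigma> - real (Suc e) powr -\<sigma> \<le> \<sigma> * real e powr (-\<sigma> - 1)" using z by linarith
qed

lemma dirichlet_series_partial_sum_bound:
  fixes g :: "nat \<Rightarrow> complex"
  defines "G \<equiv> \<lambda>n. \<Sum>i=1..n. g i"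
  assumes G: "\<And>n. n \<ge> 1 \<Longrightarrow> norm (G n) \<le> K * real n powr s" and s: "s < \<sigma>" "\<sigma> > 0"
  shows "(\<lambda>N. \<Sum>k=1..N. g k * of_real (real k powr -\<sigma>)) \<longlonglongrightarrow>
    (\<Sum>e. G (Suc e) * of_real (real (Suc e) powr -\<sigma> - real (Suc (Suc e)) powr -\<sigma>))"
proof -
  have K: "K \<ge> 0" using order.trans[OF norm_ge_zero G[of 1]] by simp
  have bd: "norm (G n * of_real (real (Suc n) powr -\<sigma>)) \<le> K * real n powr (s - \<sigma>)" if n: "n \<ge> 1" for n
  proof -
    have "norm (G n * of_real (real (Suc n) powr -\<sigma>)) \<le> (K * real n powr s) * real n powr -\<sigma>"
      unfolding norm_mult using G[OF n] n s powr_mono2'[of "-\<sigma>" "real n" "real (Suc n)"]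
      by (intro mult_mono) (auto intro: order.trans[OF norm_ge_zero])
    thus ?thesis using powr_add[of "real n" s "-\<sigma>"] by (simp add: mult.assoc)
  qed
  have lim: "(\<lambda>n. K * real n powr (s - \<sigma>)) \<longlonglongrightarrow> 0"
    using s tendsto_mult_right_zero[OF tendsto_neg_powr[OF _ filterlim_real_sequentially, of "s - \<sigma>"]] by simp
  have "(\<lambda>n. G n * of_real (real (Suc n) powr -\<sigma>)) \<longlonglongrightarrow> 0"
    by (rule Lim_null_comparison[OF _ lim]) (use bd in \<open>auto intro: eventually_mono[OF eventually_ge_at_top[of 1]]\<close>)
  moreover have "summable (\<lambda>e. norm (G (Suc e) * (of_real (real (Suc e) powr -\<sigma>) - of_real (real (Suc (Suc e)) powr -\<sigma>))))"
  proof (rule summable_comparison_test)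
    have "summable (\<lambda>e. real e powr (s - \<sigma> - 1))" using s by (subst summable_real_powr_iff) auto
    thus "summable (\<lambda>e. K * \<sigma> * real (Suc e) powr (s - \<sigma> - 1))"
      by (intro summable_mult) (subst summable_Suc_iff)
    have "norm (G (Suc e) * (of_real (real (Suc e) powr -\<sigma>) - of_real (real (Suc (Suc e)) powr -\<sigma>)))
        \<le> K * \<sigma> * real (Suc e) powr (s - \<sigma> - 1)" for e
    proof -
      have "norm (G (Suc e) * (of_real (real (Suc e) powr -\<sigma>) - of_real (real (Suc (Suc e)) powr -\<sigma>)))
        \<le> (K * real (Suc e) powr s) * (\<sigma> * real (Suc e) powr (-\<sigma> - 1))"
        unfolding norm_mult of_real_diff[symmetric] norm_of_real
        using G[of "Suc e"] powr_minus_diff_bounds[of "Suc e" \<sigma>] s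
        by (intro mult_mono) (auto simp del: of_nat_Suc intro: order.trans[OF norm_ge_zero])
      also have "\<dots> = K * \<sigma> * (real (Suc e) powr s * real (Suc e) powr (-\<sigma> - 1))" by (simp add: mult_ac)
      also have "real (Suc e) powr s * real (Suc e) powr (-\<sigma> - 1) = real (Suc e) powr (s - \<sigma> - 1)"
        by (simp add: powr_add[symmetric] algebra_simps)
      finally show ?thesis .
    qed
    thus "\<exists>N. \<forall>e\<ge>N. norm (norm (G (Suc e) * (of_real (real (Suc e) powr -\<sigma>) - of_real (real (Suc (Suc e)) powr -\<sigma>))))
        \<le> K * \<sigma> * real (Suc e) powr (s - \<sigma> - 1)" by auto
  qed
  ultimately show ?thesis
    using abel_summation_tendsto[of g "\<lambda>e. of_real (real e powr -\<sigma>)"] unfolding G_def by simp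
qed

lemma dirichlet_test_tendsto:
  fixes g :: "nat \<Rightarrow> complex" and V :: "nat \<Rightarrow> real"
  assumes g: "(\<lambda>N. \<Sum>k=1..N. g k) \<longlonglongrightarrow> L" and V: "V \<longlonglongrightarrow> 0" "\<And>n. n \<ge> 1 \<Longrightarrow> V (Suc n) \<le> V n"
  shows "\<exists>L'. (\<lambda>N. \<Sum>k=1..N. g k * of_real (V k)) \<longlonglongrightarrow> L'"
proof -
  define P where "P N = (\<Sum>k=1..N. g k)" for N
  have "Bseq P" using g unfolding P_def by (intro convergent_imp_Bseq) (auto simp: convergent_def)
  then obtain B where B: "B > 0" "\<And>N. norm (P N) \<le> B" by (auto elim: BseqE)
  have "(\<lambda>n. of_real (V (Suc n)) :: complex) \<longlonglongrightarrow> of_real 0"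
    using V(1) by (intro tendsto_of_real) (rule LIMSEQ_Suc)
  hence 1: "(\<lambda>n. P n * of_real (V (Suc n))) \<longlonglongrightarrow> 0"
    using \<open>Bseq P\<close> tendsto_mult[OF g[folded P_def]] by fastforce
  have "(\<lambda>n. V (Suc n) - V (Suc (Suc n))) sums (V (Suc 0) - 0)"
    using V(1) LIMSEQ_Suc by (intro telescope_sums') 
  hence "summable (\<lambda>n. B * (V (Suc n) - V (Suc (Suc n))))" by (intro summable_mult) (rule sums_summable)
  hence 2: "summable (\<lambda>e. norm (P (Suc e) * (of_real (V (Suc e)) - of_real (V (Suc (Suc e))))))"
  proof (rule summable_comparison_test[rotated])
    have "norm (P (Suc e) * (of_real (V (Suc e)) - of_real (V (Suc (Suc e))))) \<le> B * (V (Suc e) - V (Suc (Suc e)))" for e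
      unfolding norm_mult of_real_diff[symmetric] norm_of_real
      using B V(2)[of "Suc e"] by (intro mult_mono) auto
    thus "\<exists>N. \<forall>e\<ge>N. norm (norm (P (Suc e) * (of_real (V (Suc e)) - of_real (V (Suc (Suc e)))))) \<le> B * (V (Suc e) - V (Suc (Suc e)))"
      by auto
  qed
  from abel_summation_tendsto[of g "\<lambda>e. of_real (V e)", folded P_def, OF 1 2] show ?thesis by blast
qed

lemma sum_dvd_cofactor:
  fixes F :: "nat \<Rightarrow> nat \<Rightarrow> 'a::comm_monoid_add"
  assumes "N > 0"
  shows "(\<Sum>d | d dvd N. F d (N div d)) = (\<Sum>d | d dvd N. F (N div d) d)"
  by (rule sum.reindex_bij_witness[of _ "\<lambda>d. N div d" "\<lambda>d. N div d"]) (use assms in \<open>auto elim!: dvdE\<close>)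

text \<open>The weighted inversion with the indicator of \<open>N\<close> as weight.\<close>

lemma moebius_inversion:
  fixes b :: "nat \<Rightarrow> complex"
  assumes "N > 0"
  shows "b N = (\<Sum>d | d dvd N. of_real (moebius d) * (\<Sum>k | k dvd N div d. b k))"
proof -
  have fin: "finite {d. d dvd M}" if "M dvd N" for M using assms that by (intro finite_divisors_nat) auto
  have "b N = (\<Sum>k | k dvd N. b k * (if k = N then 1 else 0))"
    using fin[of N] by (simp add: if_distrib[of "\<lambda>x. _ * x"] sum.delta' cong: if_cong)
  also have "\<dots> = (\<Sum>e | e dvd N. (\<Sum>k | k dvd e. b k) * (\<Sum>d | d dvd N div e. of_real (moebius d) * (if e * d = N then 1 else 0)))"
    by (rule moebius_inversion_weighted[symmetric, OF assms])
  also have "\<dots> = (\<Sum>e | e dvd N. (\<Sum>k | k dvd e. b k) * of_real (moebius (N div e)))"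
  proof (intro sum.cong refl arg_cong2[where f = "(*)"])
    fix e assume "e \<in> {e. e dvd N}"
    hence e: "e dvd N" "e > 0" using assms by (auto intro: Nat.gr0I)
    have "(\<Sum>d | d dvd N div e. of_real (moebius d) * (if e * d = N then 1 else 0))
        = (\<Sum>d | d dvd N div e. if d = N div e then of_real (moebius d) else 0 :: complex)"
      using e by (intro sum.cong) auto
    also have "\<dots> = of_real (moebius (N div e))"
      using fin[of "N div e"] e by (simp add: sum.delta' div_dvd_iff_mult)
    finally show "(\<Sum>d | d dvd N div e. of_real (moebius d) * (if e * d = N then 1 else 0 :: complex)) = of_real (moebius (N div e))" .
  qed
  also have "\<dots> = (\<Sum>d | d dvd N. (\<Sum>k | k dvd N div d. b k) * of_real (moebius (N div (N div d))))"
    by (rule sum_dvd_cofactor[OF assms, of "\<lambda>d e. (\<Sum>k | k dvd d. b k) * of_real (moebius (N div d))"])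
  also have "\<dots> = (\<Sum>d | d dvd N. of_real (moebius d) * (\<Sum>k | k dvd N div d. b k))"
    by (intro sum.cong) (use assms in \<open>auto elim!: dvdE simp: mult.commute\<close>)
  finally show ?thesis .
qed

text \<open>Division by zeta: (1) controls the partial sums of the divisor sums \<open>g\<close> of
  \<open>b k = a k * ln k\<close>, so the Dirichlet series of \<open>g\<close> converges.
  Convolution with the absolutely convergent Moebius series gives back \<open>b\<close>, and
  Dirichlet's test removes the logarithm.\<close>

lemma dirichlet_series_converges:
  fixes a :: "nat \<Rightarrow> complex"
  assumes o: "ingham_sum (\<lambda>k. a k * of_real (ln (real k))) \<in> o(\<lambda>n. of_real (real n * ln (real n)))"
    and \<sigma>: "\<sigma> > 1"
  shows "\<exists>L. (\<lambda>N. \<Sum>k=1..N. a k * of_real (real k powr -\<sigma>)) \<longlonglongrightarrow> L"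
proof -
  define b where "b = (\<lambda>k. a k * of_real (ln (real k)))"
  define g where "g m = (\<Sum>d | d dvd m. b d)" for m
  define \<delta> where "\<delta> = (\<sigma> - 1) / 2"
  have \<delta>: "\<delta> > 0" "1 + \<delta> < \<sigma>" using \<sigma> by (auto simp: \<delta>_def field_simps)
  obtain M where M: "M \<ge> 0" "\<And>e n. 1 \<le> e \<Longrightarrow> e \<le> n \<Longrightarrow> norm (ingham_sum b e) \<le> (1 * ln (real n) + M) * real e"
    using smallo_sum_bound[OF o, of 1] by (auto simp: b_def)
  have G: "norm (\<Sum>i=1..n. g i) \<le> (1 / \<delta> + M) * real n powr (1 + \<delta>)" if n: "n \<ge> 1" for n
  proof -
    have "norm (\<Sum>i=1..n. g i) = norm (ingham_sum b n)"
      by (simp add: ingham_sum_conv_divisor_sum g_def)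
    also have "\<dots> \<le> (ln (real n) + M) * real n" using M(2)[of n n] n by simp
    also have "\<dots> \<le> (real n powr \<delta> / \<delta> + M * real n powr \<delta>) * real n"
      using ln_powr_bound[of "real n" \<delta>] n \<delta> M(1) ge_one_powr_ge_zero[of "real n" \<delta>]
      by (intro mult_right_mono add_mono) (auto simp: mult_le_cancel_left1)
    also have "\<dots> = (1 / \<delta> + M) * (real n powr \<delta> * real n powr 1)" using n by (simp add: algebra_simps)
    also have "\<dots> = (1 / \<delta> + M) * real n powr (1 + \<delta>)" by (simp only: powr_add mult.commute)
    finally show ?thesis .
  qed
  \<comment> \<open>The cutoff at 2 avoids division by \<open>ln 1 = 0\<close> and keeps
    \<open>V\<close> decreasing from 1 on. The term \<open>k = 1\<close>, which \<open>b\<close>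
    does not see, is added back at the end.\<close>
  define V where "V n = 1 / ln (real (max 2 n))" for n
  obtain X where "(\<lambda>N. \<Sum>k=1..N. g k * of_real (real k powr -\<sigma>)) \<longlonglongrightarrow> X"
    using dirichlet_series_partial_sum_bound[OF G] \<delta> \<sigma> by (meson less_trans zero_less_one)
  moreover have "summable (\<lambda>d. norm (of_real (moebius (Suc d)) * of_real (real (Suc d) powr -\<sigma>) :: complex))"
  proof (rule summable_comparison_test)
    have "summable (\<lambda>e. real e powr (-\<sigma>))" using \<sigma> by (subst summable_real_powr_iff) auto
    thus "summable (\<lambda>e. real (Suc e) powr (-\<sigma>))" by (subst summable_Suc_iff)
    show "\<exists>N. \<forall>n\<ge>N. norm (norm (of_real (moebius (Suc n)) * of_real (real (Suc n) powr -\<sigma>) :: complex)) \<le> real (Suc n) powr -\<sigma>"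
      using abs_moebius_le_1 by (intro exI[of _ 0]) (auto simp: norm_mult intro!: mult_left_le_one_le)
  qed
  ultimately have "\<exists>Y. (\<lambda>N. \<Sum>n=1..N. \<Sum>d | d dvd n. (of_real (moebius d) * of_real (real d powr -\<sigma>)) *
      (g (n div d) * of_real (real (n div d) powr -\<sigma>))) \<longlonglongrightarrow> Y"
    by (intro exI) (rule tendsto_dirichlet_product[where y = "\<lambda>d. of_real (moebius d) * of_real (real d powr -\<sigma>)"])
  moreover have eq: "(\<Sum>d | d dvd n. (of_real (moebius d) * of_real (real d powr -\<sigma>)) *
      (g (n div d) * of_real (real (n div d) powr -\<sigma>))) = b n * of_real (real n powr -\<sigma>)" if n: "n > 0" for n
  proof -
    have "(\<Sum>d | d dvd n. (of_real (moebius d) * of_real (real d powr -\<sigma>)) * (g (n div d) * of_real (real (n div d) powr -\<sigma>)))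
      = (\<Sum>d | d dvd n. of_real (moebius d) * g (n div d) * of_real (real n powr -\<sigma>))"
    proof (rule sum.cong[OF refl])
      fix d assume d: "d \<in> {d. d dvd n}"
      hence "real n powr -\<sigma> = real d powr -\<sigma> * real (n div d) powr -\<sigma>"
        by (auto simp: powr_mult[symmetric] simp flip: of_nat_mult)
      thus "(of_real (moebius d) * of_real (real d powr -\<sigma>)) * (g (n div d) * of_real (real (n div d) powr -\<sigma>))
        = of_real (moebius d) * g (n div d) * of_real (real n powr -\<sigma>)" by simp
    qed
    thus ?thesis using moebius_inversion[OF n, of b] by (simp add: g_def sum_distrib_right)
  qed
  moreover have "(\<Sum>n=1..N. \<Sum>d | d dvd n. (of_real (moebius d) * of_real (real d powr -\<sigma>)) *
      (g (n div d) * of_real (real (n div d) powr -\<sigma>))) = (\<Sum>n=1..N. b n * of_real (real n powr -\<sigma>))" for N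
    by (rule sum.cong[OF refl], rule eq) auto
  ultimately obtain Y where Y: "(\<lambda>N. \<Sum>n=1..N. b n * of_real (real n powr -\<sigma>)) \<longlonglongrightarrow> Y"
    by auto
  have "V \<longlonglongrightarrow> 0"
  proof -
    have "(\<lambda>n. 1 / ln (real n)) \<longlonglongrightarrow> 0" by real_asymp
    moreover have "eventually (\<lambda>n. 1 / ln (real n) = V n) sequentially"
      using eventually_ge_at_top[of 2] by eventually_elim (auto simp: V_def max_def)
    ultimately show ?thesis using tendsto_cong by fastforce
  qed
  moreover have "V (Suc n) \<le> V n" if "n \<ge> 1" for n
    unfolding V_def by (intro divide_left_mono ln_mono) auto
  ultimately obtain Z where Z: "(\<lambda>N. \<Sum>k=1..N. b k * of_real (real k powr -\<sigma>) * of_real (V k)) \<longlonglongrightarrow> Z"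
    using dirichlet_test_tendsto[OF Y] by blast
  have "(\<Sum>k=1..N. a k * of_real (real k powr -\<sigma>)) = a 1 + (\<Sum>k=1..N. b k * of_real (real k powr -\<sigma>) * of_real (V k))" if N: "N \<ge> 1" for N
  proof -
    have "a k * of_real (real k powr -\<sigma>) = (if k = 1 then a 1 else 0) + b k * of_real (real k powr -\<sigma>) * of_real (V k)" if "k \<in> {1..N}" for k
    proof (cases "k = 1")
      case False
      hence "ln (real k) \<noteq> 0" "max 2 k = k" using that by auto
      hence "of_real (ln (real k)) * of_real (V k) = (1::complex)" by (simp add: V_def flip: of_real_mult)
      thus ?thesis using False by (simp add: b_def mult_ac)
    qed (simp add: b_def)
    hence "(\<Sum>k=1..N. a k * of_real (real k powr -\<sigma>)) = (\<Sum>k=1..N. (if k = 1 then a 1 else 0) + b k * of_real (real k powr -\<sigma>) * of_real (V k))"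
      by (intro sum.cong) auto
    thus ?thesis using N by (simp add: sum.distrib)
  qed
  hence "eventually (\<lambda>N. a 1 + (\<Sum>k=1..N. b k * of_real (real k powr -\<sigma>) * of_real (V k)) = (\<Sum>k=1..N. a k * of_real (real k powr -\<sigma>))) sequentially"
    by (intro eventually_mono[OF eventually_ge_at_top[of 1]]) auto
  from Lim_transform_eventually[OF tendsto_add[OF tendsto_const Z] this] show ?thesis by blast
qed

text \<open>Convolution with the constant 1 multiplies the series by zeta, and partial summation
  expresses the result through \<open>ingham_sum\<close>; \<open>s < \<sigma>\<close> makes the
  boundary term vanish in the limit.\<close>

lemma dirichlet_series_eq_zeta_mult:
  fixes a :: "nat \<Rightarrow> complex"
  assumes S: "\<And>n. n \<ge> 1 \<Longrightarrow> norm (ingham_sum a n) \<le> K * real n powr s" and s: "s < \<sigma>" "\<sigma> > 1"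
    and L: "(\<lambda>N. \<Sum>k=1..N. a k * of_real (real k powr -\<sigma>)) \<longlonglongrightarrow> L"
  shows "(\<lambda>N. \<Sum>e=1..N. ingham_sum a e * of_real (real e powr -\<sigma> - real (Suc e) powr -\<sigma>))
    \<longlonglongrightarrow> of_real (\<Sum>d. real (Suc d) powr -\<sigma>) * L"
proof -
  define f where "f m = (\<Sum>d | d dvd m. a d)" for m
  have Sf: "(\<Sum>i=1..n. f i) = ingham_sum a n" for n by (simp add: ingham_sum_conv_divisor_sum f_def)
  have sz: "summable (\<lambda>d. real (Suc d) powr -\<sigma>)"
    using summable_Suc_iff[of "\<lambda>d. real d powr -\<sigma>"] s by (simp add: summable_real_powr_iff)
  have 0: "(\<lambda>N. \<Sum>n=1..N. \<Sum>d | d dvd n. of_real (real d powr -\<sigma>) * (a (n div d) * of_real (real (n div d) powr -\<sigma>)))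
      \<longlonglongrightarrow> (\<Sum>d. of_real (real (Suc d) powr -\<sigma>)) * L"
    by (rule tendsto_dirichlet_product[OF L, where y = "\<lambda>d. of_real (real d powr -\<sigma>)"]) (use sz in simp)
  have "(\<Sum>d | d dvd n. of_real (real d powr -\<sigma>) * (a (n div d) * of_real (real (n div d) powr -\<sigma>)))
      = f n * of_real (real n powr -\<sigma>)" if n: "n > 0" for n
  proof -
    have "(\<Sum>d | d dvd n. of_real (real d powr -\<sigma>) * (a (n div d) * of_real (real (n div d) powr -\<sigma>)))
      = (\<Sum>d | d dvd n. a (n div d) * of_real (real n powr -\<sigma>))"
    proof (rule sum.cong[OF refl])
      fix d assume d: "d \<in> {d. d dvd n}"
      hence "real n powr -\<sigma> = real d powr -\<sigma> * real (n div d) powr -\<sigma>"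
        by (auto simp: powr_mult[symmetric] simp flip: of_nat_mult)
      thus "of_real (real d powr -\<sigma>) * (a (n div d) * of_real (real (n div d) powr -\<sigma>)) = a (n div d) * of_real (real n powr -\<sigma>)"
        by simp
    qed
    also have "\<dots> = (\<Sum>d | d dvd n. a d * of_real (real n powr -\<sigma>))"
      by (rule sum_dvd_cofactor[OF n, of "\<lambda>d e. a e * of_real (real n powr -\<sigma>)"])
    finally show ?thesis by (simp add: f_def sum_distrib_right)
  qed
  hence "(\<Sum>n=1..N. \<Sum>d | d dvd n. of_real (real d powr -\<sigma>) * (a (n div d) * of_real (real (n div d) powr -\<sigma>)))
      = (\<Sum>n=1..N. f n * of_real (real n powr -\<sigma>))" for N
    by (intro sum.cong refl) auto
  hence 1: "(\<lambda>N. \<Sum>n=1..N. f n * of_real (real n powr -\<sigma>)) \<longlonglongrightarrow> (\<Sum>d. of_real (real (Suc d) powr -\<sigma>)) * L"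
    using 0 by simp
  have S': "norm (\<Sum>i=1..n. f i) \<le> K * real n powr s" if "n \<ge> 1" for n
    using S[OF that] by (simp only: Sf)
  have "(\<lambda>N. \<Sum>k=1..N. f k * of_real (real k powr -\<sigma>)) \<longlonglongrightarrow>
    (\<Sum>e. ingham_sum a (Suc e) * of_real (real (Suc e) powr -\<sigma> - real (Suc (Suc e)) powr -\<sigma>))"
    by (rule dirichlet_series_partial_sum_bound[OF S' s(1), unfolded Sf]) (use s in auto)
  hence eq: "(\<Sum>e. ingham_sum a (Suc e) * of_real (real (Suc e) powr -\<sigma> - real (Suc (Suc e)) powr -\<sigma>)) = (\<Sum>d. of_real (real (Suc d) powr -\<sigma>)) * L"
    using 1 LIMSEQ_unique by blast
  have 2: "(\<lambda>n. ingham_sum a n * of_real (real (Suc n) powr -\<sigma>)) \<longlonglongrightarrow> 0"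
  proof (rule Lim_null_comparison)
    show "(\<lambda>n. K * real n powr (s - \<sigma>)) \<longlonglongrightarrow> 0"
      using s tendsto_mult_right_zero[OF tendsto_neg_powr[OF _ filterlim_real_sequentially, of "s - \<sigma>"]] by simp
    have "norm (ingham_sum a n * of_real (real (Suc n) powr -\<sigma>)) \<le> K * real n powr (s - \<sigma>)" if n: "n \<ge> 1" for n
    proof -
      have "norm (ingham_sum a n * of_real (real (Suc n) powr -\<sigma>)) \<le> (K * real n powr s) * real n powr -\<sigma>"
        unfolding norm_mult using S[OF n] n s powr_mono2'[of "-\<sigma>" "real n" "real (Suc n)"]
        by (intro mult_mono) (auto intro: order.trans[OF norm_ge_zero])
      thus ?thesis using powr_add[of "real n" s "-\<sigma>"] by (simp add: mult.assoc)
    qed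
    thus "\<forall>\<^sub>F n in sequentially. norm (ingham_sum a n * of_real (real (Suc n) powr -\<sigma>)) \<le> K * real n powr (s - \<sigma>)"
      by (auto intro: eventually_mono[OF eventually_ge_at_top[of 1]])
  qed
  have "(\<lambda>N. (\<Sum>e=1..N. f e * of_real (real e powr -\<sigma>)) - ingham_sum a N * of_real (real (Suc N) powr -\<sigma>))
     \<longlonglongrightarrow> (\<Sum>d. of_real (real (Suc d) powr -\<sigma>)) * L - 0"
    by (intro tendsto_diff 1 2)
  moreover have "(\<Sum>e=1..N. f e * of_real (real e powr -\<sigma>)) - ingham_sum a N * of_real (real (Suc N) powr -\<sigma>)
     = (\<Sum>e=1..N. ingham_sum a e * of_real (real e powr -\<sigma> - real (Suc e) powr -\<sigma>))" for N
    by (subst sum_by_parts_nat, simp only: Sf) simp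
  moreover have "(\<Sum>d. of_real (real (Suc d) powr -\<sigma>)) = (of_real (\<Sum>d. real (Suc d) powr -\<sigma>) :: complex)"
    by (rule suminf_of_real[OF sz, symmetric])
  ultimately show ?thesis by simp
qed

section \<open>Abel means and slow variation\<close>

text \<open>The integral test in telescoping form, from \<open>powr_minus_diff_bounds\<close> at
  exponent \<open>\<sigma> - 1\<close>.\<close>

lemma sum_powr_minus_le:
  assumes "\<sigma> > 1"
  shows "(\<Sum>e=1..M. real e powr -\<sigma>) \<le> 1 + 1 / (\<sigma> - 1)"
proof (cases "M = 0")
  case False
  hence "M \<ge> 1" by simp
  hence "(\<Sum>e=1..M. real e powr -\<sigma>) \<le> 1 + (1 - real M powr -(\<sigma> - 1)) / (\<sigma> - 1)"
  proof (induction M rule: nat_induct_at_least)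
    case (Suc M)
    have "(\<sigma> - 1) * real (Suc M) powr -\<sigma> \<le> real M powr -(\<sigma> - 1) - real (Suc M) powr -(\<sigma> - 1)"
      using powr_minus_diff_bounds(3)[of M "\<sigma> - 1"] Suc.hyps assms by simp
    hence "real (Suc M) powr -\<sigma> \<le> (real M powr -(\<sigma> - 1) - real (Suc M) powr -(\<sigma> - 1)) / (\<sigma> - 1)"
      using assms by (simp add: field_simps)
    hence "(\<Sum>e=1..Suc M. real e powr -\<sigma>)
        \<le> 1 + (1 - real M powr -(\<sigma> - 1)) / (\<sigma> - 1) + (real M powr -(\<sigma> - 1) - real (Suc M) powr -(\<sigma> - 1)) / (\<sigma> - 1)"
      using Suc.IH by (simp del: of_nat_Suc)
    also have "\<dots> = 1 + (1 - real (Suc M) powr -(\<sigma> - 1)) / (\<sigma> - 1)"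
      by (simp add: diff_divide_distrib)
    finally show ?case .
  qed simp
  also have "\<dots> \<le> 1 + 1 / (\<sigma> - 1)" using assms by (intro add_left_mono divide_right_mono) auto
  finally show ?thesis .
qed (use assms in auto)

lemma zeta_ge:
  assumes "\<sigma> > 1"
  shows "1 / (\<sigma> - 1) \<le> (\<Sum>d. real (Suc d) powr -\<sigma>)"
proof -
  have sz: "summable (\<lambda>d. real (Suc d) powr -\<sigma>)"
    using summable_Suc_iff[of "\<lambda>d. real d powr -\<sigma>"] assms by (simp add: summable_real_powr_iff)
  have "(1 - real (Suc N) powr -(\<sigma> - 1)) / (\<sigma> - 1) \<le> (\<Sum>d<N. real (Suc d) powr -\<sigma>)" for N
  proof (induction N)
    case (Suc N)
    have "real (Suc N) powr -(\<sigma> - 1) - real (Suc (Suc N)) powr -(\<sigma> - 1) \<le> (\<sigma> - 1) * real (Suc N) powr -\<sigma>"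
      using powr_minus_diff_bounds(2)[of "Suc N" "\<sigma> - 1"] assms by simp
    hence "(real (Suc N) powr -(\<sigma> - 1) - real (Suc (Suc N)) powr -(\<sigma> - 1)) / (\<sigma> - 1) \<le> real (Suc N) powr -\<sigma>"
      using assms by (simp add: field_simps)
    hence "(1 - real (Suc N) powr -(\<sigma> - 1)) / (\<sigma> - 1) + (real (Suc N) powr -(\<sigma> - 1) - real (Suc (Suc N)) powr -(\<sigma> - 1)) / (\<sigma> - 1)
      \<le> (\<Sum>d<Suc N. real (Suc d) powr -\<sigma>)"
      using Suc.IH by (simp del: of_nat_Suc)
    thus ?case by (simp add: diff_divide_distrib)
  qed simp
  hence le: "(1 - real (Suc N) powr -(\<sigma> - 1)) / (\<sigma> - 1) \<le> (\<Sum>d. real (Suc d) powr -\<sigma>)" for N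
    using sum_le_suminf[OF sz, of "{..<N}"] by (meson finite_lessThan order_trans powr_ge_zero)
  have "(\<lambda>N. real (Suc N) powr -(\<sigma> - 1)) \<longlonglongrightarrow> 0"
    using assms by (intro tendsto_neg_powr filterlim_compose[OF filterlim_real_sequentially filterlim_Suc]) auto
  hence "(\<lambda>N. (1 - real (Suc N) powr -(\<sigma> - 1)) / (\<sigma> - 1)) \<longlonglongrightarrow> (1 - 0) / (\<sigma> - 1)"
    using assms by (intro tendsto_intros) auto
  from LIMSEQ_le_const2[OF this, of "\<Sum>d. real (Suc d) powr -\<sigma>"] show ?thesis
    using le by auto
qed

text \<open>The Dirichlet series at \<open>\<sigma>\<close> is the mean of \<open>ingham_sum a e / e\<close> with respect to these weights,
  whose total mass is \<open>\<zeta>(\<sigma>)\<close>.\<close>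

definition abel_weight :: "real \<Rightarrow> nat \<Rightarrow> real" where
  "abel_weight \<sigma> e = real e * (real e powr -\<sigma> - real (Suc e) powr -\<sigma>)"

lemma abel_weight_nonneg: "\<sigma> > 0 \<Longrightarrow> abel_weight \<sigma> e \<ge> 0"
  using powr_minus_diff_bounds(1)[of e \<sigma>] by (cases "e = 0") (auto simp: abel_weight_def)

lemma abel_weight_le: "\<sigma> > 0 \<Longrightarrow> abel_weight \<sigma> e \<le> \<sigma> * real e powr -\<sigma>"
proof (cases "e = 0")
  case False
  assume "\<sigma> > 0"
  hence "abel_weight \<sigma> e \<le> real e * (\<sigma> * real e powr (-\<sigma> - 1))"
    unfolding abel_weight_def using powr_minus_diff_bounds(2)[of e \<sigma>] False by (intro mult_left_mono) auto
  also have "\<dots> = \<sigma> * (real e powr 1 * real e powr (-\<sigma> - 1))" using False by simp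
  also have "real e powr 1 * real e powr (-\<sigma> - 1) = real e powr -\<sigma>"
    using powr_add[of "real e" 1 "-\<sigma> - 1"] by simp
  finally show ?thesis .
qed (auto simp: abel_weight_def)

text \<open>The sequence \<open>a1\<close> concentrated at 1 has \<open>ingham_sum a1 n = n\<close>
  and Dirichlet series 1, so subtracting \<open>c\<close> times its identity centres the mean at
  \<open>c\<close>. Division by zeta, which is at least \<open>1 / (\<sigma> - 1)\<close>, produces
  the factor \<open>\<sigma> - 1\<close>.\<close>

lemma norm_dirichlet_limit_diff_le:
  fixes a :: "nat \<Rightarrow> complex"
  assumes S: "\<And>n. n \<ge> 1 \<Longrightarrow> norm (ingham_sum a n) \<le> K * real n powr s" and s: "s < \<sigma>" "\<sigma> > 1"
    and L: "(\<lambda>N. \<Sum>k=1..N. a k * of_real (real k powr -\<sigma>)) \<longlonglongrightarrow> L"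
    and B: "\<And>N. (\<Sum>e=1..N. norm (ingham_sum a e / of_nat e - c) * abel_weight \<sigma> e) \<le> B"
  shows "norm (L - c) \<le> B * (\<sigma> - 1)"
proof -
  define z where "z = (\<Sum>d. real (Suc d) powr -\<sigma>)"
  have z: "1 / (\<sigma> - 1) \<le> z" unfolding z_def by (rule zeta_ge[OF s(2)])
  hence z0: "z > 0" using s by (meson less_le_trans zero_less_divide_1_iff diff_gt_0_iff_gt)
  define a1 :: "nat \<Rightarrow> complex" where "a1 k = (if k = 1 then 1 else 0)" for k
  have a1: "ingham_sum a1 n = of_nat n" for n
  proof (cases "n = 0")
    case False
    have "ingham_sum a1 n = (\<Sum>k=1..n. if k = 1 then of_nat (n div k) else 0)"
      unfolding ingham_sum_def a1_def by (intro sum.cong) auto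
    thus ?thesis using False by simp
  qed (simp add: ingham_sum_def)
  have L1: "(\<lambda>N. \<Sum>k=1..N. a1 k * of_real (real k powr -\<sigma>)) \<longlonglongrightarrow> 1"
  proof (rule tendsto_eventually, rule eventually_mono[OF eventually_ge_at_top[of 1]])
    fix N :: nat assume "1 \<le> N"
    have "(\<Sum>k=1..N. a1 k * of_real (real k powr -\<sigma>)) = (\<Sum>k=1..N. if k = 1 then 1 else 0 :: complex)"
      by (intro sum.cong) (auto simp: a1_def)
    thus "(\<Sum>k=1..N. a1 k * of_real (real k powr -\<sigma>)) = 1" using \<open>1 \<le> N\<close> by simp
  qed
  have 1: "(\<lambda>N. \<Sum>e=1..N. ingham_sum a e * of_real (real e powr -\<sigma> - real (Suc e) powr -\<sigma>)) \<longlonglongrightarrow> of_real z * L"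
    unfolding z_def by (rule dirichlet_series_eq_zeta_mult[OF S s L])
  have 2: "(\<lambda>N. \<Sum>e=1..N. ingham_sum a1 e * of_real (real e powr -\<sigma> - real (Suc e) powr -\<sigma>)) \<longlonglongrightarrow> of_real z * 1"
    unfolding z_def by (rule dirichlet_series_eq_zeta_mult[OF _ s(2) s(2) L1, of 1]) (auto simp: a1)
  have "(\<lambda>N. (\<Sum>e=1..N. ingham_sum a e * of_real (real e powr -\<sigma> - real (Suc e) powr -\<sigma>))
     - c * (\<Sum>e=1..N. ingham_sum a1 e * of_real (real e powr -\<sigma> - real (Suc e) powr -\<sigma>)))
     \<longlonglongrightarrow> of_real z * L - c * (of_real z * 1)"
    by (intro tendsto_diff 1 tendsto_mult tendsto_const 2)
  moreover have "(\<Sum>e=1..N. ingham_sum a e * of_real (real e powr -\<sigma> - real (Suc e) powr -\<sigma>))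
     - c * (\<Sum>e=1..N. ingham_sum a1 e * of_real (real e powr -\<sigma> - real (Suc e) powr -\<sigma>))
     = (\<Sum>e=1..N. (ingham_sum a e / of_nat e - c) * of_real (abel_weight \<sigma> e))" for N
    unfolding sum_distrib_left sum_subtractf[symmetric]
  proof (rule sum.cong[OF refl])
    fix e assume "e \<in> {1..N}"
    hence e: "(of_nat e :: complex) \<noteq> 0" by simp
    have "S * D - c * (E * D) = (S / E - c) * (E * D)" if "E \<noteq> 0" for S D E :: complex
      using that by (simp add: field_simps)
    from this[OF e] show "ingham_sum a e * of_real (real e powr -\<sigma> - real (Suc e) powr -\<sigma>) -
         c * (ingham_sum a1 e * of_real (real e powr -\<sigma> - real (Suc e) powr -\<sigma>)) =
         (ingham_sum a e / of_nat e - c) * of_real (abel_weight \<sigma> e)"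
      unfolding a1 abel_weight_def of_real_mult of_real_of_nat_eq by blast
  qed
  ultimately have lim: "(\<lambda>N. \<Sum>e=1..N. (ingham_sum a e / of_nat e - c) * of_real (abel_weight \<sigma> e)) \<longlonglongrightarrow> of_real z * (L - c)"
    by (simp add: algebra_simps)
  have "norm (of_real z * (L - c)) \<le> B"
  proof (rule LIMSEQ_le_const2[OF tendsto_norm[OF lim]], intro exI allI impI)
    fix N
    have "norm (\<Sum>e=1..N. (ingham_sum a e / of_nat e - c) * of_real (abel_weight \<sigma> e))
       \<le> (\<Sum>e=1..N. norm (ingham_sum a e / of_nat e - c) * abel_weight \<sigma> e)"
      using s abel_weight_nonneg by (intro sum_norm_le) (simp add: norm_mult)
    also note B[of N]
    finally show "norm (\<Sum>e=1..N. (ingham_sum a e / of_nat e - c) * of_real (abel_weight \<sigma> e)) \<le> B" .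
  qed
  hence "z * norm (L - c) \<le> B" using z0 by (simp add: norm_mult)
  moreover have "1 / (\<sigma> - 1) * norm (L - c) \<le> z * norm (L - c)" using z by (intro mult_right_mono) auto
  ultimately have "1 / (\<sigma> - 1) * norm (L - c) \<le> B" by linarith
  thus ?thesis using s by (simp add: field_simps)
qed

section \<open>Slow variation across long ranges and the sums that it requires\<close>

text \<open>Each squaring of \<open>m\<close> costs \<open>\<epsilon>\<close> and doubles the
  exponent that can be reached.\<close>

lemma slow_variation_chain:
  fixes R :: "nat \<Rightarrow> complex"
  assumes slow: "\<And>n n'. n \<ge> n0 \<Longrightarrow> n \<le> n' \<Longrightarrow> n' \<le> n ^ 2 \<Longrightarrow> norm (R n - R n') \<le> \<epsilon>" and \<epsilon>: "\<epsilon> \<ge> 0"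
  shows "n0 \<le> m \<Longrightarrow> m \<le> N \<Longrightarrow> N \<le> m ^ (2 ^ q) \<Longrightarrow> norm (R m - R N) \<le> \<epsilon> * real q"
proof (induction q arbitrary: m)
  case (Suc q)
  show ?case
  proof (cases "N \<le> m ^ 2")
    case True
    have "norm (R m - R N) \<le> \<epsilon>" using slow Suc.prems True by simp
    also have "\<dots> \<le> \<epsilon> * real (Suc q)" using \<epsilon> by (simp add: algebra_simps)
    finally show ?thesis .
  next
    case False
    have mm: "m \<le> m ^ 2" by (simp add: power2_eq_square)
    have "norm (R (m ^ 2) - R N) \<le> \<epsilon> * real q"
      using Suc.prems False mm by (intro Suc.IH) (auto simp: power_mult[symmetric])
    moreover have "norm (R m - R (m ^ 2)) \<le> \<epsilon>" using slow Suc.prems mm by simp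
    ultimately have "norm (R m - R N) \<le> \<epsilon> + \<epsilon> * real q" by (rule norm_diff_triangle_le[rotated])
    thus ?thesis by (simp add: algebra_simps)
  qed
qed simp

lemma le_sqrt_two_power: "real q \<le> 2 * sqrt (2 ^ q)"
proof -
  have "real q ^ 2 \<le> 4 * 2 ^ q"
  proof (induction q)
    case (Suc q)
    consider "q = 0" | "q = 1" | "q = 2" | "q \<ge> 3" by linarith
    thus ?case
    proof cases
      case 4
      hence "real q * 3 \<le> real q * real q" by (intro mult_left_mono) auto
      moreover have "3 \<le> real q" using 4 by simp
      ultimately have "2 * real q + 1 \<le> real q ^ 2" unfolding power2_eq_square by linarith
      thus ?thesis using Suc.IH by (simp add: power2_eq_square algebra_simps)
    qed auto
  qed auto
  hence "sqrt (real q ^ 2) \<le> sqrt (4 * 2 ^ q)" by (rule real_sqrt_le_mono)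
  thus ?thesis by (simp add: real_sqrt_mult)
qed

text \<open>About \<open>log 2 (ln N / ln m)\<close> squarings lead from \<open>m\<close> to
  \<open>N\<close>. The logarithm is weakened to a square root because the resulting weights
  \<open>1 / (e * sqrt (ln e))\<close> are easy to sum, while \<open>sqrt (ln N)\<close> still
  disappears after division by \<open>ln N\<close>.\<close>

lemma slow_variation_sqrt:
  fixes R :: "nat \<Rightarrow> complex"
  assumes slow: "\<And>n n'. n \<ge> n0 \<Longrightarrow> n \<le> n' \<Longrightarrow> n' \<le> n ^ 2 \<Longrightarrow> norm (R n - R n') \<le> \<epsilon>" and \<epsilon>: "\<epsilon> \<ge> 0"
    and m: "n0 \<le> m" "m \<le> N" "m \<ge> 2"
  shows "norm (R m - R N) \<le> 3 * \<epsilon> * sqrt (ln (real N) / ln (real m))"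
proof -
  define r where "r = ln (real N) / ln (real m)"
  have lm: "ln (real m) > 0" using m by simp
  have "ln (real m) \<le> ln (real N)" using m by (intro ln_mono) auto
  hence r: "r \<ge> 1" using lm by (simp add: r_def)
  \<comment> \<open>Rounding up costs at most a factor 2 in \<open>2 ^ q\<close>, which leads to the
    constant \<open>2 * sqrt 2 \<le> 3\<close>.\<close>
  define q where "q = nat \<lceil>log 2 r\<rceil>"
  have lr: "log 2 r \<ge> 0" using r by simp
  have q1: "log 2 r \<le> real q" and q2: "real q \<le> log 2 r + 1" using lr by (auto simp: q_def)
  have rq: "r \<le> 2 ^ q" using q1 r by (simp add: log_le_iff powr_realpow)
  have "2 ^ q = 2 powr real q" by (simp add: powr_realpow)
  also have "\<dots> \<le> 2 powr (log 2 r + 1)" using q2 by (intro powr_mono) auto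
  also have "\<dots> = 2 * r" using r by (simp add: powr_add)
  finally have qr: "2 ^ q \<le> 2 * r" .
  have "ln (real N) \<le> 2 ^ q * ln (real m)" using rq lm by (simp add: r_def field_simps)
  also have "\<dots> = ln (real m ^ (2 ^ q))" using m by (simp add: ln_realpow)
  finally have "real N \<le> real m ^ (2 ^ q)" using m by (subst (asm) ln_le_cancel_iff) auto
  hence "N \<le> m ^ (2 ^ q)" by (metis of_nat_le_iff of_nat_power)
  hence "norm (R m - R N) \<le> \<epsilon> * real q" using m by (intro slow_variation_chain[OF slow \<epsilon>]) auto
  also have "\<dots> \<le> \<epsilon> * (3 * sqrt r)"
  proof (intro mult_left_mono \<epsilon>)
    have "real q \<le> 2 * sqrt (2 ^ q)" by (rule le_sqrt_two_power)
    also have "\<dots> \<le> 2 * sqrt (2 * r)" using qr by simp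
    also have "\<dots> = (2 * sqrt 2) * sqrt r" by (simp add: real_sqrt_mult)
    also have "\<dots> \<le> 3 * sqrt r"
    proof (intro mult_right_mono)
      have "sqrt 2 \<le> 3 / 2" by (rule real_le_lsqrt) (auto simp: power2_eq_square)
      thus "2 * sqrt 2 \<le> (3::real)" by simp
    qed (use r in auto)
    finally show "real q \<le> 3 * sqrt r" .
  qed
  finally show ?thesis by (simp add: r_def)
qed

text \<open>Each term is at most the increment of \<open>2 * sqrt (ln e)\<close>, and the increments
  telescope.\<close>

lemma sum_inverse_sqrt_ln_le:
  assumes "n0 \<ge> 2"
  shows "(\<Sum>e\<in>{n0..n}. 1 / (real e * sqrt (ln (real e)))) \<le> 2 * sqrt (ln (real n))"
proof (cases "n \<ge> n0")
  case True
  have step: "1 / (real e * sqrt (ln (real e))) \<le> 2 * (sqrt (ln (real e)) - sqrt (ln (real (e - 1))))" if e: "e \<ge> 2" for e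
  proof -
    define x y where "x = ln (real e)" and "y = ln (real (e - 1))"
    have x: "x > 0" and y: "y \<ge> 0" using e by (auto simp: x_def y_def)
    have "ln (real (e - 1) / real e) \<le> real (e - 1) / real e - 1" using e by (intro ln_le_minus_one) auto
    hence xy: "1 / real e \<le> x - y" using e by (simp add: x_def y_def ln_div field_simps of_nat_diff)
    hence yx: "y \<le> x" using e by (smt (verit) divide_nonneg_nonneg of_nat_0_le_iff)
    have "x - y = (sqrt x - sqrt y) * (sqrt x + sqrt y)"
      using x y by (simp add: algebra_simps flip: power2_eq_square)
    also have "\<dots> \<le> (sqrt x - sqrt y) * (2 * sqrt x)" using yx by (intro mult_left_mono) auto
    also have "\<dots> = 2 * (sqrt x - sqrt y) * sqrt x" by simp
    finally have "1 / real e \<le> 2 * (sqrt x - sqrt y) * sqrt x" using xy by linarith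
    hence "1 / real e / sqrt x \<le> 2 * (sqrt x - sqrt y)" using x by (simp only: pos_divide_le_eq real_sqrt_gt_zero)
    thus ?thesis by (simp add: x_def y_def)
  qed
  have "(\<Sum>e\<in>{n0..n}. 1 / (real e * sqrt (ln (real e)))) \<le> (\<Sum>e\<in>{n0..n}. 2 * (sqrt (ln (real e)) - sqrt (ln (real (e - 1)))))"
    using assms by (intro sum_mono step) auto
  also have "\<dots> = 2 * (\<Sum>e\<in>{n0..n}. sqrt (ln (real e)) - sqrt (ln (real (e - 1))))" by (simp add: sum_distrib_left)
  also have "(\<Sum>e\<in>{n0..n}. sqrt (ln (real e)) - sqrt (ln (real (e - 1)))) = sqrt (ln (real n)) - sqrt (ln (real (n0 - 1)))"
  proof -
    have "(\<Sum>e\<in>{n0..n}. F e - F (e - 1)) = F n - F (n0 - 1)" for F :: "nat \<Rightarrow> real"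
      using True by (induction n rule: nat_induct_at_least) auto
    thus ?thesis .
  qed
  also have "2 * \<dots> \<le> 2 * sqrt (ln (real n))" using assms by simp
  finally show ?thesis .
next
  case False
  have "0 \<le> ln (real n)" by (cases "n = 0") auto
  thus ?thesis using False by simp
qed

text \<open>Half of the decay \<open>e powr (- 1 / V)\<close> absorbs the logarithm, through
  \<open>ln e \<le> 2 * V * e powr (1 / (2 * V))\<close>.\<close>

lemma sum_ln_powr_le:
  assumes V: "V > 0"
  shows "(\<Sum>e=1..N. ln (real e) * real e powr -(1 + 1 / V)) \<le> 2 * V * (1 + 2 * V)"
proof -
  have "(\<Sum>e=1..N. ln (real e) * real e powr -(1 + 1 / V)) \<le> (\<Sum>e=1..N. 2 * V * real e powr -(1 + 1 / (2 * V)))"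
  proof (rule sum_mono)
    fix e assume "e \<in> {1..N}"
    hence "ln (real e) \<le> real e powr (1 / (2 * V)) / (1 / (2 * V))" using V by (intro ln_powr_bound) auto
    hence "ln (real e) * real e powr -(1 + 1 / V) \<le> 2 * V * real e powr (1 / (2 * V)) * real e powr -(1 + 1 / V)"
      by (intro mult_right_mono) (auto simp: mult_ac)
    also have "\<dots> = 2 * V * (real e powr (1 / (2 * V)) * real e powr -(1 + 1 / V))" by simp
    also have "real e powr (1 / (2 * V)) * real e powr -(1 + 1 / V) = real e powr -(1 + 1 / (2 * V))"
      unfolding powr_add[symmetric] using V by (intro arg_cong2[where f="(powr)"] refl) (simp add: field_simps)
    finally show "ln (real e) * real e powr -(1 + 1 / V) \<le> 2 * V * real e powr -(1 + 1 / (2 * V))" .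
  qed
  also have "\<dots> = 2 * V * (\<Sum>e=1..N. real e powr -(1 + 1 / (2 * V)))" by (simp add: sum_distrib_left)
  also have "\<dots> \<le> 2 * V * (1 + 1 / ((1 + 1 / (2 * V)) - 1))"
    using V by (intro mult_left_mono sum_powr_minus_le) auto
  finally show ?thesis using V by simp
qed

section \<open>The equivalence\<close>

text \<open>With \<open>f = a * 1\<close> (Dirichlet convolution), \<open>(a ln) * 1 = f ln - mangoldt * f\<close>.\<close>

lemma smallo_log_sum_if_smallo_sum:
  fixes a :: "nat \<Rightarrow> complex"
  assumes S: "(\<lambda>n. ingham_sum a n / of_nat n) \<longlonglongrightarrow> 0"
  shows "ingham_sum (\<lambda>k. a k * of_real (ln (real k))) \<in> o(\<lambda>n. of_real (real n * ln (real n)))"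
proof (rule landau_o.smallI)
  fix c :: real assume c: "c > 0"
  define f where "f m = (\<Sum>d | d dvd m. a d)" for m
  have Sf: "(\<Sum>i=1..n. f i) = ingham_sum a n" for n by (simp add: ingham_sum_conv_divisor_sum f_def)
  \<comment> \<open>The sum with \<open>f\<close> and the sum with \<open>mangoldt\<close> take one
    third each of \<open>c * n * ln n\<close>; the last third covers the lower order terms.\<close>
  define \<delta> where "\<delta> = c / 3"
  have \<delta>: "\<delta> > 0" using c by (simp add: \<delta>_def)
  from S \<delta> have "eventually (\<lambda>n. norm (ingham_sum a n / of_nat n) < \<delta>) sequentially"
    by (auto simp: tendsto_iff)
  then obtain n0 where n0: "\<And>n. n \<ge> n0 \<Longrightarrow> norm (ingham_sum a n / of_nat n) < \<delta>"
    by (auto simp: eventually_at_top_linorder)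
  define M where "M = (\<Sum>e<n0. norm (ingham_sum a e))"
  have M: "M \<ge> 0" by (simp add: M_def sum_nonneg)
  have bd: "norm (ingham_sum a e) \<le> \<delta> * real e + M" for e
  proof (cases "e \<ge> n0")
    case True
    show ?thesis
    proof (cases "e = 0")
      case False
      thus ?thesis using n0[OF True] M by (simp add: norm_divide divide_less_eq split: if_splits)
    qed (use M in \<open>simp add: ingham_sum_def\<close>)
  next
    case False
    hence "norm (ingham_sum a e) \<le> M" unfolding M_def by (intro member_le_sum) auto
    thus ?thesis using \<delta> by (smt (verit) mult_nonneg_nonneg of_nat_0_le_iff)
  qed
  have eq: "ingham_sum (\<lambda>k. a k * of_real (ln (real k))) n
      = (\<Sum>m=1..n. f m * of_real (ln (real m))) - (\<Sum>d=1..n. of_real (mangoldt d) * ingham_sum a (n div d))" for n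
  proof -
    have "ingham_sum (\<lambda>k. a k * of_real (ln (real k))) n = (\<Sum>m=1..n. \<Sum>k | k dvd m. a k * of_real (ln (real k)))"
      by (rule ingham_sum_conv_divisor_sum)
    also have "\<dots> = (\<Sum>m=1..n. f m * of_real (ln (real m)) - (\<Sum>d | d dvd m. of_real (mangoldt d) * f (m div d)))"
    proof (rule sum.cong[OF refl])
      fix m assume "m \<in> {1..n}"
      hence m: "m > 0" by simp
      have "(\<Sum>k | k dvd m. a k * of_real (ln (real k)))
          = (\<Sum>k | k dvd m. a k * of_real (ln (real m)) - (\<Sum>d | d dvd m div k. a k * of_real (mangoldt d)))"
      proof (rule sum.cong[OF refl])
        fix k assume "k \<in> {k. k dvd m}"
        hence k: "k dvd m" "k > 0" "m div k > 0" using m by (auto elim!: dvdE)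
        have "ln (real m) = ln (real k * real (m div k))" using k by (simp flip: of_nat_mult)
        also have "\<dots> = ln (real k) + ln (real (m div k))" using k by (subst ln_mult) auto
        finally have l: "ln (real m) = ln (real k) + ln (real (m div k))" .
        have "(\<Sum>d | d dvd m div k. mangoldt d) = ln (real (m div k))"
          using k by (subst mangoldt_sum) auto
        hence "(\<Sum>d | d dvd m div k. a k * of_real (mangoldt d)) = a k * of_real (ln (real (m div k)))"
          by (simp only: sum_distrib_left[symmetric] of_real_sum[symmetric])
        thus "a k * of_real (ln (real k)) = a k * of_real (ln (real m)) - (\<Sum>d | d dvd m div k. a k * of_real (mangoldt d))"
          by (simp add: l algebra_simps)
      qed
      also have "\<dots> = f m * of_real (ln (real m)) - (\<Sum>k | k dvd m. \<Sum>d | d dvd m div k. a k * of_real (mangoldt d))"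
        by (simp add: sum_subtractf f_def sum_distrib_right)
      also have "(\<Sum>k | k dvd m. \<Sum>d | d dvd m div k. a k * of_real (mangoldt d))
          = (\<Sum>q | q dvd m. \<Sum>d | d dvd q. a (q div d) * of_real (mangoldt d))"
        by (rule sum_dvd_cofactor_swap[OF m])
      also have "\<dots> = (\<Sum>d | d dvd m. \<Sum>i | i dvd m div d. a (d * i div d) * of_real (mangoldt d))"
        by (rule sum_dvd_dvd_swap[OF m])
      also have "\<dots> = (\<Sum>d | d dvd m. of_real (mangoldt d) * f (m div d))"
      proof (rule sum.cong[OF refl])
        fix d assume "d \<in> {d. d dvd m}"
        hence "d > 0" using m by (auto intro: Nat.gr0I)
        thus "(\<Sum>i | i dvd m div d. a (d * i div d) * of_real (mangoldt d)) = of_real (mangoldt d) * f (m div d)"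
          by (simp add: f_def sum_distrib_left mult.commute)
      qed
      finally show "(\<Sum>k | k dvd m. a k * of_real (ln (real k))) = f m * of_real (ln (real m)) - (\<Sum>d | d dvd m. of_real (mangoldt d) * f (m div d))" .
    qed
    also have "\<dots> = (\<Sum>m=1..n. f m * of_real (ln (real m))) - (\<Sum>m=1..n. \<Sum>d | d dvd m. of_real (mangoldt d) * f (m div d))"
      by (rule sum_subtractf)
    also have "(\<Sum>m=1..n. \<Sum>d | d dvd m. of_real (mangoldt d) * f (m div d)) = (\<Sum>d=1..n. \<Sum>i=1..n div d. of_real (mangoldt d) * f i)"
      by (rule sum_dvd_hyperbola)
    also have "\<dots> = (\<Sum>d=1..n. of_real (mangoldt d) * ingham_sum a (n div d))"
      by (simp only: sum_distrib_left[symmetric] Sf)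
    finally show ?thesis .
  qed
  have "filterlim (\<lambda>n. ln (real n)) at_top at_top" by real_asymp
  hence "eventually (\<lambda>n. ln (real n) \<ge> (2 * \<delta> + 8 * M) / \<delta>) at_top" unfolding filterlim_at_top by blast
  thus "eventually (\<lambda>n. norm (ingham_sum (\<lambda>k. a k * of_real (ln (real k))) n) \<le> c * norm (of_real (real n * ln (real n)) :: complex)) at_top"
    using eventually_ge_at_top[of 1]
  proof eventually_elim
    case (elim n)
    define L where "L = ln (real n)"
    have L0: "L \<ge> 0" using elim by (simp add: L_def)
    have L1: "L + 1 \<le> real n" using ln_le_minus_one[of "real n"] elim by (simp add: L_def)
    have lSuc: "ln (real (Suc n)) - ln (real n) \<le> 1 / real n" if "n \<ge> 1" for n
      using that ln_le_minus_one[of "real (Suc n) / real n"] by (simp add: ln_div field_simps)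
    have lSuc1: "ln (real (Suc n)) \<le> L + 1"
      using lSuc[of n] elim by (smt (verit) L_def divide_le_eq_1 of_nat_1 of_nat_le_iff)
    have A: "norm (\<Sum>m=1..n. f m * of_real (ln (real m))) \<le> (\<delta> * real n + M) * (L + 1) + (\<delta> * real n + M * (1 + L))"
    proof -
      have "(\<Sum>m=1..n. f m * of_real (ln (real m))) = ingham_sum a n * of_real (ln (real (Suc n)))
          + (\<Sum>e=1..n. ingham_sum a e * (of_real (ln (real e)) - of_real (ln (real (Suc e)))))"
        by (subst sum_by_parts_nat, simp only: Sf)
      also have "norm \<dots> \<le> (\<delta> * real n + M) * (L + 1) + (\<Sum>e=1..n. \<delta> + M * (1 / real e))"
      proof (intro order.trans[OF norm_triangle_ineq] add_mono sum_norm_le)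
        show "norm (ingham_sum a n * of_real (ln (real (Suc n)))) \<le> (\<delta> * real n + M) * (L + 1)"
          unfolding norm_mult using bd[of n] lSuc1 \<delta> M elim by (intro mult_mono) auto
        fix e assume e: "e \<in> {1..n}"
        have "norm (ingham_sum a e * (of_real (ln (real e)) - of_real (ln (real (Suc e)))))
            = norm (ingham_sum a e) * (ln (real (Suc e)) - ln (real e))"
          unfolding norm_mult of_real_diff[symmetric] norm_of_real using e by simp
        also have "\<dots> \<le> (\<delta> * real e + M) * (1 / real e)"
          using bd[of e] lSuc[of e] e \<delta> M by (intro mult_mono) auto
        also have "\<dots> = \<delta> + M * (1 / real e)" using e by (simp add: field_simps)
        finally show "norm (ingham_sum a e * (of_real (ln (real e)) - of_real (ln (real (Suc e))))) \<le> \<delta> + M * (1 / real e)" .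
      qed
      also have "(\<Sum>e=1..n. \<delta> + M * (1 / real e)) = \<delta> * real n + M * (\<Sum>e=1..n. 1 / real e)"
        by (simp add: sum.distrib sum_distrib_left)
      also have "\<dots> \<le> \<delta> * real n + M * (1 + L)"
        unfolding L_def using M elim by (intro add_left_mono mult_left_mono sum_inverse_le) auto
      finally show ?thesis by simp
    qed
    \<comment> \<open>The constant part \<open>M\<close> of the bound on \<open>ingham_sum\<close>
      meets the full sum of \<open>mangoldt\<close>, which is where Chebyshev's bound
      enters.\<close>
    have B: "norm (\<Sum>d=1..n. of_real (mangoldt d) * ingham_sum a (n div d)) \<le> \<delta> * (real n * L) + M * (4 * real n)"
    proof -
      have "norm (\<Sum>d=1..n. of_real (mangoldt d) * ingham_sum a (n div d)) \<le> (\<Sum>d=1..n. mangoldt d * (\<delta> * real (n div d) + M))"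
      proof (rule sum_norm_le)
        fix d
        show "norm (of_real (mangoldt d) * ingham_sum a (n div d)) \<le> mangoldt d * (\<delta> * real (n div d) + M)"
          unfolding norm_mult norm_of_real abs_mangoldt by (intro mult_left_mono bd mangoldt_nonneg)
      qed
      also have "\<dots> = \<delta> * (\<Sum>d=1..n. mangoldt d * real (n div d)) + M * (\<Sum>d=1..n. mangoldt d)"
        by (simp add: sum_distrib_left sum.distrib algebra_simps)
      also have "\<dots> \<le> \<delta> * (real n * L) + M * (4 * real n)"
        unfolding sum_mangoldt_floor L_def using \<delta> M by (intro add_mono mult_left_mono ln_fact_le psi_le) auto
      finally show ?thesis .
    qed
    have "norm (ingham_sum (\<lambda>k. a k * of_real (ln (real k))) n)
        \<le> (\<delta> * real n + M) * (L + 1) + (\<delta> * real n + M * (1 + L)) + (\<delta> * (real n * L) + M * (4 * real n))"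
      unfolding eq by (rule order.trans[OF norm_triangle_ineq4 add_mono[OF A B]])
    also have "\<dots> = 2 * \<delta> * (real n * L) + (2 * \<delta> * real n + 2 * M * (L + 1) + 4 * M * real n)"
      by (simp add: algebra_simps)
    also have "\<dots> \<le> 2 * \<delta> * (real n * L) + (2 * \<delta> * real n + 2 * M * real n + 4 * M * real n)"
      using M L1 \<delta> by (intro add_mono mult_left_mono) auto
    also have "\<dots> \<le> 2 * \<delta> * (real n * L) + real n * (2 * \<delta> + 8 * M)"
      using M by (simp add: algebra_simps)
    also have "\<dots> \<le> 2 * \<delta> * (real n * L) + real n * (\<delta> * L)"
      using elim \<delta> by (intro add_left_mono mult_left_mono) (auto simp: L_def field_simps)
    also have "\<dots> = c * (real n * L)" by (simp add: \<delta>_def algebra_simps)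
    also have "\<dots> = c * norm (of_real (real n * ln (real n)) :: complex)"
      using L0 by (simp add: norm_mult L_def)
    finally show ?case .
  qed
qed

text \<open>Changing \<open>a 1\<close> shifts the mean by a constant and leaves the logarithmic sum
  untouched, since \<open>ln 1 = 0\<close>; this reduces the claim to limit 0.\<close>

lemma smallo_log_sum_if_mean:
  fixes a :: "nat \<Rightarrow> complex"
  assumes S: "(\<lambda>n. ingham_sum a n / of_nat n) \<longlonglongrightarrow> C"
  shows "ingham_sum (\<lambda>k. a k * of_real (ln (real k))) \<in> o(\<lambda>n. of_real (real n * ln (real n)))"
proof -
  define a' where "a' k = a k - (if k = 1 then C else 0)" for k
  have "ingham_sum a' n = ingham_sum a n - C * of_nat n" for n
  proof (cases "n = 0")
    case False
    have "ingham_sum a' n = (\<Sum>k=1..n. a k * of_nat (n div k) - (if k = 1 then C * of_nat (n div k) else 0))"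
      unfolding ingham_sum_def a'_def by (intro sum.cong) (auto simp: algebra_simps)
    thus ?thesis using False by (simp add: sum_subtractf ingham_sum_def)
  qed (simp add: ingham_sum_def)
  hence "eventually (\<lambda>n. ingham_sum a n / of_nat n - C = ingham_sum a' n / of_nat n) sequentially"
    by (intro eventually_mono[OF eventually_gt_at_top[of 0]]) (auto simp: field_simps)
  from Lim_transform_eventually[OF tendsto_diff[OF S tendsto_const[of C]] this]
  have "(\<lambda>n. ingham_sum a' n / of_nat n) \<longlonglongrightarrow> 0" by simp
  from smallo_log_sum_if_smallo_sum[OF this]
  have "ingham_sum (\<lambda>k. a' k * of_real (ln (real k))) \<in> o(\<lambda>n. of_real (real n * ln (real n)))" .
  moreover have "(\<lambda>k. a' k * of_real (ln (real k))) = (\<lambda>k. a k * of_real (ln (real k)))"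
    by (auto simp: a'_def)
  ultimately show ?thesis by simp
qed

section \<open>The Dirichlet series near 1\<close>

definition dirichlet_sum :: "(nat \<Rightarrow> complex) \<Rightarrow> real \<Rightarrow> complex" where
  "dirichlet_sum a \<sigma> = (\<Sum>m. a (Suc m) / of_real (real (Suc m) powr \<sigma>))"

lemma dirichlet_sums_iff:
  fixes a :: "nat \<Rightarrow> complex"
  shows "(\<lambda>m. a (Suc m) / of_real (real (Suc m) powr \<sigma>)) sums L \<longleftrightarrow>
    (\<lambda>N. \<Sum>k=1..N. a k * of_real (real k powr -\<sigma>)) \<longlonglongrightarrow> L"
proof -
  have "(\<lambda>m. a (Suc m) / of_real (real (Suc m) powr \<sigma>)) = (\<lambda>m. a (Suc m) * of_real (real (Suc m) powr -\<sigma>))"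
    by (simp only: powr_minus_divide of_real_divide of_real_1 times_divide_eq_right mult_1_right)
  thus ?thesis using sums_Suc_iff_atLeast1[of "\<lambda>k. a k * of_real (real k powr -\<sigma>)"] by simp
qed

text \<open>The Abelian half. Indices below \<open>n0\<close> contribute a bounded amount, which the
  factor \<open>\<sigma> - 1\<close> kills; the others contribute at most \<open>\<delta>\<close>
  times the mass of the weights, which is of order \<open>1 / (\<sigma> - 1)\<close>.\<close>

lemma dirichlet_sum_tendsto_if_mean:
  fixes a :: "nat \<Rightarrow> complex"
  assumes S: "(\<lambda>n. ingham_sum a n / of_nat n) \<longlonglongrightarrow> C"
    and summ: "\<And>\<sigma>. \<sigma> > 1 \<Longrightarrow> summable (\<lambda>m. a (Suc m) / of_real (real (Suc m) powr \<sigma>))"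
  shows "(dirichlet_sum a \<longlongrightarrow> C) (at_right 1)"
proof (rule tendstoI)
  fix \<epsilon> :: real assume \<epsilon>: "\<epsilon> > 0"
  define D where "D e = norm (ingham_sum a e / of_nat e - C)" for e
  have "Bseq (\<lambda>n. ingham_sum a n / of_nat n)" using S by (intro convergent_imp_Bseq) (auto simp: convergent_def)
  then obtain K where K: "K > 0" "\<And>n. norm (ingham_sum a n / of_nat n) \<le> K" by (auto elim: BseqE)
  have growth: "norm (ingham_sum a n) \<le> K * real n powr 1" if "n \<ge> 1" for n
    using K(2)[of n] that by (simp add: norm_divide divide_le_eq split: if_splits)
  \<comment> \<open>The bound obtained tends to \<open>2 * \<delta>\<close>; the 2 comes from
    \<open>\<sigma> < 2\<close> in \<open>abel_weight_le\<close>.\<close>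
  define \<delta> where "\<delta> = \<epsilon> / 4"
  have \<delta>: "\<delta> > 0" using \<epsilon> by (simp add: \<delta>_def)
  have "eventually (\<lambda>n. D n < \<delta>) sequentially"
    using S \<delta> by (auto simp: tendsto_iff dist_norm D_def)
  then obtain n0 where n0: "\<And>n. n \<ge> n0 \<Longrightarrow> D n < \<delta>" by (auto simp: eventually_at_top_linorder)
  define M where "M = (\<Sum>e<n0. D e)"
  have D0: "D e \<ge> 0" for e by (simp add: D_def)
  have main: "norm (dirichlet_sum a \<sigma> - C) \<le> 2 * (M + \<delta>) * (\<sigma> - 1) + 2 * \<delta>" if \<sigma>: "1 < \<sigma>" "\<sigma> < 2" for \<sigma>
  proof -
    have w: "abel_weight \<sigma> e \<le> 2 * real e powr -\<sigma>" for e
      using abel_weight_le[of \<sigma> e] \<sigma> mult_right_mono[of \<sigma> 2 "real e powr -\<sigma>"] by simp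
    have w1: "abel_weight \<sigma> e \<le> 2" for e
    proof -
      have "real e powr -\<sigma> \<le> 1"
        using \<sigma> powr_mono2'[of "-\<sigma>" 1 "real e"] by (cases "e = 0") auto
      thus ?thesis using w[of e] by linarith
    qed
    have w0: "abel_weight \<sigma> e \<ge> 0" for e using \<sigma> by (intro abel_weight_nonneg) auto
    have B: "(\<Sum>e=1..N. D e * abel_weight \<sigma> e) \<le> 2 * M + \<delta> * (2 * (1 + 1 / (\<sigma> - 1)))" for N
    proof -
      have "(\<Sum>e=1..N. D e * abel_weight \<sigma> e) \<le> (\<Sum>e=1..N. (if e < n0 then 2 * D e else 0) + \<delta> * (2 * real e powr -\<sigma>))"
      proof (rule sum_mono)
        fix e
        show "D e * abel_weight \<sigma> e \<le> (if e < n0 then 2 * D e else 0) + \<delta> * (2 * real e powr -\<sigma>)"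
        proof (cases "e < n0")
          case True
          have "D e * abel_weight \<sigma> e \<le> D e * 2" by (intro mult_left_mono w1 D0)
          also have "\<dots> \<le> 2 * D e + \<delta> * (2 * real e powr -\<sigma>)" using \<delta> by simp
          finally show ?thesis using True by simp
        next
          case False
          hence "D e * abel_weight \<sigma> e \<le> \<delta> * (2 * real e powr -\<sigma>)"
            using n0[of e] w[of e] w0[of e] D0[of e] \<delta> by (intro mult_mono) auto
          thus ?thesis using False by simp
        qed
      qed
      also have "\<dots> = (\<Sum>e=1..N. if e < n0 then 2 * D e else 0) + \<delta> * (2 * (\<Sum>e=1..N. real e powr -\<sigma>))"
        by (simp add: sum.distrib sum_distrib_left)
      also have "\<dots> \<le> 2 * M + \<delta> * (2 * (1 + 1 / (\<sigma> - 1)))"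
      proof (intro add_mono mult_left_mono sum_powr_minus_le)
        have "(\<Sum>e=1..N. if e < n0 then 2 * D e else 0) = (\<Sum>e\<in>{1..N} \<inter> {..<n0}. 2 * D e)"
          by (subst sum.inter_restrict) auto
        also have "\<dots> \<le> (\<Sum>e<n0. 2 * D e)" using D0 by (intro sum_mono2) auto
        finally show "(\<Sum>e=1..N. if e < n0 then 2 * D e else 0) \<le> 2 * M" by (simp add: M_def sum_distrib_left)
      qed (use \<delta> \<sigma> in auto)
      finally show ?thesis .
    qed
    have L: "(\<lambda>N. \<Sum>k=1..N. a k * of_real (real k powr -\<sigma>)) \<longlonglongrightarrow> dirichlet_sum a \<sigma>"
      unfolding dirichlet_sum_def using summable_sums[OF summ[OF \<sigma>(1)]] by (simp only: dirichlet_sums_iff)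
    have "norm (dirichlet_sum a \<sigma> - C) \<le> (2 * M + \<delta> * (2 * (1 + 1 / (\<sigma> - 1)))) * (\<sigma> - 1)"
      by (rule norm_dirichlet_limit_diff_le[OF growth _ _ L]) (use \<sigma> B D_def in auto)
    also have "\<dots> = 2 * (M + \<delta>) * (\<sigma> - 1) + 2 * \<delta>" using \<sigma> by (simp add: field_simps)
    finally show ?thesis .
  qed
  have "((\<lambda>\<sigma>. 2 * (M + \<delta>) * (\<sigma> - 1) + 2 * \<delta>) \<longlongrightarrow> 2 * (M + \<delta>) * (1 - 1) + 2 * \<delta>) (at_right 1)"
    by (intro tendsto_intros)
  moreover have "2 * (M + \<delta>) * (1 - 1) + 2 * \<delta> < \<epsilon>" using \<epsilon> by (simp add: \<delta>_def)
  ultimately have "eventually (\<lambda>\<sigma>. 2 * (M + \<delta>) * (\<sigma> - 1) + 2 * \<delta> < \<epsilon>) (at_right 1)"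
    by (rule order_tendstoD)
  moreover have "eventually (\<lambda>\<sigma>. \<sigma> \<in> {1<..<2::real}) (at_right 1)"
    by (rule eventually_at_right_real) simp
  ultimately show "eventually (\<lambda>\<sigma>. dist (dirichlet_sum a \<sigma>) C < \<epsilon>) (at_right 1)"
  proof eventually_elim
    case (elim \<sigma>)
    thus ?case using main[of \<sigma>] by (auto simp: dist_norm)
  qed
qed

text \<open>The Tauberian half. By \<open>slow_variation_sqrt\<close> the deviation of
  \<open>R e\<close> from \<open>R n\<close> is at most \<open>3 * \<epsilon>\<close> times the root
  of a quotient of logarithms. Against the weights this sums to \<open>O(\<epsilon> * ln n)\<close>
  on both sides of \<open>n\<close>, which \<open>\<sigma> - 1 = 1 / ln n\<close>
  compensates.\<close>

lemma dirichlet_sum_mean_close: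
  fixes a :: "nat \<Rightarrow> complex"
  assumes o: "ingham_sum (\<lambda>k. a k * of_real (ln (real k))) \<in> o(\<lambda>n. of_real (real n * ln (real n)))"
  shows "(\<lambda>n. dirichlet_sum a (1 + 1 / ln (real n)) - ingham_sum a n / of_nat n) \<longlonglongrightarrow> 0"
proof -
  define R where "R n = ingham_sum a n / of_nat n" for n
  \<comment> \<open>Convergence at 2 bounds the partial sums, hence \<open>a k = O(k ^ 2)\<close>,
    the polynomial bound required by \<open>ingham_mean_slowly_varying\<close>.\<close>
  obtain L2 where L2: "(\<lambda>N. \<Sum>k=1..N. a k * of_real (real k powr -2)) \<longlonglongrightarrow> L2"
    using dirichlet_series_converges[OF o, of 2] by auto
  define P where "P N = (\<Sum>k=1..N. a k * of_real (real k powr -2))" for N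
  have "Bseq P" using L2 unfolding P_def by (intro convergent_imp_Bseq) (auto simp: convergent_def)
  then obtain B where B: "B > 0" "\<And>N. norm (P N) \<le> B" by (auto elim: BseqE)
  have a_bd: "norm (a k) \<le> 2 * B * real k ^ 2" if k: "k \<ge> 1" for k
  proof -
    obtain j where j: "k = Suc j" using k by (cases k) auto
    have "a k * of_real (real k powr -2) = P k - P j" by (simp add: P_def j)
    hence "norm (a k * of_real (real k powr -2)) \<le> 2 * B"
      using norm_triangle_ineq4[of "P k" "P j"] B(2)[of k] B(2)[of j] by simp
    moreover have "real k powr -2 = 1 / real k ^ 2" using k by (simp add: powr_minus powr_numeral divide_inverse)
    ultimately show ?thesis using k by (simp add: norm_divide norm_power pos_divide_le_eq)
  qed
  have slow: "\<exists>n0\<ge>3. \<forall>n\<ge>n0. \<forall>n'. n \<le> n' \<longrightarrow> n' \<le> n ^ 2 \<longrightarrow> norm (R n - R n') \<le> \<epsilon>" if eps: "\<epsilon> > 0" for \<epsilon>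
  proof -
    obtain n1 where "\<forall>n\<ge>n1. \<forall>n'. n \<le> n' \<longrightarrow> n' \<le> n ^ 2 \<longrightarrow> norm (R n - R n') \<le> \<epsilon>"
      using ingham_mean_slowly_varying[OF o a_bd eps] unfolding R_def by blast
    thus ?thesis by (intro exI[of _ "max n1 3"]) auto
  qed
  have ln3: "ln (real e) \<ge> 1" if "e \<ge> 3" for e :: nat
  proof -
    have "exp 1 \<le> real e" using exp_le that by linarith
    thus ?thesis using that by (subst ln_ge_iff) auto
  qed
  define Mx where "Mx n0 = (\<Sum>e\<le>n0. norm (R e))" for n0 :: nat
  have Mx: "norm (R e) \<le> Mx n0" if "e \<le> n0" for e n0
    unfolding Mx_def using that by (intro member_le_sum) auto
  have Mx0: "Mx n0 \<ge> 0" for n0 by (simp add: Mx_def sum_nonneg)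
  have R_bd: "norm (R n) \<le> Mx n0 + 3 * \<epsilon> * sqrt (ln (real n))"
    if n0: "n0 \<ge> 3" "\<forall>n\<ge>n0. \<forall>n'. n \<le> n' \<longrightarrow> n' \<le> n ^ 2 \<longrightarrow> norm (R n - R n') \<le> \<epsilon>" and \<epsilon>: "\<epsilon> > 0" and n: "n \<ge> n0" for n n0 \<epsilon>
  proof -
    have "norm (R n0 - R n) \<le> 3 * \<epsilon> * sqrt (ln (real n) / ln (real n0))"
      by (rule slow_variation_sqrt[where ?n0.0 = n0]) (use n0 \<epsilon> n in auto)
    also have "\<dots> \<le> 3 * \<epsilon> * sqrt (ln (real n))"
    proof (intro mult_left_mono real_sqrt_le_mono)
      have "ln (real n) / ln (real n0) \<le> ln (real n) / 1"
        using ln3[OF n0(1)] n n0 by (intro divide_left_mono) auto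
      thus "ln (real n) / ln (real n0) \<le> ln (real n)" by simp
    qed (use \<epsilon> in auto)
    finally show ?thesis using Mx[of n0 n0] norm_triangle_sub[of "R n" "R n0"] by (simp add: norm_minus_commute)
  qed
  \<comment> \<open>Slow variation with \<open>\<epsilon> = 1\<close> gives
    \<open>R n = O(sqrt (ln n))\<close>, which is enough for every growth exponent above 1.\<close>
  have growth: "\<exists>K. \<forall>n\<ge>1. norm (ingham_sum a n) \<le> K * real n powr (1 + \<delta>)" if \<delta>: "\<delta> > 0" for \<delta>
  proof -
    obtain n0 where n0: "n0 \<ge> 3" "\<forall>n\<ge>n0. \<forall>n'. n \<le> n' \<longrightarrow> n' \<le> n ^ 2 \<longrightarrow> norm (R n - R n') \<le> 1"
      using slow[of 1] by auto
    have "norm (ingham_sum a n) \<le> (Mx n0 + 3 / \<delta>) * real n powr (1 + \<delta>)" if n: "n \<ge> 1" for n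
    proof -
      have np: "real n powr \<delta> \<ge> 1" using n \<delta> by (intro ge_one_powr_ge_zero) auto
      have "norm (R n) \<le> (Mx n0 + 3 / \<delta>) * real n powr \<delta>"
      proof (cases "n \<ge> n0")
        case True
        have l: "ln (real n) \<ge> 1" using ln3 True n0 by auto
        hence "ln (real n) * 1 \<le> ln (real n) * ln (real n)" by (intro mult_left_mono) auto
        hence "sqrt (ln (real n)) \<le> ln (real n)" using l by (intro real_le_lsqrt) (auto simp: power2_eq_square)
        also have "\<dots> \<le> real n powr \<delta> / \<delta>" using n \<delta> by (intro ln_powr_bound) auto
        finally have "norm (R n) \<le> Mx n0 * 1 + 3 * (real n powr \<delta> / \<delta>)"
          using R_bd[OF n0 _ True] by simp
        also have "\<dots> \<le> Mx n0 * real n powr \<delta> + 3 * (real n powr \<delta> / \<delta>)"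
          using np Mx0 by (intro add_right_mono mult_left_mono) auto
        finally show ?thesis by (simp add: algebra_simps)
      next
        case False
        have "norm (R n) \<le> Mx n0 * 1" using Mx False by simp
        also have "\<dots> \<le> (Mx n0 + 3 / \<delta>) * real n powr \<delta>" using np Mx0 \<delta> by (intro mult_mono) auto
        finally show ?thesis .
      qed
      hence "real n * norm (R n) \<le> real n * ((Mx n0 + 3 / \<delta>) * real n powr \<delta>)" by (intro mult_left_mono) auto
      moreover have "real n * norm (R n) = norm (ingham_sum a n)" using n by (simp add: R_def norm_divide)
      ultimately show ?thesis using n by (simp add: powr_add mult_ac)
    qed
    thus ?thesis by blast
  qed
  show ?thesis unfolding R_def[symmetric]
  proof (rule LIMSEQ_I)
    fix \<eta> :: real assume \<eta>: "\<eta> > 0"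
    define \<epsilon> where "\<epsilon> = \<eta> / 100"
    have \<epsilon>: "\<epsilon> > 0" using \<eta> by (simp add: \<epsilon>_def)
    obtain n0 where n0: "n0 \<ge> 3" "\<forall>n\<ge>n0. \<forall>n'. n \<le> n' \<longrightarrow> n' \<le> n ^ 2 \<longrightarrow> norm (R n - R n') \<le> \<epsilon>"
      using slow[OF \<epsilon>] by auto
    \<comment> \<open>Head, middle and tail after multiplication by
      \<open>\<sigma> - 1 = 1 / V\<close>: the middle gives \<open>12 * \<epsilon>\<close>, the tail
      \<open>12 * \<epsilon> * (1 + 2 * V) / V\<close>. The head tends to 0, so the limit is
      \<open>36 * \<epsilon> < \<eta>\<close>.\<close>
    define F where "F V = 2 * real n0 * (2 * Mx n0 + 3 * \<epsilon> * sqrt V) / V + 36 * \<epsilon> + 12 * \<epsilon> / V" for V :: real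
    have main: "norm (dirichlet_sum a (1 + 1 / ln (real n)) - R n) \<le> F (ln (real n))" if n: "n \<ge> n0" for n
    proof -
      define V where "V = ln (real n)"
      have V: "V \<ge> 1" unfolding V_def using ln3 n n0 by auto
      define \<sigma> where "\<sigma> = 1 + 1 / V"
      have \<sigma>: "\<sigma> > 1" "\<sigma> \<le> 2" using V by (auto simp: \<sigma>_def)
      have w: "abel_weight \<sigma> e \<le> 2 * real e powr -\<sigma>" for e
        using abel_weight_le[of \<sigma> e] \<sigma> mult_right_mono[of \<sigma> 2 "real e powr -\<sigma>"] by simp
      have pw: "real e powr -\<sigma> \<le> 1 / real e" if "e \<ge> 1" for e
      proof -
        have "real e powr -\<sigma> \<le> real e powr -1" using that \<sigma> by (intro powr_mono) auto
        thus ?thesis using that by (simp add: powr_minus_divide)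
      qed
      have w0: "abel_weight \<sigma> e \<ge> 0" for e using \<sigma> by (intro abel_weight_nonneg) auto
      define D where "D e = norm (R e - R n)" for e
      have D0: "D e \<ge> 0" for e by (simp add: D_def)
      define Q where "Q = 2 * (2 * Mx n0 + 3 * \<epsilon> * sqrt V)"
      have Q0: "Q \<ge> 0" unfolding Q_def using Mx0 \<epsilon> V by (intro mult_nonneg_nonneg add_nonneg_nonneg) auto
      define T1 where "T1 e = (if e < n0 then Q else 0)" for e
      define T2 where "T2 e = (if n0 \<le> e \<and> e \<le> n then 6 * \<epsilon> * sqrt V * (1 / (real e * sqrt (ln (real e)))) else 0)" for e
      define T3 where "T3 e = 6 * \<epsilon> / V * (ln (real e) * real e powr -\<sigma>)" for e
      have T0: "T1 e \<ge> 0" "T2 e \<ge> 0" "T3 e \<ge> 0" if "e \<ge> 1" for e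
        using Q0 \<epsilon> V that n0 by (auto simp: T1_def T2_def T3_def)
      have T: "D e * abel_weight \<sigma> e \<le> T1 e + T2 e + T3 e" if e: "e \<ge> 1" for e
      proof -
        consider "e < n0" | "n0 \<le> e" "e \<le> n" | "n0 \<le> e" "n < e" by linarith
        thus ?thesis
        proof cases
          case 1
          have "D e \<le> norm (R e) + norm (R n)" unfolding D_def by (rule norm_triangle_ineq4)
          also have "\<dots> \<le> Mx n0 + (Mx n0 + 3 * \<epsilon> * sqrt V)"
            unfolding V_def using 1 by (intro add_mono Mx R_bd n0 \<epsilon> n) auto
          finally have "D e \<le> 2 * Mx n0 + 3 * \<epsilon> * sqrt V" by simp
          moreover have "abel_weight \<sigma> e \<le> 2"
          proof -
            have "1 / real e \<le> 1" using e by simp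
            thus ?thesis using w[of e] pw[OF e] by linarith
          qed
          ultimately have "D e * abel_weight \<sigma> e \<le> (2 * Mx n0 + 3 * \<epsilon> * sqrt V) * 2"
            using D0[of e] w0[of e] by (intro mult_mono) auto
          hence "D e * abel_weight \<sigma> e \<le> T1 e" using 1 by (simp add: T1_def Q_def)
          thus ?thesis using T0[OF e] by linarith
        next
          case 2
          have le: "ln (real e) \<ge> 1" using ln3 2 n0 by auto
          have "D e \<le> 3 * \<epsilon> * sqrt (ln (real n) / ln (real e))"
            unfolding D_def by (rule slow_variation_sqrt[where ?n0.0 = n0]) (use n0 \<epsilon> 2 in auto)
          also have "\<dots> = 3 * \<epsilon> * sqrt V / sqrt (ln (real e))" by (simp add: V_def real_sqrt_divide)
          finally have "D e * abel_weight \<sigma> e \<le> 3 * \<epsilon> * sqrt V / sqrt (ln (real e)) * (2 * (1 / real e))"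
            using w[of e] pw[OF e] w0[of e] \<epsilon> V le by (intro mult_mono) auto
          also have "\<dots> = T2 e" using 2 by (simp add: T2_def mult_ac)
          finally show ?thesis using T0[OF e] by linarith
        next
          case 3
          \<comment> \<open>Beyond \<open>n\<close> the quotient of logarithms is at least 1, so its
            root may be replaced by the quotient itself, to which \<open>sum_ln_powr_le\<close>
            applies.\<close>
          have lne: "ln (real e) / V \<ge> 1" using 3 V n n0 by (simp add: V_def)
          have "D e = norm (R n - R e)" unfolding D_def by (rule norm_minus_commute)
          also have "\<dots> \<le> 3 * \<epsilon> * sqrt (ln (real e) / ln (real n))"
            by (rule slow_variation_sqrt[where ?n0.0 = n0]) (use n0 \<epsilon> 3 n in auto)
          also have "\<dots> \<le> 3 * \<epsilon> * (ln (real e) / V)"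
          proof (intro mult_left_mono)
            have "ln (real e) / V * 1 \<le> ln (real e) / V * (ln (real e) / V)" using lne by (intro mult_left_mono) auto
            thus "sqrt (ln (real e) / ln (real n)) \<le> ln (real e) / V"
              using lne by (intro real_le_lsqrt) (auto simp: power2_eq_square V_def)
          qed (use \<epsilon> in auto)
          finally have "D e * abel_weight \<sigma> e \<le> 3 * \<epsilon> * (ln (real e) / V) * (2 * real e powr -\<sigma>)"
            using w[of e] w0[of e] D0[of e] by (intro mult_mono; linarith)
          also have "\<dots> = T3 e" by (simp add: T3_def)
          finally show ?thesis using T0[OF e] by linarith
        qed
      qed
      have bound: "(\<Sum>e=1..N. D e * abel_weight \<sigma> e) \<le> real n0 * Q + 12 * \<epsilon> * V + 12 * \<epsilon> * (1 + 2 * V)" for N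
      proof -
        have "(\<Sum>e=1..N. D e * abel_weight \<sigma> e) \<le> (\<Sum>e=1..N. T1 e + T2 e + T3 e)"
          by (intro sum_mono T) auto
        also have "\<dots> = (\<Sum>e=1..N. T1 e) + (\<Sum>e=1..N. T2 e) + (\<Sum>e=1..N. T3 e)" by (simp add: sum.distrib)
        also have "\<dots> \<le> real n0 * Q + 12 * \<epsilon> * V + 12 * \<epsilon> * (1 + 2 * V)"
        proof (intro add_mono)
          have "(\<Sum>e=1..N. T1 e) = (\<Sum>e\<in>{1..N} \<inter> {..<n0}. Q)"
            unfolding T1_def by (subst sum.inter_restrict) auto
          also have "\<dots> \<le> (\<Sum>e<n0. Q)" using Q0 by (intro sum_mono2) auto
          finally show "(\<Sum>e=1..N. T1 e) \<le> real n0 * Q" by simp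
        next
          have "(\<Sum>e=1..N. T2 e) = (\<Sum>e\<in>{1..N} \<inter> {n0..n}. 6 * \<epsilon> * sqrt V * (1 / (real e * sqrt (ln (real e)))))"
            unfolding T2_def by (subst sum.inter_restrict) auto
          also have "\<dots> \<le> (\<Sum>e\<in>{n0..n}. 6 * \<epsilon> * sqrt V * (1 / (real e * sqrt (ln (real e)))))"
            using \<epsilon> V n0 by (intro sum_mono2) auto
          also have "\<dots> = 6 * \<epsilon> * sqrt V * (\<Sum>e\<in>{n0..n}. 1 / (real e * sqrt (ln (real e))))"
            by (simp add: sum_distrib_left)
          also have "\<dots> \<le> 6 * \<epsilon> * sqrt V * (2 * sqrt V)"
            unfolding V_def using \<epsilon> V n0 by (intro mult_left_mono sum_inverse_sqrt_ln_le) (auto simp: V_def)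
          also have "\<dots> = 12 * \<epsilon> * V" using V by simp
          finally show "(\<Sum>e=1..N. T2 e) \<le> 12 * \<epsilon> * V" .
        next
          have "(\<Sum>e=1..N. T3 e) = 6 * \<epsilon> / V * (\<Sum>e=1..N. ln (real e) * real e powr -\<sigma>)"
            by (simp add: T3_def sum_distrib_left)
          also have "\<dots> \<le> 6 * \<epsilon> / V * (2 * V * (1 + 2 * V))"
            unfolding \<sigma>_def using \<epsilon> V by (intro mult_left_mono sum_ln_powr_le) auto
          also have "\<dots> = 12 * \<epsilon> * (1 + 2 * V)" using V by simp
          finally show "(\<Sum>e=1..N. T3 e) \<le> 12 * \<epsilon> * (1 + 2 * V)" .
        qed
        finally show ?thesis .
      qed
      \<comment> \<open>An exponent halfway between 1 and \<open>\<sigma>\<close>, as the growth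
        exponent must lie strictly below \<open>\<sigma>\<close>.\<close>
      obtain K where K: "\<And>n. n \<ge> 1 \<Longrightarrow> norm (ingham_sum a n) \<le> K * real n powr (1 + 1 / (2 * V))"
        using growth[of "1 / (2 * V)"] V by auto
      obtain L' where L': "(\<lambda>N. \<Sum>k=1..N. a k * of_real (real k powr -\<sigma>)) \<longlonglongrightarrow> L'"
        using dirichlet_series_converges[OF o \<sigma>(1)] by auto
      hence L: "dirichlet_sum a \<sigma> = L'"
        unfolding dirichlet_sum_def dirichlet_sums_iff[symmetric] by (rule sums_unique[symmetric])
      have "norm (L' - R n) \<le> (real n0 * Q + 12 * \<epsilon> * V + 12 * \<epsilon> * (1 + 2 * V)) * (\<sigma> - 1)"
        by (rule norm_dirichlet_limit_diff_le[OF K _ _ L'])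
           (use \<sigma> V bound in \<open>auto simp: \<sigma>_def D_def R_def field_simps\<close>)
      also have "\<dots> = F V" using V by (simp add: \<sigma>_def F_def Q_def field_simps)
      finally show ?thesis unfolding L[symmetric] \<sigma>_def V_def .
    qed
    have "((\<lambda>n. F (ln (real n))) \<longlongrightarrow> 36 * \<epsilon>) sequentially"
      unfolding F_def by real_asymp
    moreover have "36 * \<epsilon> < \<eta>" using \<eta> by (simp add: \<epsilon>_def)
    ultimately have "eventually (\<lambda>n. F (ln (real n)) < \<eta>) sequentially" by (rule order_tendstoD)
    then obtain n1 where n1: "\<And>n. n \<ge> n1 \<Longrightarrow> F (ln (real n)) < \<eta>" by (auto simp: eventually_at_top_linorder)
    show "\<exists>no. \<forall>n\<ge>no. norm (dirichlet_sum a (1 + 1 / ln (real n)) - R n - 0) < \<eta>"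
      using main n1 by (intro exI[of _ "max n0 n1"]) (auto intro: le_less_trans)
  qed
qed

text \<open>\<open>suminf\<close> is total, so condition (2) states convergence of the series for
  \<open>\<sigma>\<close> close to 1 from the right as a clause of its own; \<open>Suc\<close> makes
  the index start at 1.\<close>

theorem theorem2:
  fixes a :: "nat \<Rightarrow> complex" and C :: complex
  shows "(((\<lambda>n. (\<Sum>k=1..n. a k * of_nat (n div k)) / of_nat n) \<longlonglongrightarrow> C)
          \<longleftrightarrow>
          ((\<lambda>n. \<Sum>k=1..n. a k * of_nat (n div k) * of_real (ln (real k)))
              \<in> o(\<lambda>n. of_real (real n * ln (real n))) \<and>
           (\<forall>\<^sub>F \<sigma> in at_right 1. summable (\<lambda>m. a (Suc m) / of_real (real (Suc m) powr \<sigma>))) \<and>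
           ((\<lambda>\<sigma>. \<Sum>m. a (Suc m) / of_real (real (Suc m) powr \<sigma>)) \<longlongrightarrow> C) (at_right 1)))
       \<and> ((\<lambda>n. \<Sum>k=1..n. a k * of_nat (n div k) * of_real (ln (real k)))
              \<in> o(\<lambda>n. of_real (real n * ln (real n)))
           \<longrightarrow> (\<forall>\<sigma>::real. \<sigma> > 1 \<longrightarrow> summable (\<lambda>m. a (Suc m) / of_real (real (Suc m) powr \<sigma>))))"
proof -
  have S_eq: "(\<lambda>n. (\<Sum>k=1..n. a k * of_nat (n div k)) / of_nat n) = (\<lambda>n. ingham_sum a n / of_nat n)"
    by (simp add: ingham_sum_def)
  have T_eq: "(\<lambda>n. \<Sum>k=1..n. a k * of_nat (n div k) * of_real (ln (real k))) = ingham_sum (\<lambda>k. a k * of_real (ln (real k)))"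
    by (auto simp: ingham_sum_def mult_ac)
  have A_eq: "(\<lambda>\<sigma>. \<Sum>m. a (Suc m) / of_real (real (Suc m) powr \<sigma>)) = dirichlet_sum a"
    by (auto simp: dirichlet_sum_def)
  let ?o = "ingham_sum (\<lambda>k. a k * of_real (ln (real k))) \<in> o(\<lambda>n. of_real (real n * ln (real n)))"
  have conv: "summable (\<lambda>m. a (Suc m) / of_real (real (Suc m) powr \<sigma>))" if ?o "\<sigma> > 1" for \<sigma>
    using dirichlet_series_converges[OF that] unfolding dirichlet_sums_iff[symmetric] summable_def .
  have "(\<lambda>n. ingham_sum a n / of_nat n) \<longlonglongrightarrow> C \<longleftrightarrow>
     ?o \<and> (\<forall>\<^sub>F \<sigma> in at_right 1. summable (\<lambda>m. a (Suc m) / of_real (real (Suc m) powr \<sigma>))) \<and> (dirichlet_sum a \<longlongrightarrow> C) (at_right 1)"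
  proof (intro iffI)
    assume S: "(\<lambda>n. ingham_sum a n / of_nat n) \<longlonglongrightarrow> C"
    have o: ?o by (rule smallo_log_sum_if_mean[OF S])
    moreover have "\<forall>\<^sub>F \<sigma> in at_right 1. summable (\<lambda>m. a (Suc m) / of_real (real (Suc m) powr \<sigma>))"
      using conv[OF o] by (intro eventually_at_rightI[of 1 2]) auto
    moreover have "(dirichlet_sum a \<longlongrightarrow> C) (at_right 1)"
      by (rule dirichlet_sum_tendsto_if_mean[OF S conv[OF o]])
    ultimately show "?o \<and> (\<forall>\<^sub>F \<sigma> in at_right 1. summable (\<lambda>m. a (Suc m) / of_real (real (Suc m) powr \<sigma>))) \<and> (dirichlet_sum a \<longlongrightarrow> C) (at_right 1)"
      by blast
  next
    assume "?o \<and> (\<forall>\<^sub>F \<sigma> in at_right 1. summable (\<lambda>m. a (Suc m) / of_real (real (Suc m) powr \<sigma>))) \<and> (dirichlet_sum a \<longlongrightarrow> C) (at_right 1)"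
    hence o: ?o and A: "(dirichlet_sum a \<longlongrightarrow> C) (at_right 1)" by auto
    have "filterlim (\<lambda>n. 1 + 1 / ln (real n)) (at_right 1) sequentially" by real_asymp
    from tendsto_diff[OF filterlim_compose[OF A this] dirichlet_sum_mean_close[OF o]]
    show "(\<lambda>n. ingham_sum a n / of_nat n) \<longlonglongrightarrow> C" by simp
  qed
  thus ?thesis unfolding S_eq T_eq A_eq using conv by blast
qed

end
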